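(* With at most one exception, every coarse integer $m>10^{160}$ has the following property: for every primitive real Dirichlet character $\chi$ modulo $m$ there exists a prime $p\le 4m^{1/2}/\log m$ with $\chi(p)=1$.
   Context: A positive integer $m$ is called coarse if $m$ is either prime or a product of two distinct primes each exceeding $m^{3/8}\log m$. $\log$ is the natural logarithm. *)

theory Defs
  imports Complex_Main "HOL-Computational_Algebra.Primes"
begin

definition coarse :: "nat \<Rightarrow> bool" where
  "coarse m \<longleftrightarrow>
     prime m \<or>
     (\<exists>p q. prime p \<and> prime q \<and> p \<noteq> q \<and> m = p * q \<and>
        real p > real m powr (3 / 8) * ln (real m) \<and>
        real q > real m powr (3 / 8) * ln (real m))"

text \<open>Dirichlet characters are regarded as functions on all integers, extended by \<open>0\<close> to the
  integers that are not coprime to the modulus.\<close>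

definition dirichlet_character :: "nat \<Rightarrow> (int \<Rightarrow> complex) \<Rightarrow> bool" where
  "dirichlet_character m \<chi> \<longleftrightarrow>
     m > 0 \<and>
     (\<forall>a. \<chi> (a + int m) = \<chi> a) \<and>
     (\<forall>a b. \<chi> (a * b) = \<chi> a * \<chi> b) \<and>
     (\<forall>a. \<chi> a = 0 \<longleftrightarrow> \<not> coprime a (int m))"

definition primitive_character :: "nat \<Rightarrow> (int \<Rightarrow> complex) \<Rightarrow> bool" where
  "primitive_character m \<chi> \<longleftrightarrow>
     dirichlet_character m \<chi> \<and>
     \<not> (\<exists>d \<psi>. d dvd m \<and> d < m \<and> dirichlet_character d \<psi> \<and>
          (\<forall>a. coprime a (int m) \<longrightarrow> \<chi> a = \<psi> a))"

definition real_character :: "(int \<Rightarrow> complex) \<Rightarrow> bool" where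
  "real_character \<chi> \<longleftrightarrow> range \<chi> \<subseteq> \<real>"

end

theory Submission
  imports Defs "Berlekamp_Zassenhaus.Finite_Field"
    "HOL-Computational_Algebra.Computational_Algebra" "HOL-Number_Theory.Number_Theory"
begin

text \<open>
  Let \<open>\<chi>\<close> be a primitive real character modulo a coarse \<open>m\<close> with \<open>\<chi>(p) \<noteq> 1\<close> for all primes \<open>p \<le> y = 4 \<surd>m / log m\<close>, and let
  \<open>r(n)\<close> be the sum of \<open>\<chi>(d)\<close> over the divisors \<open>d\<close> of \<open>n\<close>. Up to \<open>y\<close> the function \<open>r\<close> is essentially supported on squares.
  Stepanov's method bounds sums of \<open>\<chi>\<close> over values of quartic polynomials, which yields a Burgess bound for short sums of
  \<open>\<chi>\<close> (the size condition on the factors of \<open>m\<close> makes the shifts coprime to \<open>m\<close>); with the hyperbola method it follows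
  that \<open>r\<close> has mean value \<open>O(m\<^sup>-\<^sup>1\<^sup>/\<^sup>4\<^sup>0)\<close> up to every \<open>N\<close> between \<open>y\<close> and \<open>m\<^sup>2\<close>. This amounts to an extremely small value
  of \<open>L(1, \<chi>)\<close>, and two such moduli \<open>m\<^sub>1 < m\<^sub>2\<close> contradict each other as in the Siegel-Tatuzawa theorem: the product
  \<open>\<zeta>(s) L(s, \<chi>\<^sub>1) L(s, \<chi>\<^sub>2) L(s, \<chi>\<^sub>1\<chi>\<^sub>2)\<close> has nonnegative coefficients and constant coefficient 1, but its truncated value at a
  point \<open>s = 1 - \<eta>\<close> determined by \<open>\<chi>\<^sub>1\<close> is smaller than 1 because \<open>L(1, \<chi>\<^sub>2)\<close> is tiny. In all estimates \<open>t = m\<^sup>1\<^sup>/\<^sup>2\<^sup>4\<^sup>0\<close>.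
\<close>

section \<open>Stepanov's method for quartic polynomials\<close>

text \<open>All losses and savings are measured in powers of t. The Burgess bound is nontrivial from
  length about m^(3/8) on, well below y, so the mean value of r can be compared at y, where it is
  tiny, and at larger N; the relative error is of order log m / t^10, and log m is below t^4, which
  leaves t^-6 = m^(-1/40). Nothing relates the sizes of the two moduli. Therefore \<eta>, which
  comes from the smaller modulus, is small against 1 / log m1 but perhaps not against 1 / log m2,
  and the factor X^\<eta> with X = m2^7 may grow. It stays below sqrt t for the t of the larger
  modulus, whereas the truncated L(1, \<chi>2), of order t^-6, still saves t^-2 after a logarithm is
  lost. What is left is t^(3/2) \<le> 8, and m > 10^160 means t^3 > 100. Every L-value is replaced
  by a finite partial sum and every analytic step by the hyperbola method, so neither zeros nor
  analytic continuation occur.\<close>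

lemma power_card_mod_ring: "(x::'a::prime_card mod_ring) ^ CARD('a) = x"
  using finite_field_power_card_eq_same[of x] by simp

text \<open>Frobenius is additive and fixes the constants of the prime field: (a + X h)^p = a + X^p
  h^p.\<close>

lemma monom_dvd_power_card_diff:
  fixes f :: "'a::prime_card mod_ring poly"
  shows "monom 1 CARD('a) dvd f ^ CARD('a) - [:coeff f 0:]"
proof -
  obtain a h where f: "f = pCons a h" by (cases f)
  have "f ^ CARD('a) = ([:a:] + monom 1 1 * h) ^ CHAR('a mod_ring poly)"
    by (simp add: f monom_Suc monom_0 flip: one_pCons)
  also have "\<dots> = [:a:] ^ CHAR('a mod_ring poly) + (monom 1 1 * h) ^ CHAR('a mod_ring poly)"
    by (rule freshmans_dream) (use prime_card in auto)
  also have "\<dots> = [:a:] + monom 1 CARD('a) * h ^ CARD('a)"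
    by (simp add: power_mult_distrib monom_power poly_const_pow power_card_mod_ring)
  finally show ?thesis by (simp add: f)
qed

lemma card_degree_le:
  "card {q::'a::prime_card mod_ring poly. degree q \<le> n} = CARD('a) ^ Suc n
    \<and> finite {q::'a mod_ring poly. degree q \<le> n}"
proof (induction n)
  case 0
  have "{q::'a mod_ring poly. degree q \<le> 0} = range (\<lambda>a. [:a:])"
    by (auto elim: degree_eq_zeroE)
  then show ?case by (simp add: card_image inj_def)
next
  case (Suc n)
  let ?D = "\<lambda>n. {q::'a mod_ring poly. degree q \<le> n}"
  have "q \<in> (\<lambda>(a, q). pCons a q) ` (UNIV \<times> ?D n)" if "q \<in> ?D (Suc n)" for q
  proof -
    obtain a h where "q = pCons a h" by (cases q)
    then show ?thesis using that by (force simp: degree_pCons_eq_if split: if_splits)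
  qed
  then have eq: "?D (Suc n) = (\<lambda>(a, q). pCons a q) ` (UNIV \<times> ?D n)"
    by (auto intro: order.trans[OF degree_pCons_le])
  have inj: "inj_on (\<lambda>(a, q). pCons a q) (UNIV \<times> ?D n)"
    by (auto simp: inj_on_def)
  show ?case
    unfolding eq using Suc by (simp add: card_image[OF inj] card_cartesian_product)
qed

text \<open>Squaring eliminates the unknown power: modulo \<open>X\<^sup>p\<close> one has \<open>f\<^sup>2\<^sup>c\<^sup>+\<^sup>1 = f\<^sup>p = f(0)\<close>, so the lowest block of a
  vanishing combination satisfies \<open>r\<^sub>j\<^sup>2 f = f(0) s\<^sub>j\<^sup>2\<close>, whose two sides vanish at \<open>a\<close> to orders of different parity.\<close>

lemma stepanov_independence:
  fixes f :: "'a::prime_card mod_ring poly"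
  assumes f: "degree f \<le> 4" "coeff f 0 \<noteq> 0" and odd: "odd (Polynomial.order a f)"
    and p: "CARD('a) = 2 * c + 1" "c \<ge> 2"
    and deg: "\<And>j. j < J \<Longrightarrow> degree (r j) \<le> c - 2" "\<And>j. j < J \<Longrightarrow> degree (s j) \<le> c - 2"
    and z: "(\<Sum>j<J. (r j + s j * f ^ c) * monom 1 (j * CARD('a))) = 0"
    and j: "j < J"
  shows "r j = 0 \<and> s j = 0"
  using j
proof (induction j rule: less_induct)
  case (less j)
  let ?p = "CARD('a)"
  let ?t = "\<lambda>j. (r j + s j * f ^ c) * monom 1 (j * ?p)"
  have f0: "f \<noteq> 0" using f by auto
  have S: "{..<J} = {..<j} \<union> insert j {j<..<J}" using less.prems by auto
  have "sum ?t {..<J} = sum ?t {..<j} + sum ?t (insert j {j<..<J})"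
    unfolding S by (rule sum.union_disjoint) auto
  also have "sum ?t (insert j {j<..<J}) = ?t j + (\<Sum>i\<in>{j<..<J}. ?t i)"
    by (rule sum.insert) auto
  finally have "(\<Sum>j<J. ?t j) = (\<Sum>i<j. ?t i) + (?t j + (\<Sum>i\<in>{j<..<J}. ?t i))" .
  moreover have "(\<Sum>i<j. ?t i) = 0" using less.IH less.prems by (intro sum.neutral) auto
  moreover have "(\<Sum>i\<in>{j<..<J}. ?t i) = monom 1 (j * ?p) * (monom 1 ?p *
      (\<Sum>i\<in>{j<..<J}. (r i + s i * f ^ c) * monom 1 ((i - j - 1) * ?p)))"
    unfolding sum_distrib_left
  proof (rule sum.cong[OF refl])
    fix i assume "i \<in> {j<..<J}"
    then have "i * ?p = j * ?p + (?p + (i - j - 1) * ?p)"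
      by (metis (no_types, opaque_lifting) add.assoc add_mult_distrib diff_diff_left greaterThanLessThan_iff le_add_diff_inverse less_iff_succ_less_eq mult_1)
    then have "monom (1::'a mod_ring) (i * ?p) = monom 1 (j * ?p) * (monom 1 ?p * monom 1 ((i - j - 1) * ?p))"
      by (simp add: mult_monom)
    then show "?t i = monom 1 (j * ?p) * (monom 1 ?p * ((r i + s i * f ^ c) * monom 1 ((i - j - 1) * ?p)))"
      by (simp add: algebra_simps)
  qed
  ultimately have "monom 1 (j * ?p) * (r j + s j * f ^ c + monom 1 ?p *
      (\<Sum>i\<in>{j<..<J}. (r i + s i * f ^ c) * monom 1 ((i - j - 1) * ?p))) = 0"
    using z by (simp add: algebra_simps)
  then have "r j + s j * f ^ c = - (monom 1 ?p *
      (\<Sum>i\<in>{j<..<J}. (r i + s i * f ^ c) * monom 1 ((i - j - 1) * ?p)))"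
    by (simp add: add_eq_0_iff2)
  then have d1: "monom 1 ?p dvd r j + s j * f ^ c" by simp
  have fp: "f ^ ?p = f ^ c * f ^ c * f" by (simp add: p mult_2 power_add)
  have "(r j)\<^sup>2 * f - smult (coeff f 0) ((s j)\<^sup>2)
      = (r j + s j * f ^ c) * ((r j - s j * f ^ c) * f) + (s j)\<^sup>2 * (f ^ ?p - [:coeff f 0:])"
    unfolding fp by (simp add: power2_eq_square algebra_simps)
  moreover have "monom 1 ?p dvd \<dots>"
    by (intro dvd_add dvd_mult2[OF d1] dvd_mult[OF monom_dvd_power_card_diff])
  ultimately have d2: "monom 1 ?p dvd (r j)\<^sup>2 * f - smult (coeff f 0) ((s j)\<^sup>2)" by simp
  \<comment> \<open>This is the purpose of the degree bound \<open>c - 2\<close>: both sides have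
    degree at most 2 (c - 2) + 4 = 2 c, one less than p, so a difference divisible by X^p must be
    0.\<close>
  have "degree ((r j)\<^sup>2 * f) \<le> 2 * c"
    using degree_mult_le[of "(r j)\<^sup>2" f] degree_power_le[of "r j" 2] deg(1)[OF less.prems] f p by linarith
  moreover have "degree (smult (coeff f 0) ((s j)\<^sup>2)) \<le> 2 * c"
    using degree_smult_le[of "coeff f 0" "(s j)\<^sup>2"] degree_power_le[of "s j" 2] deg(2)[OF less.prems] p by linarith
  ultimately have d3: "degree ((r j)\<^sup>2 * f - smult (coeff f 0) ((s j)\<^sup>2)) \<le> 2 * c"
    by (rule degree_diff_le)
  have e: "(r j)\<^sup>2 * f = smult (coeff f 0) ((s j)\<^sup>2)"
  proof (rule ccontr)
    assume "\<not> ?thesis"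
    then have "degree (monom (1::'a mod_ring) ?p) \<le> degree ((r j)\<^sup>2 * f - smult (coeff f 0) ((s j)\<^sup>2))"
      using d2 by (intro dvd_imp_degree_le) auto
    then show False using d3 p by (simp add: degree_monom_eq)
  qed
  show ?case
  proof (rule ccontr)
    assume "\<not> ?case"
    then have n0: "r j \<noteq> 0" "s j \<noteq> 0" using e f f0 by auto
    have "Polynomial.order a ((r j)\<^sup>2 * f) = Polynomial.order a ((s j)\<^sup>2)"
      unfolding e using f by (simp add: order_smult)
    then have "2 * Polynomial.order a (r j) + Polynomial.order a f = 2 * Polynomial.order a (s j)"
      using n0 f0 by (simp add: order_mult power2_eq_square)
    then show False using odd by presburger
  qed
qed

text \<open>The polynomial \<open>D\<close> with \<open>(f\<^sup>u q)\<^sup>(\<^sup>k\<^sup>) = f\<^sup>u\<^sup>-\<^sup>k D\<close>; only the residue of \<open>u\<close> in the field matters, so that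
  exponents congruent modulo \<open>p\<close> share it.\<close>

fun deriv_factor :: "'b::field poly \<Rightarrow> 'b \<Rightarrow> nat \<Rightarrow> 'b poly \<Rightarrow> 'b poly" where
  "deriv_factor f u 0 q = q"
| "deriv_factor f u (Suc k) q = smult (u - of_nat k) (pderiv f * deriv_factor f u k q) + f * pderiv (deriv_factor f u k q)"

lemma deriv_factor_diff:
  "deriv_factor f u k (q - q') = deriv_factor f u k q - deriv_factor f u k q'"
  by (induction k) (simp_all add: pderiv_diff right_diff_distrib smult_diff_right)

lemma degree_deriv_factor:
  assumes "degree f \<le> 4"
  shows "degree (deriv_factor f u k q) \<le> degree q + 3 * k"
proof (induction k)
  case (Suc k)
  let ?d = "deriv_factor f u k q"
  have f': "degree (pderiv f) \<le> 3" using assms degree_pderiv_le[of f] by linarith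
  have "degree (smult (u - of_nat k) (pderiv f * ?d)) \<le> degree q + 3 * Suc k"
    using degree_smult_le[of "u - of_nat k" "pderiv f * ?d"] degree_mult_le[of "pderiv f" ?d] f' Suc by simp
  moreover have "degree (f * pderiv ?d) \<le> degree q + 3 * Suc k"
  \<comment> \<open>Multiplication by \<open>f\<close> adds 4 and differentiation takes 1 back,
    except for a constant, whose degree cannot drop but whose derivative is 0.\<close>
  proof (cases "degree ?d = 0")
    case True
    then show ?thesis by (auto elim!: degree_eq_zeroE simp: pderiv_pCons)
  next
    case False
    then show ?thesis
      using degree_mult_le[of f "pderiv ?d"] degree_pderiv_le[of ?d] assms Suc by simp
  qed
  ultimately show ?case by (simp add: degree_add_le)
qed simp

lemma pderiv_monom_card [simp]:
  "pderiv (monom (1::'a::prime_card mod_ring) (j * CARD('a))) = 0"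
  by (simp add: pderiv_monom)

text \<open>In characteristic p the monomial X^(j p) has derivative 0 and behaves like a constant,
  so all derivatives fall on the other two factors.\<close>

lemma higher_pderiv_factor:
  fixes f :: "'a::prime_card mod_ring poly"
  assumes "k \<le> u"
  shows "(pderiv ^^ k) (f ^ u * q * monom 1 (j * CARD('a)))
    = f ^ (u - k) * deriv_factor f (of_nat u) k q * monom 1 (j * CARD('a))"
  using assms
proof (induction k)
  case (Suc k)
  then obtain e where e: "u - k = Suc e" by (metis Suc_diff_Suc Suc_le_eq)
  then have u: "(of_nat u :: 'a mod_ring) - of_nat k = of_nat (Suc e)" and e': "u - Suc k = e"
    using Suc.prems by (metis of_nat_diff Suc_leD, arith)
  have "(pderiv ^^ Suc k) (f ^ u * q * monom 1 (j * CARD('a)))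
      = pderiv (f ^ Suc e * deriv_factor f (of_nat u) k q * monom 1 (j * CARD('a)))"
    using Suc e by simp
  also have "\<dots> = f ^ e * deriv_factor f (of_nat u) (Suc k) q * monom 1 (j * CARD('a))"
    by (simp only: pderiv_mult pderiv_power_Suc pderiv_monom_card deriv_factor.simps u)
       (simp add: algebra_simps)
  finally show ?case by (simp only: e')
qed simp

text \<open>The constant \<open>b\<close> is i (i - 1) ... (i - k + 1), nonzero in the field because
  i < p.\<close>

lemma higher_pderiv_linear_power:
  fixes Q :: "'a::prime_card mod_ring poly"
  assumes "k \<le> i" "i < CARD('a)"
  shows "\<exists>b R. b \<noteq> 0 \<and> (pderiv ^^ k) ([:-x, 1:] ^ i * Q) = [:-x, 1:] ^ (i - k) * ([:b:] * Q + [:-x, 1:] * R)"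
  using assms(1)
proof (induction k)
  case 0
  show ?case by (rule exI[of _ 1], rule exI[of _ 0]) simp
next
  case (Suc k)
  define L where "L = [:-x, 1:]"
  have L: "pderiv L = 1" by (simp add: L_def pderiv_pCons)
  obtain b R where b: "b \<noteq> 0" and eq: "(pderiv ^^ k) (L ^ i * Q) = L ^ (i - k) * ([:b:] * Q + L * R)"
    using Suc unfolding L_def by auto
  obtain e where e: "i - k = Suc e" "i - Suc k = e" using Suc.prems by (metis Suc_diff_Suc Suc_le_eq diff_Suc_Suc)
  have "Suc e < CARD('a)" using e assms(2) by linarith
  then have n0: "(of_nat (Suc e) :: 'a mod_ring) \<noteq> 0"
    using of_nat_0_mod_ring_dvd[of "Suc e"] by (metis dvd_imp_le not_less zero_less_Suc)
  define N where "N = [:of_nat (Suc e) :: 'a mod_ring:]"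
  define C where "C = [:b:]"
  have N: "smult (of_nat (Suc e)) q = N * q" for q by (simp add: N_def)
  have C: "pderiv C = 0" by (simp add: C_def pderiv_pCons)
  have "(pderiv ^^ Suc k) (L ^ i * Q) = pderiv (L ^ Suc e * (C * Q + L * R))"
    using eq e by (simp add: C_def)
  also have "\<dots> = L ^ e * ((N * C) * Q + L * (N * R + C * pderiv Q + R + L * pderiv R))"
    by (simp only: pderiv_mult pderiv_power_Suc pderiv_add L N C)
       (simp add: algebra_simps)
  also have "N * C = [:of_nat (Suc e) * b:]" by (simp add: N_def C_def)
  finally show ?case unfolding e(2) L_def using b n0 by (metis no_zero_divisors)
qed

text \<open>If the order i were below \<open>l\<close>, the i-th derivative at x would be a nonzero
  constant times the nonzero value of the cofactor; the constant survives in characteristic p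
  because i < l \<le> p.\<close>

lemma order_ge_if_higher_pderiv_zero:
  fixes P :: "'a::prime_card mod_ring poly"
  assumes P: "P \<noteq> 0" and l: "l \<le> CARD('a)"
    and z: "\<And>k. k < l \<Longrightarrow> poly ((pderiv ^^ k) P) x = 0"
  shows "l \<le> Polynomial.order x P"
proof (rule ccontr)
  assume "\<not> ?thesis"
  define i where "i = Polynomial.order x P"
  with \<open>\<not> ?thesis\<close> have i: "i < l" by simp
  obtain Q where Q: "P = [:-x, 1:] ^ i * Q" "\<not> [:-x, 1:] dvd Q"
    using order_decomp[OF P, of x] i_def by auto
  obtain b R where b: "b \<noteq> 0" "(pderiv ^^ i) P = [:b:] * Q + [:-x, 1:] * R"
    using higher_pderiv_linear_power[of i i x Q] i l Q by auto
  then have "poly Q x = 0" using z[OF i] by simp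
  then show False using Q(2) by (simp add: poly_eq_0_iff_dvd)
qed


text \<open>Where \<open>f\<^sup>c = a\<close>, the derivatives of \<open>P = f\<^sup>l \<Sum>\<^sub>j (r\<^sub>j + s\<^sub>j f\<^sup>c) X\<^sup>j\<^sup>p\<close> take the values of polynomials of small degree,
  because \<open>x\<^sup>p = x\<close>; the pigeonhole principle provides coefficients for which all of these vanish identically.\<close>

lemma stepanov_auxiliary_polynomial:
  fixes f :: "'a::prime_card mod_ring poly"
  assumes f: "degree f \<le> 4" "coeff f 0 \<noteq> 0" and odd: "odd (Polynomial.order b f)"
    and p: "CARD('a) = 2 * c + 1" "c \<ge> 2"
    and dim: "(\<Sum>k<l. c - 2 + 3 * k + J) < 2 * J * (c - 1)"
  obtains P where "P \<noteq> 0" "degree P \<le> 4 * l + (c - 2) + 4 * c + (J - 1) * CARD('a)"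
    "\<And>x k. poly f x ^ c = a \<Longrightarrow> k < l \<Longrightarrow> poly ((pderiv ^^ k) P) x = 0"
proof -
  let ?p = "CARD('a)"
  have J: "J \<ge> 1" using dim by (cases J) auto
  \<comment> \<open>Indices below \<open>J\<close> carry the polynomials r_j, the indices
    \<open>J + j\<close> the polynomials s_j.\<close>
  define dom where "dom = PiE {..<2 * J} (\<lambda>_. {q::'a mod_ring poly. degree q \<le> c - 2})"
  define cod where "cod = PiE {..<l} (\<lambda>k. {q::'a mod_ring poly. degree q \<le> c - 2 + 3 * k + (J - 1)})"
  \<comment> \<open>At a point with f^c = a the k-th derivative of the combination belonging to
    \<open>t\<close> is f^(l - k) times \<open>\<sigma> t k\<close>: there f^c is the constant
    \<open>a\<close>, and X^(j p) takes the same value as X^j.\<close>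
  define \<sigma> where "\<sigma> t k = (\<Sum>j<J. (deriv_factor f (of_nat l) k (t j)
      + smult a (deriv_factor f (of_nat (l + c)) k (t (J + j)))) * monom 1 j)" for t k
  define \<Phi> where "\<Phi> t = (\<lambda>k\<in>{..<l}. \<sigma> t k)" for t
  have fin: "finite cod" unfolding cod_def by (intro finite_PiE) (auto simp: card_degree_le)
  have "card dom = (?p ^ Suc (c - 2)) ^ (2 * J)"
    unfolding dom_def by (simp add: card_PiE card_degree_le del: power_Suc)
  also have "Suc (c - 2) = c - 1" using p by simp
  also have "(?p ^ (c - 1)) ^ (2 * J) = ?p ^ (2 * J * (c - 1))"
    by (simp only: power_mult[symmetric] mult.commute)
  finally have cd: "card dom = ?p ^ (2 * J * (c - 1))" .
  \<comment> \<open>Degree at most d means d + 1 coefficients, so the exponent counts linear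
    conditions, as the exponent of \<open>card dom\<close> counts unknowns; \<open>dim\<close> says
    that there are more unknowns.\<close>
  have "card cod = (\<Prod>k<l. ?p ^ (c - 2 + 3 * k + J))"
    unfolding cod_def using J by (simp add: card_PiE card_degree_le flip: power_Suc)
  also have "\<dots> = ?p ^ (\<Sum>k<l. c - 2 + 3 * k + J)" by (simp add: power_sum)
  also have "\<dots> < card dom" unfolding cd using dim p by (intro power_strict_increasing) auto
  finally have lt: "card cod < card dom" .
  have deg_term: "degree (deriv_factor f u k (t i) * monom 1 j) \<le> c - 2 + 3 * k + (J - 1)"
    if "t \<in> dom" "i < 2 * J" "j < J" for u k t i j
  proof -
    have "degree (t i) \<le> c - 2" using that by (auto simp: dom_def)
    then show ?thesis
      using degree_mult_le[of "deriv_factor f u k (t i)" "monom 1 j"] degree_deriv_factor[OF f(1), of u k "t i"]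
        degree_monom_le[of "1::'a mod_ring" j] that(3) by linarith
  qed
  have "degree (\<sigma> t k) \<le> c - 2 + 3 * k + (J - 1)" if t: "t \<in> dom" for t k
    unfolding \<sigma>_def
  proof (rule degree_sum_le)
    fix j assume "j \<in> {..<J}"
    then have j: "j < J" by simp
    have "degree (deriv_factor f (of_nat l) k (t j) * monom 1 j) \<le> c - 2 + 3 * k + (J - 1)"
      using deg_term[OF t, of j j] j by simp
    moreover have "degree (smult a (deriv_factor f (of_nat (l + c)) k (t (J + j)) * monom 1 j)) \<le> c - 2 + 3 * k + (J - 1)"
      using deg_term[OF t, of "J + j" j] j by (intro order.trans[OF degree_smult_le]) auto
    ultimately show "degree ((deriv_factor f (of_nat l) k (t j)
        + smult a (deriv_factor f (of_nat (l + c)) k (t (J + j)))) * monom 1 j) \<le> c - 2 + 3 * k + (J - 1)"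
      by (simp add: distrib_right degree_add_le)
  qed simp
  then have "\<Phi> ` dom \<subseteq> cod" by (auto simp: \<Phi>_def cod_def split: if_splits)
  then have "card (\<Phi> ` dom) < card dom" using lt card_mono[OF fin] le_less_trans by blast
  then have "\<not> inj_on \<Phi> dom" by (rule pigeonhole)
  then obtain t t' where t: "t \<in> dom" "t' \<in> dom" "t \<noteq> t'" "\<Phi> t = \<Phi> t'" by (auto simp: inj_on_def)
  define r where "r j = t j - t' j" for j
  define s where "s j = t (J + j) - t' (J + j)" for j
  \<comment> \<open>Two tuples with the same image differ by one that satisfies all conditions. The
    factor f^l leaves f^(l - k), with an exponent that is not negative, after k < l
    derivatives.\<close>
  define P where "P = (\<Sum>j<J. f ^ l * r j * monom 1 (j * ?p) + f ^ (l + c) * s j * monom 1 (j * ?p))"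
  have dt: "degree (u i) \<le> c - 2" if "u \<in> dom" "i < 2 * J" for u i
    using PiE_mem[OF that(1)[unfolded dom_def], of i] that(2) by simp
  have dr: "degree (r j) \<le> c - 2" "degree (s j) \<le> c - 2" if "j < J" for j
    unfolding r_def s_def using that by (auto intro!: degree_diff_le dt[OF t(1)] dt[OF t(2)])
  have ne: "\<exists>j<J. r j \<noteq> 0 \<or> s j \<noteq> 0"
  proof (rule ccontr)
    assume *: "\<not> ?thesis"
    have "t i = t' i" for i
    proof (cases "i < J")
      case True then show ?thesis using * by (auto simp: r_def)
    next
      case False
      show ?thesis
      proof (cases "i < 2 * J")
        case True
        then have "i - J < J" "i = J + (i - J)" using False by auto
        then show ?thesis using * by (metis s_def right_minus_eq)
      next
        case False
        then show ?thesis using t(1,2) by (auto simp: dom_def PiE_def extensional_def)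
      qed
    qed
    then show False using t(3) by auto
  qed
  have P: "P = f ^ l * (\<Sum>j<J. (r j + s j * f ^ c) * monom 1 (j * ?p))"
    unfolding P_def sum_distrib_left by (intro sum.cong) (auto simp: algebra_simps power_add)
  show ?thesis
  proof (rule that)
    show "P \<noteq> 0"
    proof
      assume "P = 0"
      moreover have "f ^ l \<noteq> 0" using f(2) by auto
      ultimately have z: "(\<Sum>j<J. (r j + s j * f ^ c) * monom 1 (j * ?p)) = 0"
        unfolding P using mult_eq_0_iff by blast
      have "r j = 0 \<and> s j = 0" if "j < J" for j
        by (rule stepanov_independence[OF f odd p dr z that])
      then show False using ne by blast
    qed
    show "degree P \<le> 4 * l + (c - 2) + 4 * c + (J - 1) * ?p"
      unfolding P_def
    proof (intro degree_sum_le degree_add_le)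
      fix j assume "j \<in> {..<J}"
      then have j: "j < J" by simp
      have m: "degree (monom (1::'a mod_ring) (j * ?p)) \<le> (J - 1) * ?p"
        using j by (intro order.trans[OF degree_monom_le] mult_right_mono) auto
      have fl: "degree (f ^ k) \<le> 4 * k" for k
        using degree_power_le[of f k] f(1) by (meson mult_le_mono1 order.trans)
      show "degree (f ^ l * r j * monom 1 (j * ?p)) \<le> 4 * l + (c - 2) + 4 * c + (J - 1) * ?p"
        using degree_mult_le[of "f ^ l * r j" "monom 1 (j * ?p)"] degree_mult_le[of "f ^ l" "r j"]
          fl[of l] dr(1)[OF j] m by linarith
      have fl2: "degree (f ^ (l + c)) \<le> 4 * l + 4 * c" using fl[of "l + c"] by simp
      show "degree (f ^ (l + c) * s j * monom 1 (j * ?p)) \<le> 4 * l + (c - 2) + 4 * c + (J - 1) * ?p"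
        using degree_mult_le[of "f ^ (l + c) * s j" "monom 1 (j * ?p)"] degree_mult_le[of "f ^ (l + c)" "s j"]
          fl2 dr(2)[OF j] m by linarith
    qed simp
    fix x k assume x: "poly f x ^ c = a" and k: "k < l"
    have hsum: "(pderiv ^^ k) (\<Sum>j\<in>S. g j) = (\<Sum>j\<in>S. (pderiv ^^ k) (g j))" for S :: "nat set" and g :: "nat \<Rightarrow> 'a mod_ring poly"
      by (induction k) (simp_all add: pderiv_sum)
    have hadd: "(pderiv ^^ k) (g + h) = (pderiv ^^ k) g + (pderiv ^^ k) h" for g h :: "'a mod_ring poly"
      by (induction k) (simp_all add: pderiv_add)
    have xp: "x ^ (j * ?p) = x ^ j" for j
      by (metis mult.commute power_card_mod_ring power_mult)
    have "poly ((pderiv ^^ k) P) x = (\<Sum>j<J. poly f x ^ (l - k) * (poly (deriv_factor f (of_nat l) k (r j)) x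
        + a * poly (deriv_factor f (of_nat (l + c)) k (s j)) x) * x ^ j)"
      unfolding P_def hsum hadd poly_sum
    proof (intro sum.cong refl)
      fix j
      have lck: "l + c - k = l - k + c" using k by simp
      have h1: "(pderiv ^^ k) (f ^ l * r j * monom 1 (j * ?p))
          = f ^ (l - k) * deriv_factor f (of_nat l) k (r j) * monom 1 (j * ?p)"
        using k by (intro higher_pderiv_factor) simp
      have h2: "(pderiv ^^ k) (f ^ (l + c) * s j * monom 1 (j * ?p))
          = f ^ (l - k) * f ^ c * deriv_factor f (of_nat (l + c)) k (s j) * monom 1 (j * ?p)"
        using higher_pderiv_factor[of k "l + c" f "s j" j] k by (simp only: lck power_add trans_le_add1 less_imp_le)
      show "poly ((pderiv ^^ k) (f ^ l * r j * monom 1 (j * ?p)) + (pderiv ^^ k) (f ^ (l + c) * s j * monom 1 (j * ?p))) x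
        = poly f x ^ (l - k) * (poly (deriv_factor f (of_nat l) k (r j)) x
        + a * poly (deriv_factor f (of_nat (l + c)) k (s j)) x) * x ^ j"
        unfolding h1 h2 by (simp add: x poly_monom xp algebra_simps del: of_nat_add)
    qed
    also have "\<dots> = poly f x ^ (l - k) * (poly (\<sigma> t k) x - poly (\<sigma> t' k) x)"
      unfolding \<sigma>_def poly_sum r_def s_def deriv_factor_diff sum_distrib_left sum_subtractf[symmetric]
      by (intro sum.cong refl) (simp add: poly_monom algebra_simps)
    also have "\<sigma> t k = \<sigma> t' k" using fun_cong[OF t(4), of k] k by (simp add: \<Phi>_def)
    finally show "poly ((pderiv ^^ k) P) x = 0" by simp
  qed
qed

text \<open>Every counted point is a zero of order at least \<open>l\<close> of the auxiliary
  polynomial, and the orders of all zeros add up to at most its degree.\<close>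

lemma stepanov_count:
  fixes f :: "'a::prime_card mod_ring poly"
  assumes f: "degree f \<le> 4" "coeff f 0 \<noteq> 0" and odd: "odd (Polynomial.order b f)"
    and p: "CARD('a) = 2 * c + 1" "c \<ge> 2" and l: "l \<le> CARD('a)"
    and dim: "(\<Sum>k<l. c - 2 + 3 * k + J) < 2 * J * (c - 1)"
  shows "card {x. poly f x ^ c = a} * l \<le> 4 * l + (c - 2) + 4 * c + (J - 1) * CARD('a)"
proof (cases "l = 0")
  case False
  obtain P where P: "P \<noteq> 0" "degree P \<le> 4 * l + (c - 2) + 4 * c + (J - 1) * CARD('a)"
    "\<And>x k. poly f x ^ c = a \<Longrightarrow> k < l \<Longrightarrow> poly ((pderiv ^^ k) P) x = 0"
    using stepanov_auxiliary_polynomial[OF f odd p dim, of a] by blast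
  have "card {x. poly f x ^ c = a} * l = (\<Sum>x | poly f x ^ c = a. l)" by simp
  also have "\<dots> \<le> (\<Sum>x | poly f x ^ c = a. Polynomial.order x P)"
    by (intro sum_mono order_ge_if_higher_pderiv_zero[OF P(1) l]) (auto simp: P(3))
  also have "\<dots> \<le> (\<Sum>x | poly P x = 0. Polynomial.order x P)"
    using P(3)[of _ 0] False P(1) by (intro sum_mono2) (auto simp: poly_roots_finite)
  also have "\<dots> \<le> degree P" by (rule sum_order_le_degree[OF P(1)])
  finally show ?thesis using P(2) by linarith
qed simp


text \<open>Solvability needs J - l / 2 to exceed about 2 l^2 / p, and the count is then about p / 2
  + (5 / 2 + J - 1 - l / 2) p / l. For l near sqrt p the excess of J stays bounded and the error is
  of order sqrt p. The choice \<open>l div 2 + 3\<close> lies between l / 2 + 5 / 2 and l / 2 + 3,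
  whence 9 / 2 = 5 / 2 + 2.\<close>

lemma stepanov_bound:
  fixes f :: "'a::prime_card mod_ring poly"
  assumes f: "degree f \<le> 4" "coeff f 0 \<noteq> 0" and odd: "odd (Polynomial.order b f)"
    and p: "CARD('a) = 2 * c + 1" "CARD('a) \<ge> 2000"
  shows "real (card {x. poly f x ^ c = a}) \<le> CARD('a) / 2 + 9 / 2 * sqrt (CARD('a)) + 18"
proof -
  define p where "p = CARD('a)"
  define l where "l = nat \<lfloor>sqrt p\<rfloor>"
  define J where "J = l div 2 + 3"
  define N where "N = card {x. poly f x ^ c = a}"
  have p2: "real p \<ge> 2000" using p by (simp add: p_def)
  have c: "real c = (real p - 1) / 2" "c \<ge> 2" using p by (simp_all add: p_def)
  have "sqrt p \<ge> 44" using p2 by (intro real_le_rsqrt) auto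
  have l: "real l \<le> sqrt p" "sqrt p < real l + 1" using \<open>sqrt p \<ge> 44\<close> by (simp_all add: l_def of_nat_nat)
  have l44: "real l \<ge> 43" using l \<open>sqrt p \<ge> 44\<close> by linarith
  have lp: "(real l)\<^sup>2 \<le> p" "p < (real l + 1)\<^sup>2"
    using power_mono[OF l(1), of 2] power_strict_mono[OF l(2), of 2] by auto
  have "l \<le> p"
  proof -
    have "real l * 1 \<le> real l * real l" using l44 by (intro mult_left_mono) auto
    then show ?thesis using lp by (simp add: power2_eq_square)
  qed
  have J: "real J \<le> real l / 2 + 3" "real J \<ge> real l / 2 + 5 / 2" unfolding J_def by linarith+
  have s: "2 * (\<Sum>k<n. c - 2 + 3 * k + J) + 3 * n = 2 * n * (c - 2 + J) + 3 * n * n" for n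
    by (induction n) (simp_all add: algebra_simps)
  have "2 * real (\<Sum>k<l. c - 2 + 3 * k + J) + 3 * real l = 2 * real l * (real c - 2 + real J) + 3 * real l * real l"
    using arg_cong[OF s[of l], of real] c(2) by (simp add: of_nat_diff)
  then have S: "real (\<Sum>k<l. c - 2 + 3 * k + J) = real l * ((real p - 5) / 2 + real J) + 3 / 2 * real l * real l - 3 / 2 * real l"
    unfolding c(1) by (simp add: field_simps)
  have "(real l / 2 + 5 / 2) * (real p - 3 - real l) \<le> real J * (real p - 3 - real l)"
  proof (intro mult_right_mono)
    have "43 * real l \<le> real l * real l" using l44 by (intro mult_right_mono) auto
    then show "0 \<le> real p - 3 - real l" using lp(1) l44 unfolding power2_eq_square by linarith
  qed (use J in auto)
  \<comment> \<open>The last bracket is the margin of the dimension count; it is positive because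
    l^2 \<le> p.\<close>
  moreover have "(real l / 2 + 5 / 2) * (real p - 3 - real l)
      = real l * (real p - 5) / 2 + 3 / 2 * real l * real l - 3 / 2 * real l + (5 / 2 * real p - 2 * (real l)\<^sup>2 - 15 / 2)"
    by (simp add: field_simps power2_eq_square)
  ultimately have "real l * (real p - 5) / 2 + 3 / 2 * real l * real l - 3 / 2 * real l < real J * (real p - 3 - real l)"
    using lp p2 by linarith
  moreover have "real J * (real p - 3 - real l) = real (2 * J * (c - 1)) - real l * real J"
  proof -
    obtain d where d: "c = Suc d" using c(2) by (cases c) auto
    then have "real p = 2 * real d + 3" using c(1) by simp
    then show ?thesis using d by (simp add: algebra_simps)
  qed
  moreover have "real (\<Sum>k<l. c - 2 + 3 * k + J) = real l * (real p - 5) / 2 + real l * real J + 3 / 2 * real l * real l - 3 / 2 * real l"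
    unfolding S by (simp add: field_simps)
  ultimately have "real (\<Sum>k<l. c - 2 + 3 * k + J) < real (2 * J * (c - 1))" by linarith
  then have dim: "(\<Sum>k<l. c - 2 + 3 * k + J) < 2 * J * (c - 1)" by linarith
  have "N * l \<le> 4 * l + (c - 2) + 4 * c + (J - 1) * p"
    unfolding N_def p_def
    by (rule stepanov_count[OF f odd p(1) c(2) _ dim]) (use \<open>l \<le> p\<close> p_def in auto)
  then have "real (N * l) \<le> real (4 * l + (c - 2) + 4 * c + (J - 1) * p)" by linarith
  also have "\<dots> \<le> 4 * real l + 5 / 2 * p + (real l / 2 + 2) * p"
  proof -
    have "real ((J - 1) * p) \<le> (real l / 2 + 2) * p"
      using J(1) unfolding of_nat_mult by (intro mult_right_mono) (auto simp: J_def)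
    then obtain W where W: "(J - 1) * p = W" "real W \<le> (real l / 2 + 2) * p" by blast
    have "real (c - 2) \<le> real c" by simp
    then show ?thesis unfolding W(1) using W(2) c(1) by simp
  qed
  also have "\<dots> \<le> (p / 2 + 9 / 2 * sqrt p + 18) * l"
  proof -
    have "9 / 2 * real p \<le> 9 / 2 * (real l + 1)\<^sup>2" using lp by simp
    also have "\<dots> \<le> 9 / 2 * (real l * real l) + 14 * real l"
      using l44 by (simp add: power2_eq_square algebra_simps)
    also have "\<dots> \<le> 9 / 2 * (sqrt p * real l) + 14 * real l"
      using l by (intro add_mono mult_left_mono mult_right_mono) auto
    finally show ?thesis by (simp add: algebra_simps)
  qed
  finally have "real N \<le> p / 2 + 9 / 2 * sqrt p + 18" using l44 by (simp add: mult_le_cancel_right)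
  then show ?thesis unfolding N_def p_def .
qed

section \<open>From polynomials over a prime field to sums of Legendre symbols\<close>

lemma order_prod_linear:
  fixes \<beta> :: "nat \<Rightarrow> 'b::field"
  shows "Polynomial.order (- x) (\<Prod>j<n. [:\<beta> j, 1:]) = card {j. j < n \<and> \<beta> j = x}"
proof (induction n)
  case (Suc n)
  have o: "Polynomial.order (- x) [:\<beta> n, 1:] = (if \<beta> n = x then 1 else 0)"
    using order_power_n_n[of "- x" 1] by (auto intro: order_0I)
  have "{j. j < Suc n \<and> \<beta> j = x} = {j. j < n \<and> \<beta> j = x} \<union> (if \<beta> n = x then {n} else {})"
    by (auto simp: less_Suc_eq)
  then have c: "card {j. j < Suc n \<and> \<beta> j = x} = card {j. j < n \<and> \<beta> j = x} + (if \<beta> n = x then 1 else 0)"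
    by auto
  have p: "(\<Prod>j<Suc n. [:\<beta> j, 1:]) = (\<Prod>j<n. [:\<beta> j, 1:]) * [:\<beta> n, 1:]" by (simp del: mult_pCons_right)
  have "(\<Prod>j<n. [:\<beta> j, 1:]) * [:\<beta> n, 1:] \<noteq> 0"
    by (simp only: mult_eq_0_iff prod_zero_iff finite_lessThan) auto
  from order_mult[OF this, of "- x"] show ?case unfolding p c o Suc.IH .
qed simp

text \<open>A translation by some \<open>t\<close> outside four forbidden values makes the constant
  coefficient nonzero; it permutes the field and keeps the multiplicities of the roots.\<close>

lemma stepanov_quartic:
  fixes \<beta> :: "nat \<Rightarrow> 'a::prime_card mod_ring"
  assumes odd: "odd (card {j. j < 4 \<and> \<beta> j = b})"
    and p: "CARD('a) = 2 * c + 1" "CARD('a) \<ge> 2000"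
  shows "real (card {x. (\<Prod>j<4. x + \<beta> j) ^ c = a}) \<le> CARD('a) / 2 + 9 / 2 * sqrt (CARD('a)) + 18"
proof -
  have "card ((\<lambda>j. - \<beta> j) ` {..<4}) < card (UNIV :: 'a mod_ring set)"
    using card_image_le[of "{..<4::nat}" "\<lambda>j. - \<beta> j"] p by simp
  then obtain t where t: "t \<notin> (\<lambda>j. - \<beta> j) ` {..<4}" by (metis UNIV_eq_I nat_neq_iff)
  define \<gamma> where "\<gamma> j = \<beta> j + t" for j
  define f where "f = (\<Prod>j<4. [:\<gamma> j, 1:])"
  have pf: "poly f x = (\<Prod>j<4. x + t + \<beta> j)" for x
    unfolding f_def poly_prod by (intro prod.cong) (auto simp: \<gamma>_def)
  have "coeff f 0 \<noteq> 0"
  proof -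
    have "t + \<beta> j \<noteq> 0" if "j < 4" for j
    proof
      assume "t + \<beta> j = 0"
      then have "t = - \<beta> j" by (simp add: eq_neg_iff_add_eq_0)
      then show False using t that by auto
    qed
    then have "poly f 0 \<noteq> 0" unfolding pf by simp
    then show ?thesis by (simp add: poly_0_coeff_0)
  qed
  moreover have "degree f \<le> 4"
    unfolding f_def using degree_prod_sum_le[of "{..<4::nat}" "\<lambda>j. [:\<gamma> j, 1:]"] by simp
  moreover have "odd (Polynomial.order (- (b + t)) f)"
    unfolding f_def order_prod_linear using odd by (simp add: \<gamma>_def)
  ultimately have "real (card {x. poly f x ^ c = a}) \<le> CARD('a) / 2 + 9 / 2 * sqrt (CARD('a)) + 18"
    by (intro stepanov_bound p)
  moreover have "bij_betw (\<lambda>x. x + t) {x. poly f x ^ c = a} {x. (\<Prod>j<4. x + \<beta> j) ^ c = a}"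
    unfolding pf by (rule bij_betwI[where g = "\<lambda>x. x - t"]) auto
  ultimately show ?thesis using bij_betw_same_card by metis
qed

text \<open>A residue hit by an odd number of the \<open>\<beta> j\<close> keeps the quartic from
  being a square modulo p, the case in which nothing cancels. As a predicate of the number
  \<open>p\<close> alone it can be stated without reference to a type of cardinality p.\<close>

definition quartic_bound :: "nat \<Rightarrow> bool" where
  "quartic_bound p \<longleftrightarrow> (p \<ge> 2000 \<longrightarrow> (\<forall>\<beta> :: nat \<Rightarrow> int. \<forall>b. odd (card {j. j < 4 \<and> [\<beta> j = b] (mod int p)}) \<longrightarrow>
     \<bar>real_of_int (\<Sum>x\<in>{0..<int p}. Legendre (\<Prod>j<4. x + \<beta> j) (int p))\<bar> \<le> 10 * sqrt (real p)))"

text \<open>Upper bounds for the frequencies of 1 and -1 suffice: together they account for all but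
  at most four residues, so an upper bound for one is a lower bound for the other. The difference is
  at most 9 sqrt p + 40, and sqrt p \<ge> 44.\<close>

lemma quartic_bound_card: "quartic_bound CARD('a::prime_card)"
  unfolding quartic_bound_def
proof (intro impI allI)
  fix \<beta> :: "nat \<Rightarrow> int" and b :: int
  define p where "p = CARD('a)"
  define c where "c = (p - 1) div 2"
  assume "2000 \<le> CARD('a)" and odd: "odd (card {j. j < 4 \<and> [\<beta> j = b] (mod int CARD('a))})"
  then have p: "p \<ge> 2000" "prime p" using prime_card[where 'a='a] by (simp_all add: p_def)
  then have "odd p" using prime_odd_nat[of p] by simp
  then have pc: "p = 2 * c + 1" by (auto simp: c_def elim!: oddE)
  let ?F = "\<lambda>x::int. \<Prod>j<4. x + \<beta> j"
  let ?I = "{0..<int p}"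
  have cong: "(of_int x :: 'a mod_ring) = of_int y \<longleftrightarrow> [x = y] (mod int p)" for x y
    by (simp add: of_int_eq_iff_cong_CHAR p_def)
  have bij: "bij_betw (of_int :: int \<Rightarrow> 'a mod_ring) ?I UNIV"
    unfolding bij_betw_def
  proof
    show inj: "inj_on (of_int :: int \<Rightarrow> 'a mod_ring) ?I"
      by (auto simp: inj_on_def cong cong_def)
    show "(of_int :: int \<Rightarrow> 'a mod_ring) ` ?I = UNIV"
      using card_image[OF inj] by (intro card_subset_eq) (auto simp: p_def)
  qed
  have leg: "[Legendre y p = y ^ c] (mod p)" for y
    using euler_criterion[of p y] p by (simp add: c_def)
  have lv: "Legendre y p \<in> {-1, 0, 1}" for y by (simp add: Legendre_def)
  have "\<not> int p dvd 2" "\<not> int p dvd 1"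
    using zdvd_imp_le[of "int p" 2] zdvd_imp_le[of "int p" 1] p(1) by linarith+
  then have m1: "\<not> [1 = (-1::int)] (mod int p)" "\<not> [0 = (1::int)] (mod int p)" "\<not> [0 = (-1::int)] (mod int p)"
    by (simp_all add: cong_iff_dvd_diff)
  have L1: "Legendre y p = a \<longleftrightarrow> (of_int y :: 'a mod_ring) ^ c = of_int a" if "a \<in> {1, -1}" for y a
  proof -
    have "(of_int y :: 'a mod_ring) ^ c = of_int (Legendre y p)"
      using leg[of y] cong[of "Legendre y p" "y ^ c"] by simp
    moreover have "(of_int (Legendre y p) :: 'a mod_ring) = of_int a \<longleftrightarrow> Legendre y p = a"
      using lv[of y] m1 that unfolding cong by (auto simp: cong_sym_eq)
    ultimately show ?thesis by simp
  qed
  have cardL: "card {x \<in> ?I. Legendre (?F x) p = a} = card {x. (\<Prod>j<4. x + (of_int (\<beta> j) :: 'a mod_ring)) ^ c = of_int a}"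
    if "a \<in> {1, -1}" for a
  proof -
    define Q where "Q y \<longleftrightarrow> (\<Prod>j<4. y + (of_int (\<beta> j) :: 'a mod_ring)) ^ c = of_int a" for y
    have eqv: "Legendre (?F x) p = a \<longleftrightarrow> Q (of_int x)" for x
      using L1[OF that, of "?F x"] by (simp add: Q_def)
    have "of_int ` {x \<in> ?I. Q (of_int x)} = {y. Q y}"
    proof (intro equalityI subsetI)
      fix y assume "y \<in> {y. Q y}"
      moreover obtain x where "x \<in> ?I" "y = of_int x"
        using bij_betw_imp_surj_on[OF bij] by (metis UNIV_I imageE)
      ultimately show "y \<in> of_int ` {x \<in> ?I. Q (of_int x)}" by blast
    qed blast
    then have "bij_betw (of_int :: int \<Rightarrow> 'a mod_ring) {x \<in> ?I. Q (of_int x)} {y. Q y}"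
      using bij by (auto simp: bij_betw_def intro: inj_on_subset)
    from bij_betw_same_card[OF this] show ?thesis unfolding eqv Q_def .
  qed
  have odd': "odd (card {j. j < 4 \<and> (of_int (\<beta> j) :: 'a mod_ring) = of_int b})"
    using odd by (simp add: cong p_def)
  have le: "real (card {x \<in> ?I. Legendre (?F x) p = a}) \<le> p / 2 + 9 / 2 * sqrt p + 18" if "a \<in> {1, -1}" for a
    unfolding cardL[OF that] using stepanov_quartic[OF odd', of c "of_int a"] pc p by (simp add: p_def)
  have zero: "card {x \<in> ?I. Legendre (?F x) p = 0} \<le> 4"
  proof -
    have "{x \<in> ?I. Legendre (?F x) p = 0} \<subseteq> (\<lambda>j. (- \<beta> j) mod int p) ` {..<4}"
    proof
      fix x assume x: "x \<in> {x \<in> ?I. Legendre (?F x) p = 0}"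
      then have "int p dvd ?F x" by (auto simp: Legendre_def cong_0_iff split: if_splits)
      then obtain j where "j < 4" "int p dvd x + \<beta> j"
        using p prime_dvd_prod_iff[of "{..<4}" "int p" "\<lambda>j. x + \<beta> j"] by auto
      then have "[x = - \<beta> j] (mod int p)" by (simp add: cong_iff_dvd_diff)
      then have "x = (- \<beta> j) mod int p" using x by (auto simp: cong_def)
      then show "x \<in> (\<lambda>j. (- \<beta> j) mod int p) ` {..<4}" using \<open>j < 4\<close> by auto
    qed
    then show ?thesis using surj_card_le[of "{..<4::nat}"] by fastforce
  qed
  let ?N = "\<lambda>a. card {x \<in> ?I. Legendre (?F x) p = a}"
  have split: "(\<Sum>x\<in>?I. g (Legendre (?F x) p)) = g 1 * int (?N 1) + g (-1) * int (?N (-1)) + g 0 * int (?N 0)" for g :: "int \<Rightarrow> int"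
  proof -
    have "(\<Sum>x\<in>?I. g (Legendre (?F x) p)) = (\<Sum>a\<in>{1,-1,0}. \<Sum>x | x \<in> ?I \<and> Legendre (?F x) p = a. g (Legendre (?F x) p))"
      by (rule sum.group[symmetric]) (use lv in auto)
    also have "\<dots> = (\<Sum>a\<in>{1,-1,0}. g a * int (?N a))" by (intro sum.cong) auto
    finally show ?thesis by simp
  qed
  have "(\<Sum>x\<in>?I. Legendre (?F x) p) = int (?N 1) - int (?N (-1))" using split[of "\<lambda>x. x"] by simp
  moreover have "int (?N 1) + int (?N (-1)) + int (?N 0) = int p" using split[of "\<lambda>x. 1"] by simp
  ultimately have e: "real_of_int (\<Sum>x\<in>?I. Legendre (?F x) p) = real (?N 1) - real (?N (-1))"
    "real (?N 1) + real (?N (-1)) + real (?N 0) = p" by linarith+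
  have "sqrt p \<ge> 44" using p by (intro real_le_rsqrt) auto
  then have "\<bar>real_of_int (\<Sum>x\<in>?I. Legendre (?F x) p)\<bar> \<le> 10 * sqrt p"
    using e le[of 1] le[of "-1"] zero by simp
  then show "\<bar>real_of_int (\<Sum>x\<in>{0..<int CARD('a)}. Legendre (\<Prod>j<4. x + \<beta> j) (int CARD('a)))\<bar>
      \<le> 10 * sqrt (real CARD('a))"
    unfolding p_def .
qed

text \<open>The field with \<open>p\<close> elements is available only over a type with \<open>p\<close> elements. A prime violating the bound can be
  chosen once and for all, so a single such type refutes every counterexample.\<close>

definition bad_prime :: nat where
  "bad_prime = (if \<exists>p. prime p \<and> \<not> quartic_bound p then SOME p. prime p \<and> \<not> quartic_bound p else 2)"

lemma prime_bad_prime: "prime bad_prime"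
  unfolding bad_prime_def using someI_ex[of "\<lambda>p. prime p \<and> \<not> quartic_bound p"] by auto

typedef bad_residue = "{0..<bad_prime}"
  using prime_gt_0_nat[OF prime_bad_prime] by (intro exI[of _ 0]) auto

lemma card_bad_residue: "CARD(bad_residue) = bad_prime"
  using type_definition.card[OF type_definition_bad_residue] by simp

instance bad_residue :: prime_card
  by standard (simp add: card_bad_residue prime_bad_prime)

lemma quartic_bound_prime:
  assumes "prime p"
  shows "quartic_bound p"
proof (rule ccontr)
  assume "\<not> quartic_bound p"
  then have ex: "\<exists>p. prime p \<and> \<not> quartic_bound p" using assms by blast
  then have "\<not> quartic_bound bad_prime"
    unfolding bad_prime_def using someI_ex[OF ex] by auto
  then show False using quartic_bound_card[where 'a = bad_residue] by (simp add: card_bad_residue)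
qed

section \<open>Real primitive characters of coarse moduli\<close>

text \<open>Primitivity is left out, so that products of two such characters, to the product of the
  moduli, are of the same kind.\<close>

definition real_char :: "nat \<Rightarrow> (int \<Rightarrow> real) \<Rightarrow> bool" where
  "real_char m f \<longleftrightarrow> m > 0 \<and> (\<forall>a. f (a + int m) = f a) \<and> (\<forall>a b. f (a * b) = f a * f b) \<and>
     (\<forall>a. f a = 0 \<longleftrightarrow> \<not> coprime a (int m)) \<and> (\<forall>a. f a \<in> {-1, 0, 1})"

lemma periodic_cong:
  fixes f :: "int \<Rightarrow> 'b"
  assumes "\<And>a. f (a + m) = f a" "[a = b] (mod m)"
  shows "f a = f b"
proof -
  have nat: "f (c + int k * m) = f c" for c k
  proof (induction k)
    case (Suc k)
    then show ?case using assms(1)[of "c + int k * m"] by (simp add: algebra_simps)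
  qed simp
  have "f (c + k * m) = f c" for c k
  proof (cases "k \<ge> 0")
    case True
    then show ?thesis using nat[of c "nat k"] by simp
  next
    case False
    then show ?thesis using nat[of "c + k * m" "nat (- k)"] by simp
  qed
  moreover obtain k where "a = b + k * m" using assms(2) by (metis cong_iff_lin cong_sym mult.commute)
  ultimately show ?thesis by simp
qed

lemma real_charD:
  assumes "real_char m f"
  shows "m > 0" "f (a * b) = f a * f b" "f a = 0 \<longleftrightarrow> \<not> coprime a (int m)" "f a \<in> {-1, 0, 1}"
    "[a = b] (mod int m) \<Longrightarrow> f a = f b" "f 1 = 1" "\<bar>f a\<bar> \<le> 1"
proof -
  show 1: "m > 0" "f (a * b) = f a * f b" "f a = 0 \<longleftrightarrow> \<not> coprime a (int m)" "f a \<in> {-1, 0, 1}" for a b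
    using assms by (auto simp: real_char_def)
  show "[a = b] (mod int m) \<Longrightarrow> f a = f b"
    by (rule periodic_cong[of f "int m"]) (use assms in \<open>auto simp: real_char_def\<close>)
  show "f 1 = 1" using 1(2)[of 1 1] 1(3)[of 1] by auto
  show "\<bar>f a\<bar> \<le> 1" using 1(4)[of a] by auto
qed

lemma dirichlet_characterD:
  assumes "dirichlet_character m \<chi>"
  shows "\<chi> (a * b) = \<chi> a * \<chi> b" "\<chi> a = 0 \<longleftrightarrow> \<not> coprime a (int m)"
    "[a = b] (mod int m) \<Longrightarrow> \<chi> a = \<chi> b" "\<chi> 1 = 1" "m > 0"
proof -
  show 1: "\<chi> (a * b) = \<chi> a * \<chi> b" "\<chi> a = 0 \<longleftrightarrow> \<not> coprime a (int m)" "m > 0" for a b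
    using assms by (auto simp: dirichlet_character_def)
  show "[a = b] (mod int m) \<Longrightarrow> \<chi> a = \<chi> b"
    by (rule periodic_cong[of \<chi> "int m"]) (use assms in \<open>auto simp: dirichlet_character_def\<close>)
  show "\<chi> 1 = 1" using 1(1)[of 1 1] 1(2)[of 1] by auto
qed

text \<open>On arguments coprime to m some positive power of the value is 1, by Euler's theorem, and
  a real number with this property is 1 or -1.\<close>

lemma real_char_Re:
  assumes \<chi>: "dirichlet_character m \<chi>" and r: "real_character \<chi>"
  shows "real_char m (\<lambda>a. Re (\<chi> a))" "\<chi> a = of_real (Re (\<chi> a))"
proof -
  show re: "\<chi> a = of_real (Re (\<chi> a))" for a
    using r by (metis of_real_Re range_subsetD real_character_def)
  have "Re (\<chi> a) \<in> {-1, 0, 1}" for a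
  proof (cases "coprime a (int m)")
    case True
    define b where "b = nat (a mod int m)"
    have m: "m > 0" using dirichlet_characterD(5)[OF \<chi>] .
    have ab: "[int b = a] (mod int m)" using m by (simp add: b_def cong_def)
    then have "coprime (int b) (int m)" using True cong_imp_coprime cong_sym by blast
    then have "[b ^ totient m = 1] (mod m)" by (intro euler_theorem) simp
    then have "[int b ^ totient m = 1] (mod int m)"
      by (metis cong_int_iff of_nat_1 of_nat_power)
    then have "[a ^ totient m = 1] (mod int m)" using ab by (meson cong_pow cong_sym cong_trans)
    then have "\<chi> (a ^ totient m) = 1"
      using dirichlet_characterD(3)[OF \<chi>] dirichlet_characterD(4)[OF \<chi>] by metis
    moreover have "\<chi> (a ^ k) = \<chi> a ^ k" for k
      by (induction k) (simp_all add: dirichlet_characterD[OF \<chi>])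
    ultimately have "Re (\<chi> a) ^ totient m = 1" using re[of a] by (metis of_real_1 of_real_eq_iff of_real_power)
    then have "\<bar>Re (\<chi> a)\<bar> ^ totient m = 1" by (simp flip: power_abs)
    moreover have "totient m > 0" using m by simp
    ultimately have "\<bar>Re (\<chi> a)\<bar> = 1" by (metis power_eq_1_iff abs_ge_zero norm_one real_norm_def abs_idempotent not_gr_zero)
    then show ?thesis by auto
  next
    case False
    then have "\<chi> a = 0" using dirichlet_characterD(2)[OF \<chi>] by blast
    then show ?thesis by simp
  qed
  moreover have "Re (\<chi> (a * b)) = Re (\<chi> a) * Re (\<chi> b)" for a b
    using dirichlet_characterD(1)[OF \<chi>, of a b] re by (metis Re_complex_of_real of_real_mult)
  moreover have "Re (\<chi> a) = 0 \<longleftrightarrow> \<not> coprime a (int m)" for a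
    using dirichlet_characterD(2)[OF \<chi>, of a] re[of a] by (metis of_real_0 zero_complex.simps(1))
  ultimately show "real_char m (\<lambda>a. Re (\<chi> a))"
    using \<chi> by (simp add: real_char_def dirichlet_character_def)
qed

text \<open>Otherwise the character would be 1 on all units that are 1 modulo \<open>d\<close>,
  hence would depend only on the residue modulo d and be induced from that smaller modulus.\<close>

lemma primitive_exists_minus_one:
  assumes prim: "primitive_character m \<chi>" and r: "real_character \<chi>"
    and m: "m = q * d" "coprime q d" "prime q"
  shows "\<exists>n. [n = 1] (mod int d) \<and> Re (\<chi> n) = -1"
proof (rule ccontr)
  assume no: "\<not> ?thesis"
  have \<chi>: "dirichlet_character m \<chi>" using prim by (simp add: primitive_character_def)
  note f = real_charD[OF real_char_Re(1)[OF \<chi> r]]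
  note c = dirichlet_characterD[OF \<chi>]
  have one: "\<chi> n = 1" if "[n = 1] (mod int d)" "coprime n (int m)" for n
    using f(3,4)[of n] that no real_char_Re(2)[OF \<chi> r, of n] by fastforce
  have same: "\<chi> u = \<chi> v" if uv: "[u = v] (mod int d)" "coprime u (int m)" "coprime v (int m)" for u v
  proof -
    obtain w where w: "[u * w = 1] (mod int m)" using cong_solve_coprime_int[OF uv(2)] by blast
    have "[v * w = 1] (mod int d)"
    proof -
      have "[u * w = 1] (mod int d)" using w m(1) by (metis cong_dvd_modulus dvd_triv_right of_nat_dvd_iff)
      moreover have "[v * w = u * w] (mod int d)" using uv(1) by (intro cong_mult cong_refl) (simp add: cong_sym)
      ultimately show ?thesis using cong_trans by blast
    qed
    moreover have "coprime w (int m)" using w by (metis coprime_iff_invertible_int mult.commute)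
    ultimately have "\<chi> (v * w) = 1" using uv(3) by (intro one) auto
    moreover have "\<chi> (u * w) = 1" using c(3)[OF w] c(4) by simp
    ultimately show ?thesis unfolding c(1) by (metis mult_cancel_right zero_neq_one mult_zero_right)
  qed
  have qd: "coprime (int q) (int d)" using m(2) by simp
  \<comment> \<open>Being 1 modulo \<open>q\<close>, the lift of a unit modulo \<open>d\<close> is a
    unit modulo m; by \<open>same\<close> the value at the lift does not depend on the
    choice.\<close>
  define lift where "lift a = (SOME x. [x = 1] (mod int q) \<and> [x = a] (mod int d))" for a
  have lift: "[lift a = 1] (mod int q)" "[lift a = a] (mod int d)" for a
  proof -
    have "\<exists>x. [x = 1] (mod int q) \<and> [x = a] (mod int d)" using binary_chinese_remainder_int[OF qd] by metis
    from someI_ex[OF this] show "[lift a = 1] (mod int q)" "[lift a = a] (mod int d)" by (simp_all add: lift_def)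
  qed
  have lc: "coprime (lift a) (int m) \<longleftrightarrow> coprime a (int d)" for a
  proof -
    have "coprime (lift a) (int q)" using lift(1) by (metis cong_imp_coprime cong_sym coprime_1_left)
    moreover have "coprime (lift a) (int d) \<longleftrightarrow> coprime a (int d)"
      using lift(2) cong_imp_coprime cong_sym by metis
    ultimately show ?thesis by (simp add: m(1))
  qed
  define \<psi> where "\<psi> a = \<chi> (lift a)" for a
  have eqd: "\<psi> a = \<chi> u" if "[u = a] (mod int d)" "coprime u (int m)" "coprime a (int d)" for a u
    unfolding \<psi>_def using that lc lift(2) by (intro same) (meson cong_sym cong_trans)+
  have z: "\<psi> a = 0 \<longleftrightarrow> \<not> coprime a (int d)" for a
    unfolding \<psi>_def c(2) lc ..
  have cp: "coprime (a + int d) (int d) \<longleftrightarrow> coprime a (int d)" for a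
    by (simp add: coprime_iff_gcd_eq_1)
  have "dirichlet_character d \<psi>"
    unfolding dirichlet_character_def
  proof (intro conjI allI)
    show "d > 0" using c(5) m by auto
    show "\<psi> (a + int d) = \<psi> a" for a
    proof (cases "coprime a (int d)")
      case True
      have "[lift (a + int d) = a] (mod int d)" using lift(2)[of "a + int d"] by (simp add: cong_def)
      moreover have "coprime (a + int d) (int d)" using True cp by simp
      ultimately show ?thesis using eqd[of "lift (a + int d)" a] True lc by (simp add: \<psi>_def)
    next
      case False
      then show ?thesis using z[of a] z[of "a + int d"] cp by simp
    qed
    show "\<psi> (a * b) = \<psi> a * \<psi> b" for a b
    proof (cases "coprime a (int d) \<and> coprime b (int d)")
      case True
      then have "\<psi> (a * b) = \<chi> (lift a * lift b)"
        using lc by (intro eqd cong_mult lift) auto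
      then show ?thesis by (simp add: c \<psi>_def)
    next
      case False
      then show ?thesis using z[of a] z[of b] z[of "a * b"] by auto
    qed
    show "\<psi> a = 0 \<longleftrightarrow> \<not> coprime a (int d)" for a by (rule z)
  qed
  moreover have "\<chi> a = \<psi> a" if "coprime a (int m)" for a
    using that m(1) by (intro eqd[symmetric]) auto
  moreover have "d dvd m" "d < m"
    using m c(5) prime_gt_1_nat[OF m(3)] by auto
  ultimately show False using prim unfolding primitive_character_def by blast
qed

lemma Legendre_cong: "[a = b] (mod p) \<Longrightarrow> Legendre a p = Legendre b p"
  by (simp add: Legendre_def QuadRes_def cong_def)

text \<open>On integers that are 1 modulo \<open>d\<close> a residue modulo \<open>q\<close> is a
  square modulo m up to congruence, so the character is 1 there. Hence \<open>n\<close> is a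
  nonresidue, and multiplying a nonresidue x by n gives a residue, which forces the value -1 at
  x.\<close>

lemma real_char_Legendre:
  assumes f: "real_char m f" and m: "m = q * d" "coprime q d" "prime q" "q > 2"
    and n: "[n = 1] (mod int d)" "f n = -1" and x: "[x = 1] (mod int d)"
  shows "f x = Legendre x q"
proof -
  note F = real_charD[OF f]
  have qd: "coprime (int q) (int d)" using m(2) by simp
  have cop: "coprime y (int m) \<longleftrightarrow> \<not> int q dvd y" if "[y = 1] (mod int d)" for y
  proof -
    have "coprime y (int d)" using that by (metis cong_imp_coprime cong_sym coprime_1_left)
    moreover have "coprime y (int q) \<longleftrightarrow> \<not> int q dvd y"
      using m(3) by (metis coprime_commute prime_imp_coprime prime_nat_int_transfer coprime_absorb_left not_prime_unit)
    ultimately show ?thesis by (simp add: m(1))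
  qed
  have res: "f y = 1" if y: "[y = 1] (mod int d)" "Legendre y q = 1" for y
  proof -
    have nz: "\<not> int q dvd y" and "QuadRes q y" using y(2) by (auto simp: Legendre_def cong_0_iff split: if_splits)
    then obtain r where r: "[r\<^sup>2 = y] (mod int q)" by (auto simp: QuadRes_def)
    obtain z where z: "[z = r] (mod int q)" "[z = 1] (mod int d)" using binary_chinese_remainder_int[OF qd] by blast
    have "[z\<^sup>2 = y] (mod int q)" using cong_pow[OF z(1), of 2] r cong_trans by blast
    moreover have "[z\<^sup>2 = y] (mod int d)" using cong_pow[OF z(2), of 2] y(1) by (metis cong_sym cong_trans power_one)
    ultimately have zy: "[z\<^sup>2 = y] (mod int m)" using qd by (simp add: m(1) coprime_cong_mult)
    have "f (z\<^sup>2) = f z * f z" by (simp add: power2_eq_square F(2))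
    moreover have "f z \<noteq> 0" using F(5)[OF zy] cop[OF y(1)] nz F(3)[of y] \<open>f (z\<^sup>2) = f z * f z\<close> by auto
    ultimately have "f (z\<^sup>2) = 1" using F(4)[of z] by auto
    then show ?thesis using F(5)[OF zy] by simp
  qed
  have lv: "Legendre y q \<in> {-1, 0, 1}" for y by (simp add: Legendre_def)
  have l0: "Legendre y q = 0 \<longleftrightarrow> int q dvd y" for y by (auto simp: Legendre_def cong_0_iff)
  have ln: "Legendre n q = -1"
    using res[OF n(1)] n(2) lv[of n] l0[of n] F(3)[of n] cop[OF n(1)] by auto
  consider "Legendre x q = 0" | "Legendre x q = 1" | "Legendre x q = -1" using lv[of x] by blast
  then show ?thesis
  proof cases
    case 1
    then show ?thesis using l0[of x] F(3)[of x] cop[OF x] by auto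
  next
    case 2
    then show ?thesis using res[OF x] by simp
  next
    case 3
    define c where "c = (q - 1) div 2"
    have e: "[Legendre y q = y ^ c] (mod q)" for y
      using euler_criterion[OF m(3,4)] by (simp add: c_def)
    have "[Legendre x q * Legendre n q = x ^ c * n ^ c] (mod q)" by (intro cong_mult e)
    then have "[1 = (x * n) ^ c] (mod q)" using 3 ln by (simp add: power_mult_distrib)
    then have c1: "[Legendre (x * n) q = 1] (mod q)" using e[of "x * n"] by (metis cong_sym cong_trans)
    have "\<not> int q dvd 2" "\<not> int q dvd 1" using zdvd_imp_le[of "int q" 2] zdvd_imp_le[of "int q" 1] m(4) by linarith+
    then have "\<not> [- 1 = (1::int)] (mod int q)" "\<not> [0 = (1::int)] (mod int q)" by (simp_all add: cong_iff_dvd_diff)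
    then have "Legendre (x * n) q = 1" using lv[of "x * n"] c1 by auto
    moreover have "[x * n = 1] (mod int d)" using cong_mult[OF x n(1)] by simp
    ultimately have "f (x * n) = 1" using res by blast
    then show ?thesis using n(2) 3 by (simp add: F(2))
  qed
qed


lemma coarse_cases:
  assumes "coarse m" "m > 10 ^ 160"
  obtains (prime) "prime m"
  | (semiprime) p q where "prime p" "prime q" "p \<noteq> q" "m = p * q"
      "real p > real m powr (3 / 8) * ln (real m)" "real q > real m powr (3 / 8) * ln (real m)"
  using assms unfolding coarse_def by blast

lemma real_char_prime_Legendre:
  assumes \<chi>: "primitive_character p \<chi>" "real_character \<chi>" and p: "prime p" "p > 2"
  shows "Re (\<chi> a) = Legendre a p"
proof -
  have c: "dirichlet_character p \<chi>" using \<chi> by (simp add: primitive_character_def)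
  obtain n where "[n = 1] (mod int 1)" "Re (\<chi> n) = -1"
    using primitive_exists_minus_one[OF \<chi>, of p 1] p by auto
  then show ?thesis
    using real_char_Legendre[OF real_char_Re(1)[OF c \<chi>(2)], of p 1 n a] p by simp
qed

text \<open>The Chinese remainder theorem writes \<open>a\<close> as u v modulo p q with u = 1
  modulo q and v = 1 modulo p, so that each factor is seen by one Legendre symbol only.\<close>

lemma real_char_semiprime_Legendre:
  assumes \<chi>: "primitive_character (p * q) \<chi>" "real_character \<chi>"
    and pq: "prime p" "prime q" "p \<noteq> q" "p > 2" "q > 2"
  shows "Re (\<chi> a) = Legendre a p * Legendre a q"
proof -
  define m where "m = p * q"
  have c: "dirichlet_character m \<chi>" using \<chi> by (simp add: primitive_character_def m_def)
  have cop: "coprime p q" "coprime q p" using pq primes_coprime by auto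
  then have copi: "coprime (int p) (int q)" by simp
  note f = real_char_Re(1)[OF c \<chi>(2)]
  obtain n where n: "[n = 1] (mod int q)" "Re (\<chi> n) = -1"
    using primitive_exists_minus_one[OF \<chi>, of p q] pq cop by auto
  obtain n' where n': "[n' = 1] (mod int p)" "Re (\<chi> n') = -1"
    using primitive_exists_minus_one[OF \<chi>, of q p] pq cop by (auto simp: mult.commute)
  obtain u where u: "[u = a] (mod int p)" "[u = 1] (mod int q)" using binary_chinese_remainder_int[OF copi] by blast
  obtain v where v: "[v = 1] (mod int p)" "[v = a] (mod int q)" using binary_chinese_remainder_int[OF copi] by blast
  have "[u * v = a] (mod int p)" "[u * v = a] (mod int q)"
    using cong_mult[OF u(1) v(1)] cong_mult[OF u(2) v(2)] by simp_all
  then have "[u * v = a] (mod int m)" using copi by (simp add: m_def coprime_cong_mult)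
  then have "Re (\<chi> a) = Re (\<chi> u) * Re (\<chi> v)"
    using real_charD(2,5)[OF f] by metis
  moreover have "Re (\<chi> u) = Legendre u p"
    using real_char_Legendre[OF f _ cop(1) pq(1,4) n u(2)] by (simp add: m_def)
  moreover have "Re (\<chi> v) = Legendre v q"
    using real_char_Legendre[OF f _ cop(2) pq(2,5) n' v(1)] by (simp add: m_def mult.commute)
  ultimately show ?thesis using Legendre_cong[OF u(1)] Legendre_cong[OF v(2)] by simp
qed

lemma sum_crt:
  fixes g h :: "int \<Rightarrow> real"
  assumes pq: "coprime p q" "p > 0" "q > 0"
    and g: "\<And>x. g (x mod int p) = g x" and h: "\<And>x. h (x mod int q) = h x"
  shows "(\<Sum>x\<in>{0..<int (p * q)}. g x * h x) = (\<Sum>x\<in>{0..<int p}. g x) * (\<Sum>x\<in>{0..<int q}. h x)"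
proof -
  have copi: "coprime (int p) (int q)" using pq by simp
  have bij: "bij_betw (\<lambda>x. (x mod int p, x mod int q)) {0..<int (p * q)} ({0..<int p} \<times> {0..<int q})"
    unfolding bij_betw_def
  proof
    show inj: "inj_on (\<lambda>x. (x mod int p, x mod int q)) {0..<int (p * q)}"
    proof (rule inj_onI)
      fix x y assume xy: "x \<in> {0..<int (p * q)}" "y \<in> {0..<int (p * q)}"
        "(x mod int p, x mod int q) = (y mod int p, y mod int q)"
      then have "[x = y] (mod int p * int q)" using copi by (intro coprime_cong_mult) (auto simp: cong_def)
      then show "x = y" using xy by (simp add: cong_def)
    qed
    have "card ((\<lambda>x. (x mod int p, x mod int q)) ` {0..<int (p * q)}) = p * q"
      unfolding card_image[OF inj] card_atLeastLessThan_int by (simp add: nat_mult_distrib)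
    then show "(\<lambda>x. (x mod int p, x mod int q)) ` {0..<int (p * q)} = {0..<int p} \<times> {0..<int q}"
      using pq by (intro card_subset_eq) (auto simp: card_cartesian_product)
  qed
  have "(\<Sum>x\<in>{0..<int p}. g x) * (\<Sum>x\<in>{0..<int q}. h x) = (\<Sum>(u, v)\<in>{0..<int p} \<times> {0..<int q}. g u * h v)"
    by (simp add: sum_product sum.cartesian_product)
  also have "\<dots> = (\<Sum>x\<in>{0..<int (p * q)}. g (x mod int p) * h (x mod int q))"
    by (subst sum.reindex_bij_betw[OF bij, symmetric]) simp
  finally show ?thesis by (simp add: g h)
qed

text \<open>Repeated squaring, rounded down at every stage to keep the numerals short.\<close>

lemma power_256_ge:
  fixes x :: real
  assumes "991054687 / 1000000000 \<le> x"
  shows "100228353 / 1000000000 \<le> x ^ 256"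
proof -
  have sq: "b \<le> y ^ 2" if "a \<le> y" "0 \<le> a" "b \<le> a ^ 2" for a b y :: real
    using power_mono[OF that(1,2), of 2] that(3) by linarith
  have h1: "61386837 / 62500000 \<le> x ^ 2" using sq[OF assms, of "61386837 / 62500000"] by (simp add: power_divide flip: power_mult)
  have h2: "964696001 / 1000000000 \<le> x ^ 4" using sq[OF h1, of "964696001 / 1000000000"] by (simp add: power_divide flip: power_mult)
  have h3: "465319187 / 500000000 \<le> x ^ 8" using sq[OF h2, of "465319187 / 500000000"] by (simp add: power_divide flip: power_mult)
  have h4: "866087783 / 1000000000 \<le> x ^ 16" using sq[OF h3, of "866087783 / 1000000000"] by (simp add: power_divide flip: power_mult)
  have h5: "750108047 / 1000000000 \<le> x ^ 32" using sq[OF h4, of "750108047 / 1000000000"] by (simp add: power_divide flip: power_mult)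
  have h6: "281331041 / 500000000 \<le> x ^ 64" using sq[OF h5, of "281331041 / 500000000"] by (simp add: power_divide flip: power_mult)
  have h7: "158294309 / 500000000 \<le> x ^ 128" using sq[OF h6, of "158294309 / 500000000"] by (simp add: power_divide flip: power_mult)
  show ?thesis using sq[OF h7, of "100228353 / 1000000000"] by (simp add: power_divide flip: power_mult)
qed

lemma power_1024_ge:
  fixes x :: real
  assumes "1002255859 / 1000000000 \<le> x"
  shows "2009647723 / 200000000 \<le> x ^ 1024"
proof -
  have sq: "b \<le> y ^ 2" if "a \<le> y" "0 \<le> a" "b \<le> a ^ 2" for a b y :: real
    using power_mono[OF that(1,2), of 2] that(3) by linarith
  have h1: "502258403 / 500000000 \<le> x ^ 2" using sq[OF assms, of "502258403 / 500000000"] by (simp add: power_divide flip: power_mult)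
  have h2: "1009054013 / 1000000000 \<le> x ^ 4" using sq[OF h1, of "1009054013 / 1000000000"] by (simp add: power_divide flip: power_mult)
  have h3: "1018190001 / 1000000000 \<le> x ^ 8" using sq[OF h2, of "1018190001 / 1000000000"] by (simp add: power_divide flip: power_mult)
  have h4: "518355439 / 500000000 \<le> x ^ 16" using sq[OF h3, of "518355439 / 500000000"] by (simp add: power_divide flip: power_mult)
  have h5: "268692361 / 250000000 \<le> x ^ 32" using sq[OF h4, of "268692361 / 250000000"] by (simp add: power_divide flip: power_mult)
  have h6: "1155129357 / 1000000000 \<le> x ^ 64" using sq[OF h5, of "1155129357 / 1000000000"] by (simp add: power_divide flip: power_mult)
  have h7: "1334323831 / 1000000000 \<le> x ^ 128" using sq[OF h6, of "1334323831 / 1000000000"] by (simp add: power_divide flip: power_mult)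
  have h8: "356084017 / 200000000 \<le> x ^ 256" using sq[OF h7, of "356084017 / 200000000"] by (simp add: power_divide flip: power_mult)
  have h9: "3169895679 / 1000000000 \<le> x ^ 512" using sq[OF h8, of "3169895679 / 1000000000"] by (simp add: power_divide flip: power_mult)
  show ?thesis using sq[OF h9, of "2009647723 / 200000000"] by (simp add: power_divide flip: power_mult)
qed

text \<open>Both follow from 1 + x \<le> exp x, at x = -2.29 / 256 and x = 2.31 / 1024, raised to
  the powers 256 and 1024.\<close>

lemma ln_10_bounds: "ln (10::real) > 229 / 100" "ln (10::real) < 231 / 100"
proof -
  have "(1 - 229 / 25600) ^ 256 \<le> exp (- (229 / 25600) :: real) ^ 256"
    using exp_ge_add_one_self[of "- (229 / 25600) :: real"] by (intro power_mono) auto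
  also have "\<dots> = exp (- (229 / 100))" by (simp flip: exp_of_nat_mult)
  finally have "1 / 10 < exp (- (229 / 100) :: real)"
    using power_256_ge[of "1 - 229 / 25600"] by simp
  then have "exp (229 / 100) < (10::real)" by (simp add: exp_minus field_simps)
  then show "ln (10::real) > 229 / 100" by (metis exp_less_cancel_iff exp_ln zero_less_numeral)
  have "(1 + 231 / 102400) ^ 1024 \<le> exp (231 / 102400 :: real) ^ 1024"
    by (intro power_mono exp_ge_add_one_self) auto
  also have "\<dots> = exp (231 / 100)" by (simp flip: exp_of_nat_mult)
  finally have "10 < exp (231 / 100 :: real)"
    using power_1024_ge[of "1 + 231 / 102400"] by simp
  then show "ln (10::real) < 231 / 100" by (metis exp_less_cancel_iff exp_ln zero_less_numeral)
qed

section \<open>Sizes of coarse moduli and quartic sums modulo them\<close>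

lemma coarse_ln_gt:
  assumes "(m::nat) > 10 ^ 160"
  shows "ln (real m) > 366" "real m > 10 ^ 160"
proof -
  show m: "real m > 10 ^ 160" using assms by (metis of_nat_less_iff of_nat_numeral of_nat_power)
  have "366 < 160 * ln (10::real)" using ln_10_bounds(1) by simp
  also have "\<dots> = ln (10 ^ 160)" using ln_realpow[of "10::real" 160] by (simp only: of_nat_numeral)
  also have "\<dots> < ln (real m)" using m by (intro ln_less_cancel_iff[THEN iffD2]) auto
  finally show "ln (real m) > 366" .
qed

lemma powr_ge_10_powr:
  assumes "real m > 10 ^ 160" "a \<ge> 0"
  shows "real m powr a \<ge> 10 powr (160 * a)"
proof -
  have "10 powr (160 * a) = (10 ^ 160) powr a" by (simp add: powr_powr powr_powr[symmetric] flip: powr_realpow)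
  also have "\<dots> \<le> real m powr a" using assms by (intro powr_mono2) auto
  finally show ?thesis .
qed

lemma coarse_factor_gt:
  assumes m: "(m::nat) > 10 ^ 160" and p: "real p > real m powr (3 / 8) * ln (real m)"
  shows "real p > real m powr (3 / 8)" "p > 10 ^ 60"
proof -
  have "real m powr (3 / 8) * 1 \<le> real m powr (3 / 8) * ln (real m)"
    using coarse_ln_gt[OF m] by (intro mult_left_mono) auto
  then show 1: "real p > real m powr (3 / 8)" using p by simp
  have "(10::real) ^ 60 = 10 powr (160 * (3 / 8))" by (simp flip: powr_realpow)
  also have "\<dots> \<le> real m powr (3 / 8)" by (rule powr_ge_10_powr[OF coarse_ln_gt(2)[OF m]]) simp
  finally have "real (10 ^ 60) < real p" using 1 by simp
  then show "p > 10 ^ 60" by linarith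
qed

text \<open>Shifts in an interval shorter than \<open>p\<close> are congruent only if they are
  equal, so the odd multiplicity of an integer passes to its residue class.\<close>

lemma quartic_legendre_sum:
  fixes \<beta> :: "nat \<Rightarrow> int"
  assumes "prime p" "p > 10 ^ 60" and \<beta>: "\<And>j. j < 4 \<Longrightarrow> \<beta> j \<in> {1..B}" "B < int p"
    and odd: "odd (card {j. j < 4 \<and> \<beta> j = b})"
  shows "\<bar>real_of_int (\<Sum>x\<in>{0..<int p}. Legendre (\<Prod>j<4. x + \<beta> j) (int p))\<bar> \<le> 10 * sqrt (real p)"
proof -
  have "{j. j < 4 \<and> \<beta> j = b} \<noteq> {}" using odd by (metis card.empty even_zero)
  then have b: "b \<in> {1..B}" using \<beta>(1) by auto
  have "[\<beta> j = b] (mod int p) \<longleftrightarrow> \<beta> j = b" if "j < 4" for j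
    using cong_less_imp_eq_int[of "\<beta> j" "int p" b] \<beta>(1)[OF that] b \<beta>(2) by auto
  then have "{j. j < 4 \<and> [\<beta> j = b] (mod int p)} = {j. j < 4 \<and> \<beta> j = b}" by auto
  then have "odd (card {j. j < 4 \<and> [\<beta> j = b] (mod int p)})" using odd by simp
  moreover have "p \<ge> 2000" using assms(2) by (simp add: order.trans[OF _ less_imp_le])
  ultimately show ?thesis
    using quartic_bound_prime[OF assms(1)] unfolding quartic_bound_def by blast
qed

text \<open>Both prime factors exceed m^(3/8), hence all shifts stay distinct modulo each of them.
  The constant 100 is 10 for each of the two factors of a semiprime.\<close>

lemma quartic_sum_coarse:
  fixes \<beta> :: "nat \<Rightarrow> int"
  assumes m: "coarse m" "m > 10 ^ 160" and \<chi>: "primitive_character m \<chi>" "real_character \<chi>"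
    and \<beta>: "\<And>j. j < 4 \<Longrightarrow> \<beta> j \<in> {1..B}" "real_of_int B \<le> real m powr (3 / 8)"
    and odd: "odd (card {j. j < 4 \<and> \<beta> j = b})"
  shows "\<bar>\<Sum>x\<in>{0..<int m}. Re (\<chi> (\<Prod>j<4. x + \<beta> j))\<bar> \<le> 100 * sqrt (real m)"
  using m
proof (cases rule: coarse_cases)
  case prime
  have "real m powr (3 / 8) < real m powr 1" using coarse_ln_gt(2)[OF m(2)] by (intro powr_less_mono) auto
  then have "B < int m" using \<beta>(2) coarse_ln_gt(2)[OF m(2)] by simp
  moreover have m60: "m > 10 ^ 60" using m(2) by (rule order.strict_trans[rotated]) simp
  ultimately have "\<bar>real_of_int (\<Sum>x\<in>{0..<int m}. Legendre (\<Prod>j<4. x + \<beta> j) (int m))\<bar> \<le> 10 * sqrt (real m)"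
    using prime \<beta>(1) odd by (intro quartic_legendre_sum) auto
  moreover have "Re (\<chi> a) = Legendre a m" for a
    using real_char_prime_Legendre[OF \<chi> prime] m60 by simp
  ultimately show ?thesis by simp
next
  case (semiprime p q)
  note p = coarse_factor_gt[OF m(2) semiprime(5)] and q = coarse_factor_gt[OF m(2) semiprime(6)]
  have B: "B < int p" "B < int q" using p(1) q(1) \<beta>(2) by linarith+
  have pq2: "p > 2" "q > 2" using p(2) q(2) by simp_all
  let ?F = "\<lambda>x. \<Prod>j<4. x + \<beta> j"
  have F: "Legendre (?F (x mod n)) n = Legendre (?F x) n" for x n
    by (intro Legendre_cong cong_prod cong_add cong_refl) (simp add: cong_def)
  have "Re (\<chi> a) = Legendre a p * Legendre a q" for a
    using real_char_semiprime_Legendre[of p q \<chi> a] \<chi> semiprime pq2 by simp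
  then have "(\<Sum>x\<in>{0..<int m}. Re (\<chi> (?F x)))
      = (\<Sum>x\<in>{0..<int (p * q)}. real_of_int (Legendre (?F x) p) * real_of_int (Legendre (?F x) q))"
    by (simp add: semiprime(4))
  also have "\<dots> = (\<Sum>x\<in>{0..<int p}. real_of_int (Legendre (?F x) p)) * (\<Sum>x\<in>{0..<int q}. real_of_int (Legendre (?F x) q))"
    using semiprime pq2 by (intro sum_crt) (auto simp: F primes_coprime)
  finally have "\<bar>\<Sum>x\<in>{0..<int m}. Re (\<chi> (?F x))\<bar>
      = \<bar>real_of_int (\<Sum>x\<in>{0..<int p}. Legendre (?F x) p)\<bar> * \<bar>real_of_int (\<Sum>x\<in>{0..<int q}. Legendre (?F x) q)\<bar>"
    by (simp add: abs_mult)
  also have "\<dots> \<le> (10 * sqrt (real p)) * (10 * sqrt (real q))"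
    using semiprime \<beta>(1) odd B p q by (intro mult_mono quartic_legendre_sum) auto
  also have "\<dots> = 100 * sqrt (real m)" by (simp add: semiprime(4) real_sqrt_mult)
  finally show ?thesis .
qed

section \<open>A Burgess bound\<close>

lemma sum_inverse_le_ln: "A \<ge> 1 \<Longrightarrow> (\<Sum>d=1..A. 1 / real d) \<le> 1 + ln (real A)"
proof (induction A rule: dec_induct)
  case (step n)
  have "ln (1 - 1 / real (Suc n)) \<le> - (1 / real (Suc n))"
    using ln_add_one_self_le_self2[of "- (1 / real (Suc n))"] step by simp
  moreover have "1 - 1 / real (Suc n) = real n / real (Suc n)" by (simp add: field_simps)
  ultimately have "ln (real n) - ln (real (Suc n)) \<le> - (1 / real (Suc n))"
    using step by (simp add: ln_div)
  then show ?case using step by simp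
qed simp

text \<open>Passing from Z to Z + 1 adds the 2 Z + 1 pairs with maximum Z + 1, whose total weight is
  below 2.\<close>

lemma sum_inverse_max_le: "(\<Sum>(u, w)\<in>{1..Z} \<times> {1..Z}. 1 / real (max u w)) \<le> 2 * real Z"
proof (induction Z)
  case (Suc Z)
  let ?g = "\<lambda>(u, w). 1 / real (max u w)"
  have S: "{1..Suc Z} \<times> {1..Suc Z} = ({1..Z} \<times> {1..Z}) \<union> (({1..Z} \<times> {Suc Z}) \<union> ({Suc Z} \<times> {1..Suc Z}))"
    by auto
  have "sum ?g ({1..Suc Z} \<times> {1..Suc Z}) = sum ?g ({1..Z} \<times> {1..Z}) + sum ?g (({1..Z} \<times> {Suc Z}) \<union> ({Suc Z} \<times> {1..Suc Z}))"
    unfolding S by (rule sum.union_disjoint) auto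
  also have "sum ?g (({1..Z} \<times> {Suc Z}) \<union> ({Suc Z} \<times> {1..Suc Z})) = (\<Sum>x\<in>({1..Z} \<times> {Suc Z}) \<union> ({Suc Z} \<times> {1..Suc Z}). 1 / real (Suc Z))"
    by (rule sum.cong) (auto simp: max_def)
  also have "\<dots> = real (card (({1..Z} \<times> {Suc Z}) \<union> ({Suc Z} \<times> {1..Suc Z}))) / real (Suc Z)"
    by simp
  also have "card (({1..Z} \<times> {Suc Z}) \<union> ({Suc Z} \<times> {1..Suc Z})) = Z + Suc Z"
    by (subst card_Un_disjoint) (auto simp: card_cartesian_product)
  also have "real (Z + Suc Z) / real (Suc Z) \<le> 2" by (simp add: field_simps)
  finally show ?case using Suc by simp
qed simp

text \<open>Each pair is determined by its gcd d and its reduced pair, which lies in a square of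
  side A div d. Forgetting that the reduced pair is coprime leaves 2 A / d for every d.\<close>

lemma sum_gcd_max_le:
  assumes "A \<ge> 1"
  shows "(\<Sum>(a, a')\<in>{1..A} \<times> {1..A}. 1 / real (max (a div gcd a a') (a' div gcd a a'))) \<le> 2 * real A * (1 + ln (real A))"
proof -
  let ?h = "\<lambda>(a, a'). (gcd a a', (a div gcd a a', a' div gcd a a'))"
  let ?g = "\<lambda>(d::nat, (u, w)). 1 / real (max u w)"
  let ?T = "Sigma {1..A} (\<lambda>d. {1..A div d} \<times> {1..A div d})"
  have "inj_on ?h ({1..A} \<times> {1..A})"
    by (rule inj_on_inverseI[where g = "\<lambda>(d, (u, w)). (d * u, d * w)"]) auto
  moreover have "?h ` ({1..A} \<times> {1..A}) \<subseteq> ?T"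
  proof (clarsimp, intro conjI)
    fix a a' assume *: "Suc 0 \<le> a" "a \<le> A" "Suc 0 \<le> a'" "a' \<le> A"
    have g: "gcd a a' > 0" "gcd a a' \<le> a" "gcd a a' \<le> a'" using * by (auto intro!: dvd_imp_le)
    show "Suc 0 \<le> gcd a a'" using g(1) by (rule Suc_leI)
    show "gcd a a' \<le> A" using g * by linarith
    show "Suc 0 \<le> a div gcd a a'" "Suc 0 \<le> a' div gcd a a'" using g by (simp_all add: div_greater_zero_iff Suc_le_eq)
    show "a div gcd a a' \<le> A div gcd a a'" "a' div gcd a a' \<le> A div gcd a a'" using * by (simp_all add: div_le_mono)
  qed
  ultimately have "(\<Sum>x\<in>{1..A} \<times> {1..A}. ?g (?h x)) \<le> (\<Sum>x\<in>?T. ?g x)"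
    by (subst sum.reindex[of ?h, unfolded o_def, symmetric]) (auto intro!: sum_mono2)
  also have "\<dots> = (\<Sum>d=1..A. \<Sum>(u, w)\<in>{1..A div d} \<times> {1..A div d}. 1 / real (max u w))"
    by (subst sum.Sigma) auto
  also have "\<dots> \<le> (\<Sum>d=1..A. 2 * real A * (1 / real d))"
  proof (rule sum_mono)
    fix d assume "d \<in> {1..A}"
    have "(\<Sum>(u, w)\<in>{1..A div d} \<times> {1..A div d}. 1 / real (max u w)) \<le> 2 * real (A div d)"
      by (rule sum_inverse_max_le)
    also have "\<dots> \<le> 2 * (real A / real d)" by (intro mult_left_mono of_nat_div_le_of_nat) auto
    finally show "(\<Sum>(u, w)\<in>{1..A div d} \<times> {1..A div d}. 1 / real (max u w)) \<le> 2 * real A * (1 / real d)"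
      by simp
  qed
  also have "\<dots> = 2 * real A * (\<Sum>d=1..A. 1 / real d)" by (simp add: sum_distrib_left)
  also have "\<dots> \<le> 2 * real A * (1 + ln (real A))"
    using sum_inverse_le_ln[OF assms] by (intro mult_left_mono) auto
  finally show ?thesis by (simp add: case_prod_unfold)
qed

lemma card_congruent_le:
  fixes S :: "int set" and M :: int
  assumes "u > 0" and S: "S \<subseteq> {M<..M + int N}" and c: "\<And>s t. s \<in> S \<Longrightarrow> t \<in> S \<Longrightarrow> int u dvd s - t"
  shows "real (card S) \<le> 1 + real N / real u"
proof (cases "S = {}")
  case False
  have fin: "finite S" using S finite_subset by blast
  define s0 where "s0 = Min S"
  have s0: "s0 \<in> S" "\<And>s. s \<in> S \<Longrightarrow> s0 \<le> s" using False fin by (auto simp: s0_def)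
  define h where "h s = (s - s0) div int u" for s
  have hs: "s = s0 + int u * h s" if "s \<in> S" for s
    using c[OF that s0(1)] by (simp add: h_def)
  have "inj_on h S" using hs by (metis inj_onI)
  moreover have "h ` S \<subseteq> {0..int (N div u)}"
  proof
    fix y assume "y \<in> h ` S"
    then obtain s where s: "s \<in> S" "y = h s" by auto
    have "s0 \<in> {M<..M + int N}" "s \<in> {M<..M + int N}" using s0(1) s(1) S by auto
    then have "0 \<le> s - s0" "s - s0 \<le> int N" using s0(2)[OF s(1)] by auto
    then have "0 \<le> h s" "h s \<le> int N div int u"
      using assms(1) by (auto simp: h_def pos_imp_zdiv_nonneg_iff intro: zdiv_mono1)
    then show "y \<in> {0..int (N div u)}" using s by (simp add: zdiv_int)
  qed
  ultimately have "card S \<le> card {0..int (N div u)}" by (metis card_image card_mono finite_atLeastAtMost_int)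
  then have "real (card S) \<le> 1 + real (N div u)" by simp
  also have "\<dots> \<le> 1 + real N / real u" using of_nat_div_le_of_nat[of N u, where 'a = real] by simp
  finally show ?thesis .
qed simp

text \<open>The difference of two solutions satisfies the congruence with both sides so small that
  it is an equation, u \<Delta>' = w \<Delta> with coprime u and w. So each coordinate determines
  the other, the first coordinates agree modulo u and the second modulo w.\<close>

lemma card_fraction_solutions:
  fixes M :: int
  assumes a: "1 \<le> a" "a \<le> A" "1 \<le> a'" "a' \<le> A" and m: "2 * A * N < m"
  shows "real (card {(n, n') \<in> {M<..M + int N} \<times> {M<..M + int N}. int m dvd int a * n' - int a' * n})
    \<le> 1 + real N / real (max (a div gcd a a') (a' div gcd a a'))"
proof -
  define g where "g = gcd a a'"
  define u where "u = a div g"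
  define w where "w = a' div g"
  let ?I = "{M<..M + int N}"
  let ?S = "{(n, n') \<in> ?I \<times> ?I. int m dvd int a * n' - int a' * n}"
  have g: "g > 0" "a = g * u" "a' = g * w" using a by (auto simp: g_def u_def w_def)
  have pos: "u > 0" "w > 0" using g a by (auto intro: gr0I)
  have cop: "coprime u w" unfolding u_def w_def g_def using a by (intro div_gcd_coprime) auto
  have key: "int u * (n2' - n1') = int w * (n2 - n1)" if "(n1, n1') \<in> ?S" "(n2, n2') \<in> ?S" for n1 n1' n2 n2'
  proof -
    define D where "D = int a * (n2' - n1') - int a' * (n2 - n1)"
    have "int m dvd (int a * n2' - int a' * n2) - (int a * n1' - int a' * n1)"
      by (rule dvd_diff) (use that in auto)
    then have dv: "int m dvd D" by (simp add: D_def algebra_simps)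
    have "\<bar>n2' - n1'\<bar> \<le> int N" "\<bar>n2 - n1\<bar> \<le> int N" using that by auto
    then have "\<bar>int a * (n2' - n1')\<bar> \<le> int A * int N" "\<bar>int a' * (n2 - n1)\<bar> \<le> int A * int N"
      using a unfolding abs_mult by (auto intro!: mult_mono)
    then have "\<bar>D\<bar> \<le> int (2 * A * N)" unfolding D_def by simp
    then have "\<bar>D\<bar> < int m" using m by linarith
    then have "D = 0" using dv dvd_imp_le_int[of D "int m"] by fastforce
    then have "int g * (int u * (n2' - n1')) = int g * (int w * (n2 - n1))"
      by (simp add: D_def g(2,3) algebra_simps)
    then show ?thesis using g(1) by simp
  qed
  have fin: "finite ?S" by (rule finite_subset[of _ "?I \<times> ?I"]) auto
  have "inj_on fst ?S"
  proof (rule inj_onI)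
    fix p p' assume "p \<in> ?S" "p' \<in> ?S" "fst p = fst p'"
    then show "p = p'" using key[of "fst p" "snd p" "fst p'" "snd p'"] pos by (auto simp: prod_eq_iff)
  qed
  then have 1: "card ?S = card (fst ` ?S)" by (simp add: card_image)
  have "inj_on snd ?S"
  proof (rule inj_onI)
    fix p p' assume "p \<in> ?S" "p' \<in> ?S" "snd p = snd p'"
    then show "p = p'" using key[of "fst p" "snd p" "fst p'" "snd p'"] pos by (auto simp: prod_eq_iff)
  qed
  then have 2: "card ?S = card (snd ` ?S)" by (simp add: card_image)
  have "real (card (fst ` ?S)) \<le> 1 + real N / real u"
  proof (rule card_congruent_le[OF pos(1)])
    fix s t assume "s \<in> fst ` ?S" "t \<in> fst ` ?S"
    then obtain s' t' where "(s, s') \<in> ?S" "(t, t') \<in> ?S" by auto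
    from key[OF this(2,1)] have "int u dvd int w * (s - t)" by (metis dvd_triv_left)
    then show "int u dvd s - t" using cop by (simp add: coprime_dvd_mult_right_iff)
  qed auto
  moreover have "real (card (snd ` ?S)) \<le> 1 + real N / real w"
  proof (rule card_congruent_le[OF pos(2)])
    fix s t assume "s \<in> snd ` ?S" "t \<in> snd ` ?S"
    then obtain s' t' where "(s', s) \<in> ?S" "(t', t) \<in> ?S" by auto
    from key[OF this(2,1)] have "int w dvd int u * (s - t)" by (metis dvd_triv_left)
    then show "int w dvd s - t" using cop by (simp add: coprime_dvd_mult_right_iff coprime_commute)
  qed auto
  ultimately show ?thesis using 1 2 unfolding g_def[symmetric] u_def[symmetric] w_def[symmetric]
    by (auto simp: max_def)
qed

text \<open>If every value were taken an even number of times, the four indices would split into two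
  pairs with equal values, in one of three ways.\<close>

lemma odd_fibre_of_unpaired:
  fixes b :: "nat \<Rightarrow> int"
  assumes "\<not> (b 0 = b 1 \<and> b 2 = b 3)" "\<not> (b 0 = b 2 \<and> b 1 = b 3)" "\<not> (b 0 = b 3 \<and> b 1 = b 2)"
  shows "\<exists>c. odd (card {j. j < 4 \<and> b j = c})"
proof -
  have cc: "card {j. j < (4::nat) \<and> P j} = of_bool (P 0) + of_bool (P 1) + of_bool (P 2) + of_bool (P 3)" for P :: "nat \<Rightarrow> bool"
  proof -
    have "card {j. j < (4::nat) \<and> P j} = (\<Sum>j<4. of_bool (P j))"
      by (simp add: sum_of_bool_eq Collect_conj_eq lessThan_def)
    then show ?thesis by (simp add: eval_nat_numeral)
  qed
  show ?thesis
  proof (rule ccontr)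
    assume "\<not> ?thesis"
    then have ev: "even (card {j. j < 4 \<and> b j = c})" for c by blast
    have e: "even (of_bool (b 0 = c) + of_bool (b 1 = c) + of_bool (b 2 = c) + of_bool (b 3 = c) :: nat)" for c
      using ev[of c] by (simp only: cc[of "\<lambda>j. b j = c"])
    show False
      using assms e[of "b 0"] e[of "b 1"] e[of "b 2"]
      by (cases "b 1 = b 0"; cases "b 2 = b 0"; cases "b 3 = b 0") (simp_all split: if_splits add: of_bool_def)
  qed
qed

section \<open>Fourth moments and averaging over shifts\<close>

text \<open>Expanding the fourth power, the at most 3 B^2 quadruples that split into equal pairs are
  estimated trivially by m; every other quadruple has a value of odd multiplicity, where the quartic
  bound applies.\<close>

lemma fourth_moment:
  fixes f :: "int \<Rightarrow> real"
  assumes f: "\<And>a b. f (a * b) = f a * f b" "\<And>a. \<bar>f a\<bar> \<le> 1" and C: "C \<ge> 0"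
    and quartic: "\<And>(\<beta> :: nat \<Rightarrow> int) c. (\<And>j. j < 4 \<Longrightarrow> \<beta> j \<in> {1..int B}) \<Longrightarrow> odd (card {j. j < 4 \<and> \<beta> j = c})
      \<Longrightarrow> \<bar>\<Sum>x\<in>{0..<int m}. f (\<Prod>j<4. x + \<beta> j)\<bar> \<le> C"
  shows "(\<Sum>x\<in>{0..<int m}. (\<Sum>b\<in>{1..int B}. f (x + b)) ^ 4) \<le> 3 * (real B)\<^sup>2 * real m + C * real B ^ 4"
proof -
  let ?I = "{1..int B}"
  define Q where "Q = ?I \<times> ?I \<times> ?I \<times> ?I"
  define W where "W = (\<lambda>(b0, b1, b2, b3). \<Sum>x\<in>{0..<int m}. f ((x + b0) * (x + b1) * (x + b2) * (x + b3)))"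
  define E where "E = {(b0, b1, b2, b3) \<in> Q. b0 = b1 \<and> b2 = b3 \<or> b0 = b2 \<and> b1 = b3 \<or> b0 = b3 \<and> b1 = b2}"
  have finQ: "finite Q" "E \<subseteq> Q" by (auto simp: Q_def E_def)
  then have finE: "finite E" by (rule rev_finite_subset)
  have "(\<Sum>b\<in>?I. g b) ^ 4 = (\<Sum>(b0, b1, b2, b3)\<in>Q. g b0 * g b1 * g b2 * g b3)" for g :: "int \<Rightarrow> real"
  proof -
    have "(\<Sum>b\<in>?I. g b) ^ 4 = (\<Sum>b\<in>?I. g b) * ((\<Sum>b\<in>?I. g b) * ((\<Sum>b\<in>?I. g b) * (\<Sum>b\<in>?I. g b)))"
      by (simp add: eval_nat_numeral)
    also have "\<dots> = (\<Sum>(b0, b1, b2, b3)\<in>Q. g b0 * (g b1 * (g b2 * g b3)))"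
      unfolding Q_def by (simp add: sum.cartesian_product[symmetric] sum_distrib_left[symmetric] sum_distrib_right[symmetric])
    finally show ?thesis by (simp add: mult.assoc)
  qed
  then have "(\<Sum>x\<in>{0..<int m}. (\<Sum>b\<in>?I. f (x + b)) ^ 4)
      = (\<Sum>x\<in>{0..<int m}. \<Sum>(b0, b1, b2, b3)\<in>Q. f ((x + b0) * (x + b1) * (x + b2) * (x + b3)))"
    by (simp add: f(1))
  also have "\<dots> = (\<Sum>b\<in>Q. W b)"
    unfolding W_def by (subst sum.swap) (simp add: case_prod_unfold)
  also have "\<dots> = (\<Sum>b\<in>E. W b) + (\<Sum>b\<in>Q - E. W b)"
    using finQ by (metis sum.subset_diff add.commute)
  also have "(\<Sum>b\<in>E. W b) \<le> (\<Sum>b\<in>E. real m)"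
  proof (rule sum_mono)
    fix b assume "b \<in> E"
    obtain b0 b1 b2 b3 where b: "b = (b0, b1, b2, b3)" by (metis prod_cases4)
    have "W b \<le> (\<Sum>x\<in>{0..<int m}. 1)"
      unfolding W_def b prod.case using f(2) by (intro sum_mono) (metis abs_le_D1)
    then show "W b \<le> real m" by simp
  qed
  also have "\<dots> \<le> 3 * (real B)\<^sup>2 * real m"
  proof -
    have "E \<subseteq> (\<lambda>(x, y). (x, x, y, y)) ` (?I \<times> ?I) \<union> ((\<lambda>(x, y). (x, y, x, y)) ` (?I \<times> ?I) \<union> (\<lambda>(x, y). (x, y, y, x)) ` (?I \<times> ?I))"
      by (auto simp: E_def Q_def)
    then have "card E \<le> card ((\<lambda>(x, y). (x, x, y, y)) ` (?I \<times> ?I) \<union> ((\<lambda>(x, y). (x, y, x, y)) ` (?I \<times> ?I) \<union> (\<lambda>(x, y). (x, y, y, x)) ` (?I \<times> ?I)))"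
      by (intro card_mono) auto
    also have "\<dots> \<le> B\<^sup>2 + (B\<^sup>2 + B\<^sup>2)"
      by (intro order.trans[OF card_Un_le] add_mono order.trans[OF card_image_le])
        (auto simp: card_cartesian_product power2_eq_square)
    finally have "card E \<le> 3 * B\<^sup>2" by simp
    then have "real (card E) \<le> 3 * (real B)\<^sup>2" by (metis of_nat_le_iff of_nat_mult of_nat_numeral of_nat_power)
    then show ?thesis by (simp add: mult_right_mono)
  qed
  also have "(\<Sum>b\<in>Q - E. W b) \<le> (\<Sum>b\<in>Q - E. C)"
  proof (rule sum_mono)
    fix b assume b: "b \<in> Q - E"
    obtain b0 b1 b2 b3 where eq: "b = (b0, b1, b2, b3)" by (metis prod_cases4)
    define \<beta> where "\<beta> j = (if j = 0 then b0 else if j = 1 then b1 else if j = 2 then b2 else b3)" for j :: nat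
    have "\<exists>c. odd (card {j. j < 4 \<and> \<beta> j = c})"
      by (rule odd_fibre_of_unpaired) (use b eq in \<open>auto simp: \<beta>_def E_def\<close>)
    then obtain c where c: "odd (card {j. j < 4 \<and> \<beta> j = c})" by blast
    have "\<beta> j \<in> ?I" if "j < 4" for j using b by (auto simp: \<beta>_def eq Q_def)
    from quartic[OF this c] have "\<bar>\<Sum>x\<in>{0..<int m}. f (\<Prod>j<4. x + \<beta> j)\<bar> \<le> C" by simp
    moreover have "(\<Prod>j<4. x + \<beta> j) = (x + b0) * (x + b1) * (x + b2) * (x + b3)" for x
      by (simp add: \<beta>_def eval_nat_numeral)
    ultimately have "\<bar>W b\<bar> \<le> C" by (simp add: W_def eq)
    then show "W b \<le> C" by simp
  qed
  also have "\<dots> \<le> C * real B ^ 4"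
  proof -
    have "card (Q - E) \<le> card Q" using finQ by (intro card_mono) auto
    also have "card Q = B ^ 4" by (simp add: Q_def card_cartesian_product eval_nat_numeral)
    finally have "real (card (Q - E)) \<le> real B ^ 4" by (metis of_nat_le_iff of_nat_power)
    then show ?thesis using C by (simp add: mult.commute mult_left_mono)
  qed
  finally show ?thesis by simp
qed

lemma sum_Cauchy_Schwarz:
  fixes g h :: "'b \<Rightarrow> real"
  shows "(\<Sum>i\<in>S. g i * h i)\<^sup>2 \<le> (\<Sum>i\<in>S. (g i)\<^sup>2) * (\<Sum>i\<in>S. (h i)\<^sup>2)"
proof -
  have "0 \<le> (\<Sum>i\<in>S. \<Sum>j\<in>S. (g i * h j - g j * h i)\<^sup>2)" by (intro sum_nonneg) auto
  also have "\<dots> = (\<Sum>i\<in>S. \<Sum>j\<in>S. (g i)\<^sup>2 * (h j)\<^sup>2 + (h i)\<^sup>2 * (g j)\<^sup>2 - 2 * ((g i * h i) * (g j * h j)))"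
    by (intro sum.cong) (auto simp: power2_eq_square algebra_simps)
  also have "\<dots> = (\<Sum>i\<in>S. \<Sum>j\<in>S. (g i)\<^sup>2 * (h j)\<^sup>2) + (\<Sum>i\<in>S. \<Sum>j\<in>S. (h i)\<^sup>2 * (g j)\<^sup>2)
      - 2 * (\<Sum>i\<in>S. \<Sum>j\<in>S. (g i * h i) * (g j * h j))"
    by (simp only: sum.distrib sum_subtractf sum_distrib_left)
  also have "\<dots> = 2 * ((\<Sum>i\<in>S. (g i)\<^sup>2) * (\<Sum>i\<in>S. (h i)\<^sup>2)) - 2 * (\<Sum>i\<in>S. g i * h i)\<^sup>2"
    unfolding sum_product[symmetric] by (simp add: power2_eq_square)
  finally show ?thesis by simp
qed

lemma card_fraction_pairs:
  fixes M :: int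
  assumes A: "A \<ge> 1" and m: "2 * A * N < m"
  shows "(\<Sum>(a, a')\<in>{1..A} \<times> {1..A}. real (card {(n, n') \<in> {M<..M + int N} \<times> {M<..M + int N}. int m dvd int a * n' - int a' * n}))
    \<le> (real A)\<^sup>2 + 2 * real A * real N * (1 + ln (real A))"
proof -
  let ?mx = "\<lambda>a a'. real (max (a div gcd a a') (a' div gcd a a'))"
  have "(\<Sum>(a, a')\<in>{1..A} \<times> {1..A}. real (card {(n, n') \<in> {M<..M + int N} \<times> {M<..M + int N}. int m dvd int a * n' - int a' * n}))
      \<le> (\<Sum>(a, a')\<in>{1..A} \<times> {1..A}. 1 + real N * (1 / ?mx a a'))"
    using card_fraction_solutions[OF _ _ _ _ m] by (intro sum_mono) auto
  also have "\<dots> = (real A)\<^sup>2 + real N * (\<Sum>(a, a')\<in>{1..A} \<times> {1..A}. 1 / ?mx a a')"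
    by (simp add: case_prod_unfold sum.distrib sum_distrib_left card_cartesian_product power2_eq_square)
  also have "\<dots> \<le> (real A)\<^sup>2 + real N * (2 * real A * (1 + ln (real A)))"
    using sum_gcd_max_le[OF A] by (intro add_left_mono mult_left_mono) auto
  finally show ?thesis by (simp add: algebra_simps)
qed

text \<open>Since f(n + a b) = f(a) f(n / a + b) modulo m, the double sum runs over quotients x = n
  / a, weighted by the number \<nu>(x) of their representations. Applying Cauchy-Schwarz twice
  bounds the fourth power by (\<Sum> \<nu>)^2 (\<Sum> \<nu>^2) (\<Sum> G^4).\<close>

lemma burgess_shift_moment:
  fixes f :: "int \<Rightarrow> real" and M :: int
  assumes f: "real_char m f" and A: "A \<ge> 1" and cop: "\<And>a. 1 \<le> a \<Longrightarrow> a \<le> A \<Longrightarrow> coprime (int a) (int m)"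
    and m: "2 * A * N < m"
  shows "(\<Sum>a=1..A. \<Sum>n\<in>{M<..M + int N}. \<bar>\<Sum>b\<in>{1..int B}. f (n + int a * b)\<bar>) ^ 4
    \<le> (real A * real N)\<^sup>2 * ((real A)\<^sup>2 + 2 * real A * real N * (1 + ln (real A)))
        * (\<Sum>x\<in>{0..<int m}. (\<Sum>b\<in>{1..int B}. f (x + b)) ^ 4)"
proof -
  note F = real_charD[OF f]
  let ?I = "{M<..M + int N}"
  let ?X = "{0..<int m}"
  define G where "G x = (\<Sum>b\<in>{1..int B}. f (x + b))" for x
  define w where "w a = (SOME w. [int a * w = 1] (mod int m))" for a
  have w: "[int a * w a = 1] (mod int m)" if "1 \<le> a" "a \<le> A" for a
    unfolding w_def by (rule someI_ex) (use cong_solve_coprime_int cop[OF that] in blast)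
  define \<phi> where "\<phi> i = (w (fst i) * snd i) mod int m" for i :: "nat \<times> int"
  define P where "P = {1..A} \<times> ?I"
  have finP: "finite P" by (simp add: P_def)
  have Pn: "(\<Sum>i\<in>P. h i) = (\<Sum>a=1..A. \<Sum>n\<in>?I. h (a, n))" for h :: "nat \<times> int \<Rightarrow> real"
    by (simp add: P_def sum.cartesian_product)
  have \<phi>X: "\<phi> i \<in> ?X" for i using F(1) by (simp add: \<phi>_def)
  have \<phi>: "[int a * \<phi> (a, n) = n] (mod int m)" if "1 \<le> a" "a \<le> A" for a n
  proof -
    have "[int a * \<phi> (a, n) = int a * (w a * n)] (mod int m)"
      by (intro cong_mult cong_refl) (simp add: \<phi>_def cong_def)
    moreover have "[(int a * w a) * n = 1 * n] (mod int m)" by (intro cong_mult w that cong_refl)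
    ultimately show ?thesis by (simp add: mult.assoc) (metis cong_trans)
  qed
  have G: "\<bar>\<Sum>b\<in>{1..int B}. f (n + int a * b)\<bar> = \<bar>G (\<phi> (a, n))\<bar>" if "1 \<le> a" "a \<le> A" for a n
  proof -
    have "f (n + int a * b) = f (int a) * f (\<phi> (a, n) + b)" for b
    proof -
      have "[int a * (\<phi> (a, n) + b) = n + int a * b] (mod int m)"
        unfolding distrib_left by (intro cong_add \<phi> that cong_refl)
      then show ?thesis using F(2,5) by metis
    qed
    then have "(\<Sum>b\<in>{1..int B}. f (n + int a * b)) = f (int a) * G (\<phi> (a, n))"
      by (simp add: G_def sum_distrib_left)
    moreover have "\<bar>f (int a)\<bar> = 1" using F(3,4)[of "int a"] cop[OF that] by auto
    ultimately show ?thesis by (simp add: abs_mult)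
  qed
  define V where "V = (\<Sum>a=1..A. \<Sum>n\<in>?I. \<bar>\<Sum>b\<in>{1..int B}. f (n + int a * b)\<bar>)"
  have V: "V = (\<Sum>i\<in>P. \<bar>G (\<phi> i)\<bar>)"
    unfolding V_def P_def sum.cartesian_product by (intro sum.cong) (auto simp: G)
  define \<nu> where "\<nu> x = real (card {i \<in> P. \<phi> i = x})" for x
  have \<nu>: "(\<Sum>i\<in>P. g (\<phi> i)) = (\<Sum>x\<in>?X. \<nu> x * g x)" for g :: "int \<Rightarrow> real"
  proof -
    have "(\<Sum>i\<in>P. g (\<phi> i)) = (\<Sum>x\<in>?X. \<Sum>i | i \<in> P \<and> \<phi> i = x. g (\<phi> i))"
      by (rule sum.group[symmetric]) (use finP \<phi>X in auto)
    also have "\<dots> = (\<Sum>x\<in>?X. \<nu> x * g x)"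
      by (intro sum.cong refl) (simp add: \<nu>_def)
    finally show ?thesis .
  qed
  have 1: "V\<^sup>2 \<le> (real A * real N) * (\<Sum>x\<in>?X. \<nu> x * (G x)\<^sup>2)"
  proof -
    have "V\<^sup>2 \<le> (\<Sum>i\<in>P. 1\<^sup>2) * (\<Sum>i\<in>P. \<bar>G (\<phi> i)\<bar>\<^sup>2)"
      unfolding V using sum_Cauchy_Schwarz[of "\<lambda>_. 1" "\<lambda>i. \<bar>G (\<phi> i)\<bar>" P] by simp
    also have "(\<Sum>i\<in>P. 1\<^sup>2) = real A * real N" by (simp add: P_def card_cartesian_product)
    also have "(\<Sum>i\<in>P. \<bar>G (\<phi> i)\<bar>\<^sup>2) = (\<Sum>x\<in>?X. \<nu> x * (G x)\<^sup>2)"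
      using \<nu>[of "\<lambda>x. (G x)\<^sup>2"] by simp
    finally show ?thesis .
  qed
  have 2: "(\<Sum>x\<in>?X. \<nu> x * (G x)\<^sup>2)\<^sup>2 \<le> (\<Sum>x\<in>?X. (\<nu> x)\<^sup>2) * (\<Sum>x\<in>?X. G x ^ 4)"
    using sum_Cauchy_Schwarz[of \<nu> "\<lambda>x. (G x)\<^sup>2" ?X] by (simp flip: power_mult)
  have 3: "(\<Sum>x\<in>?X. (\<nu> x)\<^sup>2) \<le> (real A)\<^sup>2 + 2 * real A * real N * (1 + ln (real A))"
  proof -
    have "(\<Sum>x\<in>?X. (\<nu> x)\<^sup>2) = (\<Sum>i\<in>P. \<nu> (\<phi> i))" using \<nu>[of \<nu>] by (simp add: power2_eq_square)
    \<comment> \<open>The sum of \<nu>^2 counts pairs of representations of the same quotient, which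
      solve a n' = a' n modulo m.\<close>
    also have "\<dots> = (\<Sum>i\<in>P. \<Sum>i'\<in>P. of_bool (\<phi> i' = \<phi> i))"
      unfolding \<nu>_def by (intro sum.cong refl) (simp add: finP Int_def)
    also have "\<dots> = (\<Sum>a=1..A. \<Sum>n\<in>?I. \<Sum>a'=1..A. \<Sum>n'\<in>?I. of_bool (\<phi> (a', n') = \<phi> (a, n)))"
      by (simp only: Pn)
    also have "\<dots> = (\<Sum>a=1..A. \<Sum>a'=1..A. \<Sum>n\<in>?I. \<Sum>n'\<in>?I. of_bool (\<phi> (a', n') = \<phi> (a, n)))"
      by (intro sum.cong refl sum.swap)
    also have "\<dots> \<le> (\<Sum>a=1..A. \<Sum>a'=1..A. \<Sum>n\<in>?I. \<Sum>n'\<in>?I. of_bool (int m dvd int a * n' - int a' * n))"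
    proof (intro sum_mono)
      fix a n a' n' assume a: "a \<in> {1..A}" "a' \<in> {1..A}"
      have "int m dvd int a * n' - int a' * n" if "\<phi> (a', n') = \<phi> (a, n)"
      proof -
        have "[int a * n' = int a * (int a' * \<phi> (a', n'))] (mod int m)"
          using a by (intro cong_mult cong_refl cong_sym[OF \<phi>]) auto
        moreover have "[int a' * n = int a' * (int a * \<phi> (a, n))] (mod int m)"
          using a by (intro cong_mult cong_refl cong_sym[OF \<phi>]) auto
        moreover have "int a * (int a' * \<phi> (a', n')) = int a' * (int a * \<phi> (a, n))" using that by simp
        ultimately have "[int a * n' = int a' * n] (mod int m)" by (metis cong_sym cong_trans)
        then show ?thesis by (simp add: cong_iff_dvd_diff)
      qed
      then show "of_bool (\<phi> (a', n') = \<phi> (a, n)) \<le> (of_bool (int m dvd int a * n' - int a' * n) :: real)"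
        by auto
    qed
    also have "\<dots> = (\<Sum>(a, a')\<in>{1..A} \<times> {1..A}. real (card {(n, n') \<in> ?I \<times> ?I. int m dvd int a * n' - int a' * n}))"
    proof -
      have "(\<Sum>n\<in>?I. \<Sum>n'\<in>?I. of_bool (int m dvd int a * n' - int a' * n))
          = real (card {(n, n') \<in> ?I \<times> ?I. int m dvd int a * n' - int a' * n})" for a a'
      proof -
        have "(\<Sum>n\<in>?I. \<Sum>n'\<in>?I. of_bool (int m dvd int a * n' - int a' * n))
          = (\<Sum>p\<in>?I \<times> ?I. of_bool (int m dvd int a * snd p - int a' * fst p) :: real)"
          unfolding sum.cartesian_product by (simp only: case_prod_unfold)
        also have "\<dots> = real (card {p \<in> ?I \<times> ?I. int m dvd int a * snd p - int a' * fst p})"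
          by (simp add: Int_def)
        also have "{p \<in> ?I \<times> ?I. int m dvd int a * snd p - int a' * fst p} = {(n, n') \<in> ?I \<times> ?I. int m dvd int a * n' - int a' * n}"
          by auto
        finally show ?thesis .
      qed
      then show ?thesis by (simp add: sum.cartesian_product)
    qed
    also have "\<dots> \<le> (real A)\<^sup>2 + 2 * real A * real N * (1 + ln (real A))"
      by (rule card_fraction_pairs[OF A m])
    finally show ?thesis .
  qed
  have T: "(\<Sum>x\<in>?X. G x ^ 4) \<ge> 0" by (intro sum_nonneg) auto
  have "V ^ 4 = (V\<^sup>2)\<^sup>2" by simp
  also have "\<dots> \<le> ((real A * real N) * (\<Sum>x\<in>?X. \<nu> x * (G x)\<^sup>2))\<^sup>2" by (intro power_mono 1) auto
  also have "\<dots> = (real A * real N)\<^sup>2 * (\<Sum>x\<in>?X. \<nu> x * (G x)\<^sup>2)\<^sup>2" by (rule power_mult_distrib)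
  also have "\<dots> \<le> (real A * real N)\<^sup>2 * ((\<Sum>x\<in>?X. (\<nu> x)\<^sup>2) * (\<Sum>x\<in>?X. G x ^ 4))"
    by (intro mult_left_mono 2) auto
  also have "\<dots> \<le> (real A * real N)\<^sup>2 * (((real A)\<^sup>2 + 2 * real A * real N * (1 + ln (real A))) * (\<Sum>x\<in>?X. G x ^ 4))"
    by (intro mult_left_mono mult_right_mono 3 T) auto
  finally show ?thesis unfolding V_def G_def by (simp only: mult.assoc)
qed

lemma interval_sum_split:
  fixes f :: "int \<Rightarrow> real"
  shows "(\<Sum>n\<in>{M<..M + int (N + h)}. f n) = (\<Sum>n\<in>{M<..M + int N}. f n) + (\<Sum>n\<in>{M + int N<..M + int N + int h}. f n)"
proof -
  have "{M<..M + int (N + h)} = {M<..M + int N} \<union> {M + int N<..M + int N + int h}" by auto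
  then show ?thesis by (simp add: sum.union_disjoint)
qed

lemma interval_sum_shift:
  fixes f :: "int \<Rightarrow> real"
  shows "(\<Sum>n\<in>{M<..M + int N}. f (n + h)) = (\<Sum>n\<in>{M + h<..M + h + int N}. f n)"
  by (rule sum.reindex_bij_witness[of _ "\<lambda>n. n - h" "\<lambda>n. n + h"]) auto

text \<open>Shifting the interval by a b changes the sum only by two end pieces of length a b \<le>
  N / 16. By the inductive bound each is at most G sqrt N / 4, so together they cost half of the
  bound aimed at.\<close>

lemma burgess_step:
  fixes f :: "int \<Rightarrow> real" and M :: int
  assumes A: "A \<ge> 1" and B: "B \<ge> 1" and hN: "\<And>a b. a \<in> {1..A} \<Longrightarrow> b \<in> {1..B} \<Longrightarrow> 16 * (a * b) \<le> N"
    and IH: "\<And>M h. h < N \<Longrightarrow> \<bar>\<Sum>n\<in>{M<..M + int h}. f n\<bar> \<le> G * sqrt (real h)" and G: "G \<ge> 0" and N: "N > 0"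
  shows "real A * real B * \<bar>\<Sum>n\<in>{M<..M + int N}. f n\<bar>
    \<le> (\<Sum>a=1..A. \<Sum>n\<in>{M<..M + int N}. \<bar>\<Sum>b\<in>{1..int B}. f (n + int a * b)\<bar>) + real A * real B * (G * sqrt (real N) / 2)"
proof -
  let ?I = "{M<..M + int N}"
  define S where "S = (\<Sum>n\<in>?I. f n)"
  define \<delta> where "\<delta> a b = S - (\<Sum>n\<in>?I. f (n + int a * b))" for a b
  have \<delta>: "\<bar>\<delta> a b\<bar> \<le> G * sqrt (real N) / 2" if a: "a \<in> {1..A}" and b: "b \<in> {1..int B}" for a b
  proof -
    define h where "h = a * nat b"
    have hi: "int a * b = int h" using b by (simp add: h_def)
    have h16: "16 * h \<le> N" unfolding h_def using a b by (intro hN) auto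
    then have "h < N" using N by linarith
    have "S + (\<Sum>n\<in>{M + int N<..M + int N + int h}. f n) = (\<Sum>n\<in>{M<..M + int h}. f n) + (\<Sum>n\<in>{M + int h<..M + int h + int N}. f n)"
      unfolding S_def using interval_sum_split[of f M N h] interval_sum_split[of f M h N] by (simp add: add.commute)
    then have "\<delta> a b = (\<Sum>n\<in>{M<..M + int h}. f n) - (\<Sum>n\<in>{M + int N<..M + int N + int h}. f n)"
      unfolding \<delta>_def hi interval_sum_shift by simp
    then have "\<bar>\<delta> a b\<bar> \<le> G * sqrt (real h) + G * sqrt (real h)"
      using IH[OF \<open>h < N\<close>, of M] IH[OF \<open>h < N\<close>, of "M + int N"] by linarith
    also have "G * sqrt (real h) \<le> G * (sqrt (real N) / 4)"
    proof (intro mult_left_mono G)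
      have "sqrt (real h) \<le> sqrt (real N / 16)" using h16 by (intro real_sqrt_le_mono) linarith
      then show "sqrt (real h) \<le> sqrt (real N) / 4" by (simp add: real_sqrt_divide)
    qed
    finally show ?thesis by simp
  qed
  have "real A * real B * S = (\<Sum>a=1..A. \<Sum>b\<in>{1..int B}. S)" by simp
  also have "\<dots> = (\<Sum>a=1..A. \<Sum>b\<in>{1..int B}. \<Sum>n\<in>?I. f (n + int a * b)) + (\<Sum>a=1..A. \<Sum>b\<in>{1..int B}. \<delta> a b)"
    unfolding \<delta>_def by (simp add: sum_subtractf)
  also have "(\<Sum>a=1..A. \<Sum>b\<in>{1..int B}. \<Sum>n\<in>?I. f (n + int a * b)) = (\<Sum>a=1..A. \<Sum>n\<in>?I. \<Sum>b\<in>{1..int B}. f (n + int a * b))"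
    by (intro sum.cong refl sum.swap)
  finally have eq: "real A * real B * S = (\<Sum>a=1..A. \<Sum>n\<in>?I. \<Sum>b\<in>{1..int B}. f (n + int a * b)) + (\<Sum>a=1..A. \<Sum>b\<in>{1..int B}. \<delta> a b)" .
  have "\<bar>\<Sum>a=1..A. \<Sum>n\<in>?I. \<Sum>b\<in>{1..int B}. f (n + int a * b)\<bar> \<le> (\<Sum>a=1..A. \<Sum>n\<in>?I. \<bar>\<Sum>b\<in>{1..int B}. f (n + int a * b)\<bar>)"
    by (rule order.trans[OF sum_abs], rule sum_mono, rule sum_abs)
  moreover have "\<bar>\<Sum>a=1..A. \<Sum>b\<in>{1..int B}. \<delta> a b\<bar> \<le> (\<Sum>a=1..A. \<Sum>b\<in>{1..int B}. G * sqrt (real N) / 2)"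
    by (intro order.trans[OF sum_abs] sum_mono order.trans[OF sum_abs] \<delta>) auto
  moreover have "\<bar>real A * real B * S\<bar> = real A * real B * \<bar>S\<bar>" by (simp add: abs_mult)
  ultimately show ?thesis using eq unfolding S_def by simp
qed

text \<open>All exponents in the Burgess argument are multiples of 1 / 16, so that with r = m^(1/16)
  only integer powers remain.\<close>

lemma powr_sixteenth:
  assumes "real m > 10 ^ 160"
  obtains r where "r \<ge> 10 ^ 10" "real m = r ^ 16" "real m powr (1/4) = r ^ 4" "real m powr (3/8) = r ^ 6"
    "real m powr (3/16) = r ^ 3" "sqrt (real m) = r ^ 8" "real m powr (1/16) = r"
proof
  define r where "r = real m powr (1/16)"
  have pos: "real m > 0" using assms by (rule less_trans[rotated]) simp
  then have r0: "r > 0" by (simp add: r_def)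
  have rp: "r ^ k = real m powr (real k / 16)" for k
    using r0 by (simp add: r_def powr_powr flip: powr_realpow)
  have px: "(x ^ k) powr (1 / real k) = x" if "x > 0" "k > 0" for x :: real and k
    using that by (simp add: powr_powr flip: powr_realpow)
  have "(10 ^ 10 :: real) = ((10 ^ 10) ^ 16) powr (1/16)"
    using px[of "10 ^ 10" 16] by (simp only: of_nat_numeral) simp
  also have "(10 ^ 10) ^ 16 = (10 ^ 160 :: real)" by (simp flip: power_mult)
  also have "(10 ^ 160) powr (1/16) \<le> r" unfolding r_def using assms by (intro powr_mono2) auto
  finally show "r \<ge> 10 ^ 10" .
  show "real m = r ^ 16" "real m powr (1/4) = r ^ 4" "real m powr (3/8) = r ^ 6" "real m powr (3/16) = r ^ 3"
    using pos by (simp_all add: rp)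
  show "sqrt (real m) = r ^ 8" using pos by (simp add: rp powr_half_sqrt)
  show "real m powr (1/16) = r" by (simp add: r_def)
qed

text \<open>Induction on the length. With A B about N / 16 the end pieces use up half of the claimed
  bound, and the moment estimate has to supply the other half.\<close>

lemma burgess_bound:
  fixes f :: "int \<Rightarrow> real" and M :: int
  assumes f: "real_char m f" and m: "real m > 10 ^ 160" "ln (real m) > 366"
    and cop: "\<And>a. 1 \<le> a \<Longrightarrow> real a \<le> real m powr (3/8) \<Longrightarrow> coprime (int a) (int m)"
    and quartic: "\<And>(\<beta> :: nat \<Rightarrow> int) B c. (\<And>j. j < 4 \<Longrightarrow> \<beta> j \<in> {1..B}) \<Longrightarrow> real_of_int B \<le> real m powr (3/8) \<Longrightarrow>
      odd (card {j. j < 4 \<and> \<beta> j = c}) \<Longrightarrow> \<bar>\<Sum>x\<in>{0..<int m}. f (\<Prod>j<4. x + \<beta> j)\<bar> \<le> 100 * sqrt (real m)"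
    and N: "real N \<le> sqrt (real m)"
  shows "\<bar>\<Sum>n\<in>{M<..M + int N}. f n\<bar> \<le> ln (real m) * real m powr (3/16) / 10 * sqrt (real N)"
proof -
  obtain r where r: "r \<ge> 10 ^ 10" "real m = r ^ 16" "real m powr (1/4) = r ^ 4" "real m powr (3/8) = r ^ 6"
    "real m powr (3/16) = r ^ 3" "sqrt (real m) = r ^ 8" using powr_sixteenth[OF m(1)] by blast
  have r1: "r > 1" using r(1) by (rule less_le_trans[rotated]) simp
  define L where "L = ln (real m)"
  define G where "G = L * r ^ 3 / 10"
  \<comment> \<open>For fixed A B the estimate depends on B through 3 m / B + 100 sqrt m B, which is
    smallest at B = sqrt (3 / 100) r^4, close to r^4 / 6. The value there is about 34.7
    r^12.\<close>
  define B where "B = nat \<lfloor>r ^ 4 / 6\<rfloor>"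
  have L: "L > 366" using m(2) by (simp add: L_def)
  have G: "G > 0" using L r1 by (simp add: G_def)
  have r4: "r ^ 4 \<ge> 10 ^ 40" using power_mono[OF r(1), of 4] by simp
  have B: "real B \<le> r ^ 4 / 6" "real B \<ge> r ^ 4 / 6 - 1"
  proof -
    have "real B = of_int \<lfloor>r ^ 4 / 6\<rfloor>" unfolding B_def using r4 by simp
    then show "real B \<le> r ^ 4 / 6" "real B \<ge> r ^ 4 / 6 - 1" by linarith+
  qed
  have B2: "real B \<ge> r ^ 4 * (100 / 601)" using B(2) r4 by simp
  have Bpos: "real B > 0" using less_le_trans[OF _ B2, of 0] r1 by simp
  have B6: "real B \<le> r ^ 6"
  proof -
    have "r ^ 4 \<le> r ^ 6" using r1 by (intro power_increasing) auto
    moreover have "r ^ 4 / 6 \<le> r ^ 4" using r1 by simp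
    ultimately show ?thesis using B(1) by linarith
  qed
  define T where "T = (\<Sum>x\<in>{0..<int m}. (\<Sum>b\<in>{1..int B}. f (x + b)) ^ 4)"
  have T: "T \<le> real B ^ 3 * (347 / 10 * r ^ 12)"
  proof -
    have "T \<le> 3 * (real B)\<^sup>2 * real m + 100 * sqrt (real m) * real B ^ 4"
      unfolding T_def
    proof (rule fourth_moment)
      show "\<bar>\<Sum>x\<in>{0..<int m}. f (\<Prod>j<4. x + \<beta> j)\<bar> \<le> 100 * sqrt (real m)"
        if "\<And>j. j < 4 \<Longrightarrow> \<beta> j \<in> {1..int B}" "odd (card {j. j < 4 \<and> \<beta> j = c})" for \<beta> :: "nat \<Rightarrow> int" and c
        by (rule quartic[OF that(1) _ that(2)]) (use B6 r(4) in auto)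
    qed (use real_charD(2,7)[OF f] in auto)
    also have "\<dots> \<le> 3 * (real B)\<^sup>2 * (real B * (601 / 100) * r ^ 12) + 100 * r ^ 8 * (real B ^ 3 * (r ^ 4 / 6))"
      unfolding r(6)
    proof (intro add_mono mult_left_mono)
      have "real m = r ^ 4 * r ^ 12" by (simp add: r(2) flip: power_add)
      also have "\<dots> \<le> (real B * (601 / 100)) * r ^ 12" using B2 r1 by (intro mult_right_mono) auto
      finally show "real m \<le> real B * (601 / 100) * r ^ 12" .
      have "real B ^ 4 = real B ^ 3 * real B" by (simp add: eval_nat_numeral)
      also have "\<dots> \<le> real B ^ 3 * (r ^ 4 / 6)" using B(1) by (intro mult_left_mono) auto
      finally show "real B ^ 4 \<le> real B ^ 3 * (r ^ 4 / 6)" .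
    qed (use r r1 in auto)
    also have "\<dots> = real B ^ 3 * (r ^ 12 * (3 * 601 / 100 + 100 / 6))"
    proof -
      have "r ^ 8 * r ^ 4 = r ^ 12" by (simp flip: power_add)
      then have "100 * r ^ 8 * (real B ^ 3 * (r ^ 4 / 6)) = 100 / 6 * real B ^ 3 * r ^ 12" by (simp add: algebra_simps)
      then show ?thesis by (simp add: power2_eq_square power3_eq_cube algebra_simps)
    qed
    also have "\<dots> \<le> real B ^ 3 * (347 / 10 * r ^ 12)"
      using r1 Bpos by (intro mult_left_mono) auto
    finally show ?thesis .
  qed
  have main: "\<bar>\<Sum>n\<in>{M<..M + int N}. f n\<bar> \<le> G * sqrt (real N)" if "real N \<le> r ^ 8" for M N
    using that
  proof (induction N arbitrary: M rule: less_induct)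
    case (less N)
    show ?case
    \<comment> \<open>Up to length G^2 the trivial bound N is already at most G sqrt N.\<close>
    proof (cases "real N \<le> G\<^sup>2")
      case True
      have "\<bar>\<Sum>n\<in>{M<..M + int N}. f n\<bar> \<le> (\<Sum>n\<in>{M<..M + int N}. 1)"
        using real_charD(7)[OF f] by (intro order.trans[OF sum_abs] sum_mono) auto
      also have "\<dots> = sqrt (real N) * sqrt (real N)" by simp
      also have "\<dots> \<le> G * sqrt (real N)"
        using True G by (intro mult_right_mono real_le_lsqrt) auto
      finally show ?thesis .
    next
      case False
      define A where "A = N div (16 * B)"
      have "r ^ 6 * 1339 \<le> r ^ 6 * (L\<^sup>2 / 100)"
        using power_mono[of 366 L 2] L r1 by (intro mult_left_mono) auto
      also have "\<dots> = G\<^sup>2" by (simp add: G_def power2_eq_square flip: power_add)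
      finally have N1339: "real N \<ge> r ^ 6 * 1339" using False by linarith
      have "r ^ 4 \<le> r ^ 6" using r1 by (intro power_increasing) auto
      \<comment> \<open>272 = 16 * 17: the rounding loss 16 B in the choice of \<open>A\<close> is
        at most N / 17, so that N \<le> 17 A B.\<close>
      then have N272: "real N \<ge> 272 * real B" using N1339 B(1) r1 by linarith
      have "N = 16 * B * A + N mod (16 * B)" by (simp add: A_def)
      moreover have "N mod (16 * B) < 16 * B" using Bpos by simp
      ultimately have "16 * B * A \<le> N" "N < 16 * B * A + 16 * B" by linarith+
      then have AB: "16 * (real B * real A) \<le> real N" "real N \<le> 16 * (real B * real A) + 16 * real B"
        by (metis of_nat_le_iff of_nat_mult of_nat_numeral mult.assoc)
          (metis (mono_tags) \<open>N < 16 * B * A + 16 * B\<close> less_imp_le of_nat_add of_nat_le_iff of_nat_mult of_nat_numeral mult.assoc)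
      have AB17: "real N \<le> 17 * (real A * real B)" using AB(2) N272 by (simp add: algebra_simps)
      have "A \<noteq> 0" using AB17 N272 Bpos by (intro notI) simp
      then have A1: "A \<ge> 1" by simp
      have B1: "B \<ge> 1" using Bpos by simp
      have Ar: "real A \<le> r ^ 4"
      proof -
        have "real A * r ^ 4 \<le> real A * (real B * (601 / 100))" using B2 by (intro mult_left_mono) auto
        also have "\<dots> \<le> real N" using AB(1) by (simp add: algebra_simps)
        also have "\<dots> \<le> r ^ 4 * r ^ 4" using less.prems by (simp flip: power_add)
        finally show ?thesis by (rule mult_right_le_imp_le) (use r1 in auto)
      qed
      \<comment> \<open>A is at most m^(1/4), which gives L / 2 for the logarithmic part; L > 366
        puts 3 below L / 100.\<close>
      have lnA: "3 + 2 * ln (real A) \<le> 51 / 100 * L"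
      proof -
        have "ln (real A) \<le> ln (r ^ 4)" using Ar A1 by (intro ln_mono) auto
        also have "\<dots> = 4 * ln r" using r1 by (simp add: ln_realpow)
        also have "\<dots> = L / 4" using r1 by (simp add: L_def r(2) ln_realpow)
        finally show ?thesis using L by simp
      qed
      have AN: "real A \<le> real N"
        using AB(1) Bpos B1 mult_mono[of 1 "real B" "real A" "real A"] by simp
      let ?V = "\<Sum>a=1..A. \<Sum>n\<in>{M<..M + int N}. \<bar>\<Sum>b\<in>{1..int B}. f (n + int a * b)\<bar>"
      have step: "real A * real B * \<bar>\<Sum>n\<in>{M<..M + int N}. f n\<bar> \<le> ?V + real A * real B * (G * sqrt (real N) / 2)"
      proof (rule burgess_step[OF A1 B1])
        fix a b assume "a \<in> {1..A}" "b \<in> {1..B}"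
        then have "a * b \<le> A * B" by (intro mult_le_mono) auto
        then show "16 * (a * b) \<le> N" using \<open>16 * B * A \<le> N\<close> by (simp add: mult.commute mult.left_commute)
      next
        fix M h assume "h < N"
        then show "\<bar>\<Sum>n\<in>{M<..M + int h}. f n\<bar> \<le> G * sqrt (real h)"
          using less.prems by (intro less.IH) auto
      qed (use G AN A1 in auto)
      have V0: "?V \<ge> 0" by (intro sum_nonneg) auto
      have "?V ^ 4 \<le> (real A * real N)\<^sup>2 * ((real A)\<^sup>2 + 2 * real A * real N * (1 + ln (real A))) * T"
        unfolding T_def
      proof (rule burgess_shift_moment[OF f A1])
        fix a assume a: "1 \<le> a" "a \<le> A"
        have "real a \<le> r ^ 6" using a Ar \<open>r ^ 4 \<le> r ^ 6\<close> by linarith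
        then show "coprime (int a) (int m)" using cop a r(4) by simp
      next
        have "2 * (real A * real N) \<le> 2 * (r ^ 4 * r ^ 8)" using Ar less.prems r1 by (intro mult_left_mono mult_mono) auto
        also have "\<dots> = 2 * r ^ 12" by (simp flip: power_add)
        also have "\<dots> < r ^ 4 * r ^ 12" using r4 r1 by (intro mult_strict_right_mono) auto
        also have "\<dots> = real m" by (simp add: r(2) flip: power_add)
        finally have "real (2 * A * N) < real m" by simp
        then show "2 * A * N < m" by linarith
      qed
      also have "\<dots> \<le> (real A * real N)\<^sup>2 * (real A * real N * (51 / 100 * L)) * (real B ^ 3 * (347 / 10 * r ^ 12))"
      proof (intro mult_mono T mult_left_mono)
        have "(real A)\<^sup>2 \<le> real A * real N" using AN by (simp add: power2_eq_square mult_left_mono)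
        then have "(real A)\<^sup>2 + 2 * real A * real N * (1 + ln (real A)) \<le> real A * real N * (3 + 2 * ln (real A))"
          by (simp add: algebra_simps)
        also have "\<dots> \<le> real A * real N * (51 / 100 * L)" using lnA by (intro mult_left_mono) auto
        finally show "(real A)\<^sup>2 + 2 * real A * real N * (1 + ln (real A)) \<le> real A * real N * (51 / 100 * L)" .
        show "0 \<le> T" unfolding T_def by (intro sum_nonneg) auto
      qed (use L A1 in auto)
      also have "\<dots> = (real A * real N * real B) ^ 3 * r ^ 12 * L * (51 / 100 * 347 / 10)"
        by (simp add: power_mult_distrib power2_eq_square power3_eq_cube algebra_simps)
      also have "\<dots> \<le> (real A * real B * (G * sqrt (real N) / 2)) ^ 4"
      proof -
        \<comment> \<open>Here the constant 1 / 10 in \<open>G\<close> is settled: 160000 = 20^4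
          comes from the fourth power of G / 2 and 17 from N \<le> 17 A B. Three of the four
          logarithms in G^4 pay for the constants.\<close>
        have "51 / 100 * 347 / 10 * 17 * 160000 \<le> (366::real) ^ 3" by simp
        also have "\<dots> \<le> L ^ 3" using L by (intro power_mono) auto
        finally have L3: "51 / 100 * 347 / 10 \<le> L ^ 3 / (17 * 160000)" by simp
        have "(real A * real N * real B) ^ 3 * r ^ 12 * L * (51 / 100 * 347 / 10)
            \<le> (real A * real N * real B) ^ 3 * r ^ 12 * L * (L ^ 3 / (17 * 160000))"
          using L3 L r1 by (intro mult_left_mono) auto
        also have "\<dots> = real N * ((real A * real B) ^ 3 * (real N)\<^sup>2 * r ^ 12 * L ^ 4 / (17 * 160000))"
          by (simp add: eval_nat_numeral algebra_simps)
        also have "\<dots> \<le> (17 * (real A * real B)) * ((real A * real B) ^ 3 * (real N)\<^sup>2 * r ^ 12 * L ^ 4 / (17 * 160000))"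
          using r1 by (intro mult_right_mono AB17) auto
        also have "\<dots> = (real A * real B) ^ 4 * (real N)\<^sup>2 * (r ^ 12 * L ^ 4 / 160000)"
          by (simp add: eval_nat_numeral)
        also have "\<dots> = (real A * real B * (G * sqrt (real N) / 2)) ^ 4"
        proof -
          have "sqrt (real N) ^ 4 = (real N)\<^sup>2" by (simp add: eval_nat_numeral)
          moreover have "G ^ 4 = r ^ 12 * L ^ 4 / 10000" by (simp add: G_def power_mult_distrib power_divide flip: power_mult)
          ultimately show ?thesis by (simp add: power_mult_distrib power_divide)
        qed
        finally show ?thesis .
      qed
      finally have "?V ^ 4 \<le> (real A * real B * (G * sqrt (real N) / 2)) ^ 4" .
      then have "?V \<le> real A * real B * (G * sqrt (real N) / 2)"
        using power_mono_iff[OF V0, of "real A * real B * (G * sqrt (real N) / 2)" 4] G by simp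
      then have "real A * real B * \<bar>\<Sum>n\<in>{M<..M + int N}. f n\<bar> \<le> real A * real B * (G * sqrt (real N))"
        using step by (simp add: algebra_simps)
      then show ?thesis using A1 B1 by (simp add: mult_le_cancel_left_pos)
    qed
  qed
  show ?thesis using main[of N M] N r(6) by (simp add: G_def L_def r(5))
qed

section \<open>Divisor sums of real characters\<close>

definition dconv :: "(nat \<Rightarrow> real) \<Rightarrow> (nat \<Rightarrow> real) \<Rightarrow> nat \<Rightarrow> real" where
  "dconv g h n = (\<Sum>d | d dvd n. g d * h (n div d))"

lemma sum_dconv_pairs:
  "(\<Sum>n=1..N. dconv g h n) = (\<Sum>(a, b)\<in>Sigma {1..N} (\<lambda>a. {1..N div a}). g a * h b)"
proof -
  have "(\<Sum>n=1..N. dconv g h n) = (\<Sum>(n, d)\<in>Sigma {1..N} (\<lambda>n. {d. d dvd n}). g d * h (n div d))"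
    unfolding dconv_def by (rule sum.Sigma) auto
  also have "\<dots> = (\<Sum>(a, b)\<in>Sigma {1..N} (\<lambda>a. {1..N div a}). g a * h b)"
  proof (rule sum.reindex_bij_witness[of _ "\<lambda>(a, b). (a * b, a)" "\<lambda>(n, d). (d, n div d)"])
    fix p assume p: "p \<in> Sigma {1..N} (\<lambda>n. {d. d dvd n})"
    obtain n d where nd: "p = (n, d)" by (cases p)
    have n: "1 \<le> n" "n \<le> N" "d dvd n" using p nd by auto
    then have d: "1 \<le> d" "d \<le> n" by (auto intro: dvd_imp_le Suc_leI dvd_pos_nat)
    moreover have "1 \<le> n div d" using n d by (simp add: Suc_le_eq div_greater_zero_iff)
    moreover have "n div d \<le> N div d" using n by (intro div_le_mono)
    ultimately show "(case p of (n, d) \<Rightarrow> (d, n div d)) \<in> Sigma {1..N} (\<lambda>a. {1..N div a})"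
      using nd n by auto
    show "(case (case p of (n, d) \<Rightarrow> (d, n div d)) of (a, b) \<Rightarrow> (a * b, a)) = p" using nd n by simp
    show "(case case p of (n, d) \<Rightarrow> (d, n div d) of (a, b) \<Rightarrow> g a * h b) = (case p of (n, d) \<Rightarrow> g d * h (n div d))"
      using nd by simp
  next
    fix p assume p: "p \<in> Sigma {1..N} (\<lambda>a. {1..N div a})"
    obtain a b where ab: "p = (a, b)" by (cases p)
    have a: "1 \<le> a" "a \<le> N" "1 \<le> b" "b \<le> N div a" using p ab by auto
    then have "a * b \<le> N" by (metis div_le_mono le_trans less_eq_div_iff_mult_less_eq mult.commute One_nat_def Suc_le_eq)
    then show "(case p of (a, b) \<Rightarrow> (a * b, a)) \<in> Sigma {1..N} (\<lambda>n. {d. d dvd n})"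
      using ab a by auto
    show "(case (case p of (a, b) \<Rightarrow> (a * b, a)) of (n, d) \<Rightarrow> (d, n div d)) = p" using ab a by simp
  qed
  finally show ?thesis .
qed

text \<open>Pairs with a b \<le> N are split at a = A. The rest have a \<ge> A + 1, hence b \<le> N
  div (A + 1), and are summed over a first.\<close>

lemma dirichlet_hyperbola:
  assumes "A \<le> N"
  shows "(\<Sum>n=1..N. dconv g h n) = (\<Sum>a=1..A. g a * (\<Sum>b=1..N div a. h b))
    + (\<Sum>b=1..N div (A + 1). h b * ((\<Sum>a=1..N div b. g a) - (\<Sum>a=1..A. g a)))"
proof -
  have S: "Sigma {1..N} (\<lambda>a. {1..N div a}) = Sigma {1..A} (\<lambda>a. {1..N div a}) \<union> Sigma {A<..N} (\<lambda>a. {1..N div a})"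
    using assms by auto
  have "(\<Sum>(a, b)\<in>Sigma {1..N} (\<lambda>a. {1..N div a}). g a * h b)
      = (\<Sum>(a, b)\<in>Sigma {1..A} (\<lambda>a. {1..N div a}). g a * h b) + (\<Sum>(a, b)\<in>Sigma {A<..N} (\<lambda>a. {1..N div a}). g a * h b)"
    unfolding S by (rule sum.union_disjoint) auto
  also have "(\<Sum>(a, b)\<in>Sigma {1..A} (\<lambda>a. {1..N div a}). g a * h b) = (\<Sum>a=1..A. g a * (\<Sum>b=1..N div a. h b))"
    by (simp add: sum_distrib_left sum.Sigma)
  also have "(\<Sum>(a, b)\<in>Sigma {A<..N} (\<lambda>a. {1..N div a}). g a * h b)
      = (\<Sum>(b, a)\<in>Sigma {1..N div (A + 1)} (\<lambda>b. {A<..N div b}). h b * g a)"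
  proof (rule sum.reindex_bij_witness[of _ "\<lambda>(b, a). (a, b)" "\<lambda>(a, b). (b, a)"])
    have div_iff: "b \<le> N div a \<longleftrightarrow> a * b \<le> N" if "a \<ge> 1" for a b
      using that by (simp add: less_eq_div_iff_mult_less_eq mult.commute)
    fix p assume p: "p \<in> Sigma {A<..N} (\<lambda>a. {1..N div a})"
    obtain a b where ab: "p = (a, b)" by (cases p)
    have a: "A < a" "a \<le> N" "1 \<le> b" "a * b \<le> N" using p ab div_iff[of a b] by auto
    have "(A + 1) * b \<le> a * b" using a by (intro mult_right_mono) auto
    then have "b \<le> N div (A + 1)" using a div_iff[of "A + 1" b] by linarith
    moreover have "a \<le> N div b" using a div_iff[of b a] by (simp add: mult.commute)
    ultimately show "(case p of (a, b) \<Rightarrow> (b, a)) \<in> Sigma {1..N div (A + 1)} (\<lambda>b. {A<..N div b})"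
      using ab a by auto
  next
    have div_iff: "b \<le> N div a \<longleftrightarrow> a * b \<le> N" if "a \<ge> 1" for a b
      using that by (simp add: less_eq_div_iff_mult_less_eq mult.commute)
    fix p assume p: "p \<in> Sigma {1..N div (A + 1)} (\<lambda>b. {A<..N div b})"
    obtain b a where ab: "p = (b, a)" by (cases p)
    have a: "A < a" "1 \<le> b" "b * a \<le> N" using p ab div_iff[of b a] by auto
    have "1 * a \<le> b * a" using a by (intro mult_right_mono) auto
    then have "a \<le> N" using a by linarith
    moreover have "b \<le> N div a" using a div_iff[of a b] by (simp add: mult.commute)
    ultimately show "(case p of (b, a) \<Rightarrow> (a, b)) \<in> Sigma {A<..N} (\<lambda>a. {1..N div a})"
      using ab a by auto
  qed auto
  also have "\<dots> = (\<Sum>b=1..N div (A + 1). h b * (\<Sum>a\<in>{A<..N div b}. g a))"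
    by (simp add: sum_distrib_left sum.Sigma)
  also have "\<dots> = (\<Sum>b=1..N div (A + 1). h b * ((\<Sum>a=1..N div b. g a) - (\<Sum>a=1..A. g a)))"
  proof (intro sum.cong refl)
    fix b assume "b \<in> {1..N div (A + 1)}"
    then have "b \<ge> 1" "(A + 1) * b \<le> N"
      by (auto simp: less_eq_div_iff_mult_less_eq mult.commute)
    then have "A + 1 \<le> N div b" by (simp add: less_eq_div_iff_mult_less_eq)
    then have "{1..N div b} = {1..A} \<union> {A<..N div b}" by auto
    then have "(\<Sum>a=1..N div b. g a) = (\<Sum>a=1..A. g a) + (\<Sum>a\<in>{A<..N div b}. g a)"
      by (simp only:) (rule sum.union_disjoint, auto)
    then show "h b * (\<Sum>a\<in>{A<..N div b}. g a) = h b * ((\<Sum>a=1..N div b. g a) - (\<Sum>a=1..A. g a))" by simp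
  qed
  finally show ?thesis unfolding sum_dconv_pairs .
qed

definition mult_fun :: "(nat \<Rightarrow> real) \<Rightarrow> bool" where
  "mult_fun g \<longleftrightarrow> g 1 = 1 \<and> (\<forall>a b. coprime a b \<longrightarrow> g (a * b) = g a * g b)"

lemma mult_fun_dconv:
  assumes g: "mult_fun g" and h: "mult_fun h"
  shows "dconv g h 1 = 1" "\<And>a b. coprime a b \<Longrightarrow> a > 0 \<Longrightarrow> b > 0 \<Longrightarrow> dconv g h (a * b) = dconv g h a * dconv g h b"
proof -
  show "dconv g h 1 = 1" using g h by (simp add: dconv_def mult_fun_def)
  fix a b :: nat assume cop: "coprime a b" and pos: "a > 0" "b > 0"
  let ?D = "\<lambda>n. {d::nat. d dvd n}"
  have fin: "finite (?D a)" "finite (?D b)" using pos by auto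
  have inj: "inj_on (\<lambda>(d, e). d * e) (?D a \<times> ?D b)"
  proof (rule inj_onI, clarify)
    fix d e d' e' assume *: "d dvd a" "e dvd b" "d' dvd a" "e' dvd b" "d * e = d' * e'"
    have c: "coprime d e'" "coprime d' e" using cop * by (meson coprime_divisors)+
    have "d dvd d'" using c(1) *(5) by (metis coprime_dvd_mult_left_iff dvd_triv_left)
    moreover have "d' dvd d" using c(2) *(5) by (metis coprime_dvd_mult_left_iff dvd_triv_left)
    ultimately have "d = d'" by (rule dvd_antisym)
    moreover have "d > 0" using *(1) pos by (auto intro: gr0I)
    ultimately show "d = d' \<and> e = e'" using *(5) by simp
  qed
  have im: "(\<lambda>(d, e). d * e) ` (?D a \<times> ?D b) = ?D (a * b)"
  proof (intro equalityI subsetI)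
    fix x assume "x \<in> ?D (a * b)"
    then obtain d e where "x = d * e" "d dvd a" "e dvd b" using division_decomp[of x a b] by auto
    then show "x \<in> (\<lambda>(d, e). d * e) ` (?D a \<times> ?D b)" by auto
  qed (auto intro: mult_dvd_mono)
  have "dconv g h (a * b) = (\<Sum>x\<in>(\<lambda>(d, e). d * e) ` (?D a \<times> ?D b). g x * h (a * b div x))"
    unfolding dconv_def im ..
  also have "\<dots> = (\<Sum>(d, e)\<in>?D a \<times> ?D b. g (d * e) * h (a * b div (d * e)))"
    by (subst sum.reindex[OF inj]) (simp add: case_prod_unfold)
  also have "\<dots> = (\<Sum>(d, e)\<in>?D a \<times> ?D b. (g d * h (a div d)) * (g e * h (b div e)))"
  proof (intro sum.cong refl, clarsimp)
    fix d e assume de: "d dvd a" "e dvd b"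
    have "a div d dvd a" "b div e dvd b" using de by (metis dvd_div_mult_self dvd_triv_left)+
    then have c: "coprime d e" "coprime (a div d) (b div e)"
      using coprime_divisors[OF de cop] coprime_divisors[OF _ _ cop] by blast+
    have "a * b div (d * e) = (a div d) * (b div e)" using de by (simp add: div_mult_div_if_dvd)
    then show "g (d * e) * h (a * b div (d * e)) = (g d * h (a div d)) * (g e * h (b div e))"
      using c g h by (simp add: mult_fun_def)
  qed
  also have "\<dots> = dconv g h a * dconv g h b"
    unfolding dconv_def sum_product sum.cartesian_product ..
  finally show "dconv g h (a * b) = dconv g h a * dconv g h b" .
qed

lemma dconv_prime_power:
  assumes "prime p"
  shows "dconv g h (p ^ k) = (\<Sum>i\<le>k. g (p ^ i) * h (p ^ (k - i)))"
proof -
  have p: "p > 1" using assms prime_gt_1_nat by blast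
  have "{d. d dvd p ^ k} = (\<lambda>i. p ^ i) ` {..k}"
    using assms by (auto simp: divides_primepow_nat)
  moreover have "inj_on (\<lambda>i. p ^ i) {..k}" using p by (auto simp: inj_on_def)
  ultimately have "dconv g h (p ^ k) = (\<Sum>i\<le>k. g (p ^ i) * h (p ^ k div p ^ i))"
    unfolding dconv_def by (simp add: sum.reindex)
  also have "\<dots> = (\<Sum>i\<le>k. g (p ^ i) * h (p ^ (k - i)))"
    using p by (intro sum.cong refl) (simp add: power_diff)
  finally show ?thesis .
qed

lemma prime_power_induct [consumes 1, case_names one mult]:
  fixes n :: nat
  assumes "n > 0" and "P 1"
    and "\<And>p k u. prime p \<Longrightarrow> k > 0 \<Longrightarrow> u > 0 \<Longrightarrow> coprime (p ^ k) u \<Longrightarrow> P u \<Longrightarrow> P (p ^ k * u)"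
  shows "P n"
  using assms(1)
proof (induction n rule: less_induct)
  case (less n)
  show ?case
  proof (cases "n = 1")
    case False
    then obtain p where p: "prime p" "p dvd n" using prime_factor_nat by blast
    obtain u where u: "n = p ^ multiplicity p n * u" "\<not> p dvd u"
      using multiplicity_decompose'[of n p] less.prems p by (metis not_prime_unit not_gr_zero)
    have k: "multiplicity p n > 0" using p less.prems by (simp add: prime_multiplicity_gt_zero_iff)
    have "u > 0" using u less.prems by (intro gr0I) auto
    have "p ^ multiplicity p n > 1" by (rule one_less_power[OF prime_gt_1_nat[OF p(1)] k])
    then have "u < n" using \<open>u > 0\<close> by (subst u(1)) simp
    have "coprime (p ^ multiplicity p n) u"
      using u(2) p(1) by (simp add: prime_imp_coprime)
    then have "P (p ^ multiplicity p n * u)"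
      using assms(3) p(1) k \<open>u > 0\<close> less.IH[OF \<open>u < n\<close> \<open>u > 0\<close>] by blast
    then show ?thesis using u(1) by simp
  qed (use assms(2) in simp)
qed

section \<open>Divisor sums of a character with few primes of value 1\<close>

definition divisor_sum :: "(nat \<Rightarrow> real) \<Rightarrow> nat \<Rightarrow> real" where
  "divisor_sum \<chi> = dconv \<chi> (\<lambda>_. 1)"

text \<open>Keeps the multiplicative side of a real character and forgets the period, so that
  results about several characters need only bounds for their partial sums in addition.\<close>

definition cmult_fun :: "(nat \<Rightarrow> real) \<Rightarrow> bool" where
  "cmult_fun \<chi> \<longleftrightarrow> \<chi> 1 = 1 \<and> (\<forall>a b. \<chi> (a * b) = \<chi> a * \<chi> b) \<and> (\<forall>a. \<chi> a \<in> {-1, 0, 1})"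

lemma cmult_funD:
  assumes "cmult_fun \<chi>"
  shows "\<chi> 1 = 1" "\<chi> (a * b) = \<chi> a * \<chi> b" "\<chi> a \<in> {-1, 0, 1}" "\<bar>\<chi> a\<bar> \<le> 1" "\<chi> (a ^ k) = \<chi> a ^ k" "mult_fun \<chi>"
proof -
  show 1: "\<chi> 1 = 1" "\<chi> (a * b) = \<chi> a * \<chi> b" "\<chi> a \<in> {-1, 0, 1}" for a b
    using assms by (auto simp: cmult_fun_def)
  show "\<bar>\<chi> a\<bar> \<le> 1" using 1(3)[of a] by auto
  show "\<chi> (a ^ k) = \<chi> a ^ k" using 1(1) by (induction k) (simp_all add: 1(2))
  show "mult_fun \<chi>" using assms by (simp add: cmult_fun_def mult_fun_def)
qed

lemma cmult_fun_real_char: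
  assumes "real_char m f"
  shows "cmult_fun (\<lambda>n. f (int n))"
  using real_charD[OF assms] by (simp add: cmult_fun_def)

lemma mult_fun_one: "mult_fun (\<lambda>_. 1)"
  by (simp add: mult_fun_def)

lemma sum_alternating: "(\<Sum>i\<le>k. (- 1 :: real) ^ i) = (if even k then 1 else 0)"
  by (induction k) auto

lemma divisor_sum_mult:
  assumes "cmult_fun \<chi>"
  shows "divisor_sum \<chi> 1 = 1"
    "\<And>a b. coprime a b \<Longrightarrow> a > 0 \<Longrightarrow> b > 0 \<Longrightarrow> divisor_sum \<chi> (a * b) = divisor_sum \<chi> a * divisor_sum \<chi> b"
    "prime p \<Longrightarrow> divisor_sum \<chi> (p ^ k) = (if \<chi> p = 1 then real k + 1 else if \<chi> p = 0 then 1 else if even k then 1 else 0)"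
proof -
  note C = cmult_funD[OF assms]
  note M = mult_fun_dconv[OF C(6) mult_fun_one]
  show "divisor_sum \<chi> 1 = 1" using M(1) by (simp add: divisor_sum_def)
  show "coprime a b \<Longrightarrow> a > 0 \<Longrightarrow> b > 0 \<Longrightarrow> divisor_sum \<chi> (a * b) = divisor_sum \<chi> a * divisor_sum \<chi> b" for a b
    using M(2) by (simp add: divisor_sum_def)
  show "divisor_sum \<chi> (p ^ k) = (if \<chi> p = 1 then real k + 1 else if \<chi> p = 0 then 1 else if even k then 1 else 0)"
    if "prime p"
  proof -
    have "divisor_sum \<chi> (p ^ k) = (\<Sum>i\<le>k. \<chi> p ^ i)"
      unfolding divisor_sum_def dconv_prime_power[OF that] by (simp add: C(5))
    moreover have "(\<Sum>i\<le>k. (0::real) ^ i) = 1" by (simp add: sum.atMost_shift)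
    ultimately show ?thesis using C(3)[of p] sum_alternating[of k] by auto
  qed
qed

lemma divisor_sum_nonneg:
  assumes "cmult_fun \<chi>" "n > 0"
  shows "divisor_sum \<chi> n \<ge> 0"
  using assms(2)
proof (induction n rule: prime_power_induct)
  case one
  then show ?case using divisor_sum_mult(1)[OF assms(1)] by simp
next
  case (mult p k u)
  then show ?case using divisor_sum_mult(2,3)[OF assms(1)] prime_gt_0_nat[of p] by simp
qed

text \<open>A prime power contributes 1 if the character vanishes at the prime; if the value is -1
  it contributes 1 or 0 according to the parity of the exponent. So no local factor exceeds 1, and
  odd exponents survive only at primes of value 0.\<close>

lemma divisor_sum_inert:
  assumes "cmult_fun \<chi>" "n > 0" "\<And>p. prime p \<Longrightarrow> p dvd n \<Longrightarrow> \<chi> p \<noteq> 1"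
  shows "divisor_sum \<chi> n \<le> 1 \<and>
    (divisor_sum \<chi> n \<noteq> 0 \<longrightarrow> (\<exists>s e. n = s\<^sup>2 * e \<and> (\<forall>q. prime q \<longrightarrow> q dvd e \<longrightarrow> \<chi> q = 0)))"
  using assms(2,3)
proof (induction n rule: prime_power_induct)
  case one
  then show ?case using divisor_sum_mult(1)[OF assms(1)] by (auto intro!: exI[of _ 1])
next
  case (mult p k u)
  note D = divisor_sum_mult[OF assms(1)]
  have "\<chi> q \<noteq> 1" if "prime q" "q dvd u" for q using mult.prems that by simp
  then have IH: "divisor_sum \<chi> u \<le> 1"
    "divisor_sum \<chi> u \<noteq> 0 \<Longrightarrow> (\<exists>s e. u = s\<^sup>2 * e \<and> (\<forall>q. prime q \<longrightarrow> q dvd e \<longrightarrow> \<chi> q = 0))"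
    using mult.IH by auto
  have u0: "divisor_sum \<chi> u \<ge> 0" using divisor_sum_nonneg[OF assms(1)] mult by simp
  have p1: "\<chi> p \<noteq> 1" using mult.prems[of p] mult.hyps by (simp add: dvd_power)
  have eq: "divisor_sum \<chi> (p ^ k * u) = (if \<chi> p = 0 \<or> even k then divisor_sum \<chi> u else 0)"
    using D(2,3) mult.hyps p1 prime_gt_0_nat[of p] by simp
  show ?case
  proof (intro conjI impI)
    show "divisor_sum \<chi> (p ^ k * u) \<le> 1" using eq IH(1) by simp
    assume "divisor_sum \<chi> (p ^ k * u) \<noteq> 0"
    then have c: "\<chi> p = 0 \<or> even k" and "divisor_sum \<chi> u \<noteq> 0" by (auto simp: eq split: if_splits)
    then obtain s e where se: "u = s\<^sup>2 * e" "\<forall>q. prime q \<longrightarrow> q dvd e \<longrightarrow> \<chi> q = 0" using IH(2) by blast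
    show "\<exists>s e. p ^ k * u = s\<^sup>2 * e \<and> (\<forall>q. prime q \<longrightarrow> q dvd e \<longrightarrow> \<chi> q = 0)"
    proof (cases "even k")
      case True
      then obtain l where "k = 2 * l" by blast
      then have "p ^ k * u = (p ^ l * s)\<^sup>2 * e" by (simp add: se power_mult_distrib power_mult[symmetric] mult.commute[of l])
      then show ?thesis using se by blast
    next
      case False
      then have p0: "\<chi> p = 0" using c by blast
      have "p ^ k * u = s\<^sup>2 * (p ^ k * e)" by (simp add: se)
      moreover have "\<chi> q = 0" if "prime q" "q dvd p ^ k * e" for q
        using that mult.hyps p0 se(2) by (metis prime_dvd_mult_iff prime_dvd_power primes_dvd_imp_eq)
      ultimately show ?thesis by blast
    qed
  qed
qed

lemma sum_inverse_squares_le: "(\<Sum>s=1..n. 1 / (real s)\<^sup>2) \<le> 2"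
proof -
  have "(\<Sum>s=1..Suc n. 1 / (real s)\<^sup>2) \<le> 2 - 1 / real (Suc n)" for n
  proof (induction n)
    case (Suc n)
    have "1 / (real (Suc (Suc n)))\<^sup>2 \<le> 1 / (real (Suc n) * real (Suc (Suc n)))"
      by (intro divide_left_mono) (auto simp: power2_eq_square)
    also have "\<dots> = 1 / real (Suc n) - 1 / real (Suc (Suc n))" by (simp add: field_simps)
    finally show ?case using Suc by simp
  qed simp
  from this[of "n - 1"] show ?thesis
    by (cases n) (auto intro: order.trans)
qed

text \<open>\<open>E\<close> plays the role of the set of prime divisors of the modulus and
  \<open>K\<close> that of the lower bound m^(3/8) for them; Y < K^2 prevents two of them, counted
  with multiplicity, from dividing a number up to Y.\<close>

locale exceptional =
  fixes \<chi> :: "nat \<Rightarrow> real" and Y :: nat and K :: real and E :: "nat set"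
  assumes \<chi>: "cmult_fun \<chi>"
    and inert: "\<And>p. prime p \<Longrightarrow> p \<le> Y \<Longrightarrow> \<chi> p \<noteq> 1"
    and ramified: "\<And>p. prime p \<Longrightarrow> \<chi> p = 0 \<Longrightarrow> p \<in> E"
    and E: "finite E" "card E \<le> 2" "\<And>p. p \<in> E \<Longrightarrow> real p \<ge> K" "K > 1" "real Y < K\<^sup>2"
begin

text \<open>The part \<open>e\<close> composed of primes where the character vanishes has at most
  one prime factor, since two would already give e \<ge> K^2 > Y.\<close>

lemma representation:
  assumes "1 \<le> n" "n \<le> Y" "divisor_sum \<chi> n \<noteq> 0"
  shows "\<exists>s e. n = s\<^sup>2 * e \<and> e \<in> insert 1 E"
proof -
  have "\<chi> p \<noteq> 1" if "prime p" "p dvd n" for p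
    using inert[OF that(1)] dvd_imp_le[OF that(2)] assms by simp
  then obtain s e where se: "n = s\<^sup>2 * e" "\<And>q. prime q \<Longrightarrow> q dvd e \<Longrightarrow> \<chi> q = 0"
    using divisor_sum_inert[OF \<chi>, of n] assms by auto
  have n0: "e > 0" "s > 0" using se(1) assms(1) by (auto intro: gr0I)
  have "e \<in> insert 1 E"
  proof (cases "e = 1")
    case False
    then obtain q where q: "prime q" "q dvd e" using prime_factor_nat by blast
    then obtain e' where e': "e = q * e'" by blast
    have qE: "q \<in> E" using ramified q se(2) by blast
    have "e' = 1"
    proof (rule ccontr)
      assume "e' \<noteq> 1"
      then obtain q' where q': "prime q'" "q' dvd e'" using prime_factor_nat by blast
      have "q' \<in> E" using ramified q' se(2) e' by simp
      then have "K\<^sup>2 \<le> real q * real q'" using E(3)[OF qE] E(3)[of q'] E(4) unfolding power2_eq_square by (intro mult_mono) auto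
      also have "\<dots> \<le> real q * real e'"
        using dvd_imp_le[OF q'(2)] n0 e' by (intro mult_left_mono) auto
      also have "\<dots> = real e" using e' by simp
      also have "\<dots> \<le> real n" using se(1) n0 by (simp add: Suc_leI)
      also have "\<dots> \<le> real Y" using assms by simp
      finally show False using E(5) by simp
    qed
    then show ?thesis using e' qE by simp
  qed simp
  then show ?thesis using se(1) by blast
qed

text \<open>Each contributing n has coefficient at most 1 and at least one representation; counting
  some n several times is harmless because the weights are nonnegative.\<close>

lemma sum_le_representations:
  assumes "N \<le> Y" "\<And>n. w n \<ge> 0" and T: "\<And>s e. s\<^sup>2 * e \<in> {1..N} \<Longrightarrow> s \<in> T" "finite T"
  shows "(\<Sum>n=1..N. divisor_sum \<chi> n * w n) \<le> (\<Sum>(e, s)\<in>insert 1 E \<times> T. w (s\<^sup>2 * e))"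
proof -
  let ?R = "{n \<in> {1..N}. divisor_sum \<chi> n \<noteq> 0}"
  have r1: "divisor_sum \<chi> n \<le> 1" if "n \<in> ?R" for n
  proof -
    have "\<chi> p \<noteq> 1" if "prime p" "p dvd n" for p
      using inert[OF that(1)] dvd_imp_le[OF that(2)] assms(1) \<open>n \<in> ?R\<close> by simp
    then show ?thesis using divisor_sum_inert[OF \<chi>, of n] that by auto
  qed
  have "(\<Sum>n=1..N. divisor_sum \<chi> n * w n) = (\<Sum>n\<in>?R. divisor_sum \<chi> n * w n)"
    by (rule sum.mono_neutral_right) auto
  also have "\<dots> \<le> (\<Sum>n\<in>?R. w n)"
  proof (rule sum_mono)
    fix n assume "n \<in> ?R"
    from mult_right_mono[OF r1[OF this] assms(2)] show "divisor_sum \<chi> n * w n \<le> w n" by simp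
  qed
  also have "\<dots> \<le> (\<Sum>(e, s)\<in>insert 1 E \<times> T. w (s\<^sup>2 * e))"
  proof (rule sum_le_included[where i = "\<lambda>(e, s). s\<^sup>2 * e"])
    show "\<forall>n\<in>?R. \<exists>p\<in>insert 1 E \<times> T. (case p of (e, s) \<Rightarrow> s\<^sup>2 * e) = n \<and> w n \<le> (case p of (e, s) \<Rightarrow> w (s\<^sup>2 * e))"
    proof
      fix n assume n: "n \<in> ?R"
      then obtain s e where "n = s\<^sup>2 * e" "e \<in> insert 1 E" using representation[of n] assms(1) by auto
      moreover have "s \<in> T" using T(1)[of s e] n calculation by simp
      ultimately show "\<exists>p\<in>insert 1 E \<times> T. (case p of (e, s) \<Rightarrow> s\<^sup>2 * e) = n \<and> w n \<le> (case p of (e, s) \<Rightarrow> w (s\<^sup>2 * e))"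
        by (intro bexI[of _ "(e, s)"]) auto
    qed
  qed (use assms(2) E(1) T(2) in auto)
  finally show ?thesis .
qed

lemma sum_divisor_sum_le:
  assumes "N \<le> Y"
  shows "(\<Sum>n=1..N. divisor_sum \<chi> n) \<le> 3 * sqrt (real N)"
proof -
  let ?T = "{1..nat \<lfloor>sqrt (real N)\<rfloor>}"
  have "(\<Sum>n=1..N. divisor_sum \<chi> n * 1) \<le> (\<Sum>(e, s)\<in>insert 1 E \<times> ?T. 1)"
  proof (rule sum_le_representations[OF assms])
    fix s e assume *: "s\<^sup>2 * e \<in> {1..N}"
    then have "s > 0" "e > 0" by (auto intro: gr0I)
    have "s\<^sup>2 \<le> s\<^sup>2 * e" using \<open>e > 0\<close> by simp
    then have "s\<^sup>2 \<le> N" using * by (meson atLeastAtMost_iff le_trans)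
    then have "(real s)\<^sup>2 \<le> real N" by (metis of_nat_le_iff of_nat_power)
    then have "real s \<le> sqrt (real N)" by (rule real_le_rsqrt)
    then show "s \<in> ?T" using \<open>s > 0\<close> by (auto simp: le_nat_floor Suc_le_eq)
  qed auto
  also have "\<dots> = real (card (insert 1 E)) * real (nat \<lfloor>sqrt (real N)\<rfloor>)"
    by (simp add: case_prod_unfold card_cartesian_product del: insert_Times_insert)
  also have "\<dots> \<le> 3 * sqrt (real N)"
  proof (intro mult_mono)
    have "card (insert 1 E) \<le> 3" using E(2) card_insert_le_m1[of 3 E 1] by simp
    then show "real (card (insert 1 E)) \<le> 3" by simp
    show "real (nat \<lfloor>sqrt (real N)\<rfloor>) \<le> sqrt (real N)" by simp
  qed auto
  finally show ?thesis by simp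
qed

lemma sum_divisor_sum_over_le:
  assumes "N \<le> Y"
  shows "(\<Sum>n=1..N. divisor_sum \<chi> n / real n) \<le> 2 + 4 / K"
proof -
  have "(\<Sum>n=1..N. divisor_sum \<chi> n * (1 / real n)) \<le> (\<Sum>(e, s)\<in>insert 1 E \<times> {1..N}. 1 / real (s\<^sup>2 * e))"
  proof (rule sum_le_representations[OF assms])
    fix s e :: nat assume *: "s\<^sup>2 * e \<in> {1..N}"
    then have "s > 0" "e > 0" by (auto intro: gr0I)
    have "s = s * 1" by simp
    also have "\<dots> \<le> s * (s * e)" using \<open>s > 0\<close> \<open>e > 0\<close> by (intro mult_left_mono) (auto simp: Suc_le_eq)
    also have "\<dots> = s\<^sup>2 * e" by (simp add: power2_eq_square mult.assoc)
    finally have "s \<le> N" using * by simp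
    then show "s \<in> {1..N}" using \<open>s > 0\<close> by simp
  qed auto
  also have "\<dots> = (\<Sum>e\<in>insert 1 E. 1 / real e) * (\<Sum>s=1..N. 1 / (real s)\<^sup>2)"
    unfolding sum_product sum.cartesian_product
    by (rule sum.cong[OF refl], unfold case_prod_unfold, simp)
  also have "\<dots> \<le> (1 + 2 / K) * 2"
  proof (intro mult_mono sum_inverse_squares_le)
    have "(\<Sum>e\<in>insert 1 E. 1 / real e) \<le> 1 + (\<Sum>e\<in>E. 1 / real e)"
      unfolding sum.insert_if[OF E(1)] by simp
    also have "(\<Sum>e\<in>E. 1 / real e) \<le> (\<Sum>e\<in>E. 1 / K)"
    proof (rule sum_mono)
      fix e assume "e \<in> E"
      then show "1 / real e \<le> 1 / K" using E(3)[of e] E(4) by (simp add: frac_le)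
    qed
    also have "\<dots> \<le> 2 / K" using E(2,4) by (simp add: divide_right_mono)
    finally show "(\<Sum>e\<in>insert 1 E. 1 / real e) \<le> 1 + 2 / K" by simp
  qed (use E(4) in \<open>auto intro!: sum_nonneg\<close>)
  finally show ?thesis by (simp add: algebra_simps)
qed

end

section \<open>Partial summation against powers\<close>

lemma abel_summation:
  fixes u w :: "nat \<Rightarrow> real"
  assumes "Y \<le> N"
  shows "(\<Sum>n=Suc Y..N. u n * w n) = (\<Sum>k=1..N. u k) * w (Suc N) - (\<Sum>k=1..Y. u k) * w (Suc Y)
    + (\<Sum>n=Suc Y..N. (\<Sum>k=1..n. u k) * (w n - w (Suc n)))"
  using assms
proof (induction N rule: dec_induct)
  case (step N)
  then show ?case by (simp add: algebra_simps)
qed simp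

lemma sum_tail_split:
  fixes g :: "nat \<Rightarrow> real"
  assumes "Y \<le> N"
  shows "(\<Sum>n=1..N. g n) = (\<Sum>n=1..Y. g n) + (\<Sum>n=Suc Y..N. g n)"
  using assms
proof (induction N rule: dec_induct)
  case (step N)
  then show ?case by simp
qed simp

lemma sum_telescope_decreasing:
  fixes w :: "nat \<Rightarrow> real"
  assumes "Y \<le> N"
  shows "(\<Sum>n=Suc Y..N. w n - w (Suc n)) = w (Suc Y) - w (Suc N)"
  using assms
proof (induction N rule: dec_induct)
  case (step N)
  then show ?case by simp
qed simp

lemma abel_bounded:
  fixes u w :: "nat \<Rightarrow> real"
  assumes "Y \<le> N" and K: "\<And>n. \<bar>\<Sum>k=1..n. u k\<bar> \<le> K"
    and w: "\<And>n. n \<ge> 1 \<Longrightarrow> w n \<ge> 0" "\<And>n. n \<ge> 1 \<Longrightarrow> w (Suc n) \<le> w n"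
  shows "\<bar>\<Sum>n=Suc Y..N. u n * w n\<bar> \<le> 2 * K * w (Suc Y)"
proof -
  let ?U = "\<lambda>n. \<Sum>k=1..n. u k"
  have "\<bar>\<Sum>n=Suc Y..N. ?U n * (w n - w (Suc n))\<bar> \<le> (\<Sum>n=Suc Y..N. K * (w n - w (Suc n)))"
    by (rule order.trans[OF sum_abs], rule sum_mono) (use K w in \<open>auto simp: abs_mult intro!: mult_right_mono\<close>)
  also have "\<dots> = K * (w (Suc Y) - w (Suc N))"
    unfolding sum_distrib_left[symmetric] sum_telescope_decreasing[OF assms(1)] ..
  finally have 1: "\<bar>\<Sum>n=Suc Y..N. ?U n * (w n - w (Suc n))\<bar> \<le> K * (w (Suc Y) - w (Suc N))" .
  have 2: "\<bar>?U N * w (Suc N)\<bar> \<le> K * w (Suc N)" "\<bar>?U Y * w (Suc Y)\<bar> \<le> K * w (Suc Y)"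
    using K w(1) by (auto simp: abs_mult intro!: mult_right_mono)
  have aux: "\<bar>x - y + z\<bar> \<le> 2 * q" if "\<bar>z\<bar> \<le> q - p" "\<bar>x\<bar> \<le> p" "\<bar>y\<bar> \<le> q" for x y z p q :: real
    using that by linarith
  have "\<bar>?U N * w (Suc N) - ?U Y * w (Suc Y) + (\<Sum>n=Suc Y..N. ?U n * (w n - w (Suc n)))\<bar> \<le> 2 * (K * w (Suc Y))"
    by (rule aux[OF _ 2]) (rule 1[unfolded right_diff_distrib[of K "w (Suc Y)" "w (Suc N)"]])
  then show ?thesis by (subst abel_summation[OF assms(1)]) (simp only: mult.assoc)
qed

lemma powr_diff_mvt:
  fixes c x :: real
  assumes "x > 0"
  obtains z where "x < z" "z < x + 1" "(x + 1) powr c - x powr c = c * z powr (c - 1)"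
proof -
  have "\<exists>z>x. z < x + 1 \<and> (x + 1) powr c - x powr c = (x + 1 - x) * (c * z powr (c - 1))"
    by (rule MVT2) (use assms in \<open>auto intro!: derivative_eq_intros\<close>)
  then show ?thesis using that by auto
qed

lemma powr_decrease_le:
  fixes x \<eta> :: real
  assumes "\<eta> \<ge> 0" "\<eta> \<le> 1" "x > 0"
  shows "x powr (\<eta> - 1) - (x + 1) powr (\<eta> - 1) \<le> x powr (\<eta> - 2)"
proof -
  obtain z where z: "x < z" "(x + 1) powr (\<eta> - 1) - x powr (\<eta> - 1) = (\<eta> - 1) * z powr (\<eta> - 1 - 1)"
    using powr_diff_mvt[OF assms(3), of "\<eta> - 1"] by blast
  have "x powr (\<eta> - 1) - (x + 1) powr (\<eta> - 1) = (1 - \<eta>) * z powr (\<eta> - 2)" using z(2) by (simp add: algebra_simps)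
  also have "\<dots> \<le> 1 * x powr (\<eta> - 2)"
    using assms z by (intro mult_mono powr_mono2') auto
  finally show ?thesis by simp
qed

lemma sum_powr_tail:
  assumes s: "s > 0" and Y: "1 \<le> Y" "Y \<le> N"
  shows "(\<Sum>n=Suc Y..N. real n powr (- s - 1)) \<le> (real Y powr (- s) - real N powr (- s)) / s"
  using Y(2)
proof (induction N rule: dec_induct)
  case (step N)
  obtain z where z: "real N < z" "z < real N + 1" "(real N + 1) powr (- s) - real N powr (- s) = (- s) * z powr (- s - 1)"
    using powr_diff_mvt[of "real N" "- s"] step Y by auto
  have "real (Suc N) powr (- s - 1) \<le> z powr (- s - 1)"
    using z s step Y by (intro powr_mono2') auto
  also have "\<dots> = (real N powr (- s) - real (Suc N) powr (- s)) / s"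
    using z(3) s by (simp add: field_simps)
  finally show ?case using step s by (simp add: field_simps)
qed simp

lemma sum_powr_integral:
  assumes \<eta>: "0 < \<eta>" "\<eta> \<le> 1" and Y: "1 \<le> Y" "Y \<le> N"
  shows "(\<Sum>n=Suc Y..N. real n powr (\<eta> - 1)) \<le> (real N powr \<eta> - real Y powr \<eta>) / \<eta>"
    "(real N powr \<eta> - real Y powr \<eta>) / \<eta> \<le> (\<Sum>n=Suc Y..N. real n powr (\<eta> - 1)) + (real Y powr (\<eta> - 1) - real N powr (\<eta> - 1))"
proof -
  have step: "real (Suc n) powr (\<eta> - 1) \<le> (real (Suc n) powr \<eta> - real n powr \<eta>) / \<eta>"
    "(real (Suc n) powr \<eta> - real n powr \<eta>) / \<eta> \<le> real n powr (\<eta> - 1)" if "n \<ge> 1" for n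
  proof -
    obtain z where z: "real n < z" "z < real n + 1" "(real n + 1) powr \<eta> - real n powr \<eta> = \<eta> * z powr (\<eta> - 1)"
      using powr_diff_mvt[of "real n" \<eta>] \<open>n \<ge> 1\<close> by auto
    have e: "(real (Suc n) powr \<eta> - real n powr \<eta>) / \<eta> = z powr (\<eta> - 1)"
      using z(3) \<eta> by (simp add: field_simps)
    show "real (Suc n) powr (\<eta> - 1) \<le> (real (Suc n) powr \<eta> - real n powr \<eta>) / \<eta>"
      unfolding e using z \<eta> that by (intro powr_mono2') auto
    show "(real (Suc n) powr \<eta> - real n powr \<eta>) / \<eta> \<le> real n powr (\<eta> - 1)"
      unfolding e using z \<eta> that by (intro powr_mono2') auto
  qed
  show "(\<Sum>n=Suc Y..N. real n powr (\<eta> - 1)) \<le> (real N powr \<eta> - real Y powr \<eta>) / \<eta>"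
    using Y(2)
  proof (induction N rule: dec_induct)
    case (step N)
    then show ?case using \<open>\<And>n. n \<ge> 1 \<Longrightarrow> real (Suc n) powr (\<eta> - 1) \<le> _\<close>[of N] Y by (simp add: diff_divide_distrib)
  qed simp
  show "(real N powr \<eta> - real Y powr \<eta>) / \<eta> \<le> (\<Sum>n=Suc Y..N. real n powr (\<eta> - 1)) + (real Y powr (\<eta> - 1) - real N powr (\<eta> - 1))"
    using Y(2)
  proof (induction N rule: dec_induct)
    case (step N)
    then show ?case using \<open>\<And>n. n \<ge> 1 \<Longrightarrow> _ \<le> real n powr (\<eta> - 1)\<close>[of N] Y by (simp add: diff_divide_distrib)
  qed simp
qed

text \<open>The constant 5 is 1 for each of the two boundary terms and 3 for the sum of n^(\<eta> -
  3/2), which is at most Y^(\<eta> - 1/2) / (1/2 - \<eta>).\<close>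

lemma abel_sqrt:
  fixes u :: "nat \<Rightarrow> real"
  assumes \<eta>: "0 \<le> \<eta>" "\<eta> \<le> 1 / 100" and Y: "1 \<le> Y" "Y \<le> N" and \<kappa>: "\<kappa> \<ge> 0"
    and U: "\<And>n. Y \<le> n \<Longrightarrow> n \<le> N \<Longrightarrow> \<bar>\<Sum>k=1..n. u k\<bar> \<le> \<kappa> * sqrt (real n)"
  shows "\<bar>\<Sum>n=Suc Y..N. u n * real n powr (\<eta> - 1)\<bar> \<le> 5 * \<kappa> * real Y powr (\<eta> - 1 / 2)"
proof -
  let ?U = "\<lambda>n. \<Sum>k=1..n. u k" and ?w = "\<lambda>n. real n powr (\<eta> - 1)"
  have sw: "sqrt (real n) * ?w (Suc n) \<le> real n powr (\<eta> - 1 / 2)" if "n \<ge> 1" for n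
  proof -
    have "?w (Suc n) \<le> ?w n" using \<eta> that by (intro powr_mono2') auto
    then have "sqrt (real n) * ?w (Suc n) \<le> real n powr (1 / 2) * ?w n"
      by (simp add: powr_half_sqrt mult_left_mono)
    also have "\<dots> = real n powr (\<eta> - 1 / 2)" by (simp flip: powr_add)
    finally show ?thesis .
  qed
  have "\<bar>\<Sum>n=Suc Y..N. ?U n * (?w n - ?w (Suc n))\<bar> \<le> (\<Sum>n=Suc Y..N. \<kappa> * real n powr (- (1 / 2 - \<eta>) - 1))"
  proof (rule order.trans[OF sum_abs], rule sum_mono)
    fix n assume n: "n \<in> {Suc Y..N}"
    have d: "?w n - ?w (Suc n) \<le> real n powr (\<eta> - 2)" "?w n - ?w (Suc n) \<ge> 0"
      using powr_decrease_le[of \<eta> "real n"] \<eta> n by (auto simp: add.commute intro!: powr_mono2')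
    have "\<bar>?U n * (?w n - ?w (Suc n))\<bar> \<le> (\<kappa> * sqrt (real n)) * real n powr (\<eta> - 2)"
      unfolding abs_mult using U[of n] n d \<kappa> by (intro mult_mono) auto
    also have "\<dots> = \<kappa> * (real n powr (1 / 2) * real n powr (\<eta> - 2))" using n by (simp add: powr_half_sqrt)
    also have "\<dots> = \<kappa> * real n powr (- (1 / 2 - \<eta>) - 1)" by (simp add: algebra_simps flip: powr_add)
    finally show "\<bar>?U n * (?w n - ?w (Suc n))\<bar> \<le> \<kappa> * real n powr (- (1 / 2 - \<eta>) - 1)" .
  qed
  also have "\<dots> \<le> \<kappa> * (3 * real Y powr (\<eta> - 1 / 2))"
  proof -
    have "(\<Sum>n=Suc Y..N. real n powr (- (1 / 2 - \<eta>) - 1)) \<le> (real Y powr (- (1 / 2 - \<eta>)) - real N powr (- (1 / 2 - \<eta>))) / (1 / 2 - \<eta>)"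
      by (rule sum_powr_tail) (use \<eta> Y in auto)
    also have "\<dots> \<le> real Y powr (- (1 / 2 - \<eta>)) / (1 / 2 - \<eta>)"
      using \<eta> by (intro divide_right_mono) auto
    also have "\<dots> \<le> real Y powr (- (1 / 2 - \<eta>)) / (1 / 3)"
      using \<eta> Y by (intro divide_left_mono) auto
    also have "\<dots> = 3 * real Y powr (\<eta> - 1 / 2)" by simp
    finally show ?thesis unfolding sum_distrib_left[symmetric] using \<kappa> by (rule mult_left_mono)
  qed
  finally have 1: "\<bar>\<Sum>n=Suc Y..N. ?U n * (?w n - ?w (Suc n))\<bar> \<le> 3 * \<kappa> * real Y powr (\<eta> - 1 / 2)" by simp
  have "\<bar>?U N * ?w (Suc N)\<bar> \<le> \<kappa> * (sqrt (real N) * ?w (Suc N))"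
    using U[of N] Y by (simp add: abs_mult mult_right_mono mult.assoc[symmetric])
  also have "\<dots> \<le> \<kappa> * real N powr (\<eta> - 1 / 2)" using sw[of N] Y \<kappa> by (intro mult_left_mono) auto
  also have "\<dots> \<le> \<kappa> * real Y powr (\<eta> - 1 / 2)" using Y \<eta> \<kappa> by (intro mult_left_mono powr_mono2') auto
  finally have 2: "\<bar>?U N * ?w (Suc N)\<bar> \<le> \<kappa> * real Y powr (\<eta> - 1 / 2)" .
  have "\<bar>?U Y * ?w (Suc Y)\<bar> \<le> \<kappa> * (sqrt (real Y) * ?w (Suc Y))"
    using U[of Y] Y by (simp add: abs_mult mult_right_mono mult.assoc[symmetric])
  also have "\<dots> \<le> \<kappa> * real Y powr (\<eta> - 1 / 2)" using sw[of Y] Y \<kappa> by (intro mult_left_mono) auto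
  finally have 3: "\<bar>?U Y * ?w (Suc Y)\<bar> \<le> \<kappa> * real Y powr (\<eta> - 1 / 2)" .
  have "\<bar>x - y + z\<bar> \<le> 5 * q" if "\<bar>z\<bar> \<le> 3 * q" "\<bar>x\<bar> \<le> q" "\<bar>y\<bar> \<le> q" for x y z q :: real
    using that by linarith
  from this[OF _ 2 3] 1 show ?thesis by (subst abel_summation[OF Y(2)]) (simp only: mult.assoc)
qed

text \<open>Partial summation is applied to r(n) - l, whose partial sums are of order sqrt n; the
  remaining smooth sum of l n^(\<eta> - 1) is compared with an integral.\<close>

lemma weighted_divisor_sum_increment:
  fixes r :: "nat \<Rightarrow> real"
  assumes \<eta>: "0 < \<eta>" "\<eta> \<le> 1 / 100" and Y: "1 \<le> Y" "Y \<le> N" and \<kappa>: "\<kappa> \<ge> 0" and l: "l \<ge> 0"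
    and R: "\<And>n. Y \<le> n \<Longrightarrow> n \<le> N \<Longrightarrow> \<bar>(\<Sum>k=1..n. r k) - l * real n\<bar> \<le> \<kappa> * sqrt (real n)"
  shows "\<bar>(\<Sum>n=1..N. r n * real n powr (\<eta> - 1)) - (\<Sum>n=1..Y. r n * real n powr (\<eta> - 1))
      - l * (real N powr \<eta> - real Y powr \<eta>) / \<eta>\<bar> \<le> 5 * \<kappa> * real Y powr (\<eta> - 1 / 2) + l * real Y powr (\<eta> - 1)"
proof -
  let ?w = "\<lambda>n. real n powr (\<eta> - 1)"
  let ?I = "(real N powr \<eta> - real Y powr \<eta>) / \<eta>"
  have U: "\<bar>\<Sum>k=1..n. r k - l\<bar> \<le> \<kappa> * sqrt (real n)" if "Y \<le> n" "n \<le> N" for n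
    using R[OF that] by (simp only: sum_subtractf) (simp add: mult.commute)
  have 1: "\<bar>\<Sum>n=Suc Y..N. (r n - l) * ?w n\<bar> \<le> 5 * \<kappa> * real Y powr (\<eta> - 1 / 2)"
    by (rule abel_sqrt[OF less_imp_le[OF \<eta>(1)] \<eta>(2) Y \<kappa> U])
  have 2: "(\<Sum>n=Suc Y..N. (r n - l) * ?w n) = (\<Sum>n=Suc Y..N. r n * ?w n) - l * (\<Sum>n=Suc Y..N. ?w n)"
    unfolding sum_distrib_left sum_subtractf[symmetric] left_diff_distrib ..
  have 3: "(\<Sum>n=1..N. r n * ?w n) = (\<Sum>n=1..Y. r n * ?w n) + (\<Sum>n=Suc Y..N. r n * ?w n)"
    by (rule sum_tail_split[OF Y(2)])
  have 4: "l * (\<Sum>n=Suc Y..N. ?w n) \<le> l * ?I"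
    using sum_powr_integral(1)[of \<eta> Y N] \<eta> Y l by (intro mult_left_mono) auto
  have "l * ?I \<le> l * ((\<Sum>n=Suc Y..N. ?w n) + real Y powr (\<eta> - 1))"
  proof (intro mult_left_mono l)
    have "real N powr (\<eta> - 1) \<ge> 0" by simp
    then show "?I \<le> (\<Sum>n=Suc Y..N. ?w n) + real Y powr (\<eta> - 1)"
      using sum_powr_integral(2)[of \<eta> Y N] \<eta> Y by linarith
  qed
  then have 5: "l * ?I \<le> l * (\<Sum>n=Suc Y..N. ?w n) + l * real Y powr (\<eta> - 1)"
    by (simp only: distrib_left)
  have aux: "\<bar>P - Q - lI\<bar> \<le> B + ly" if "\<bar>e\<bar> \<le> B" "e = T - lW" "P = Q + T" "lW \<le> lI" "lI \<le> lW + ly"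
    for P Q lI B ly e T lW :: real
    using that by linarith
  show ?thesis using aux[OF 1 2 3 4 5] by simp
qed

section \<open>Hyperbola estimates for divisor sums and their twists\<close>

text \<open>For a \<le> Q the count N div a is replaced by N / a at a cost of at most 1 each; the
  range a > Q is kept exactly.\<close>

lemma divisor_sum_hyperbola_core:
  assumes \<chi>: "\<And>n. \<bar>\<chi> n\<bar> \<le> 1" and Q: "1 \<le> Q" "Q \<le> N"
  shows "\<bar>(\<Sum>n=1..N. divisor_sum \<chi> n) - real N * (\<Sum>a=1..Q. \<chi> a / real a)
    - (\<Sum>b=1..N div (Q + 1). (\<Sum>a=1..N div b. \<chi> a) - (\<Sum>a=1..Q. \<chi> a))\<bar> \<le> real Q"
proof -
  have "(\<Sum>n=1..N. divisor_sum \<chi> n) - real N * (\<Sum>a=1..Q. \<chi> a / real a)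
      - (\<Sum>b=1..N div (Q + 1). (\<Sum>a=1..N div b. \<chi> a) - (\<Sum>a=1..Q. \<chi> a))
      = (\<Sum>a=1..Q. \<chi> a * real (N div a)) - real N * (\<Sum>a=1..Q. \<chi> a / real a)"
    unfolding divisor_sum_def by (subst dirichlet_hyperbola[OF Q(2)]) simp
  also have "\<dots> = (\<Sum>a=1..Q. \<chi> a * (real (N div a) - real N / real a))"
    by (simp add: sum_distrib_left sum_subtractf algebra_simps)
  also have "\<bar>\<dots>\<bar> \<le> (\<Sum>a=1..Q. 1)"
  proof (rule order.trans[OF sum_abs], rule sum_mono)
    fix a assume a: "a \<in> {1..Q}"
    have "real (N div a) \<le> real N / real a" by (rule of_nat_div_le_of_nat)
    moreover have "real N / real a \<le> real (N div a) + 1"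
    proof -
      have "N < a * (N div a + 1)" using dividend_less_times_div[of a N] a by simp
      then have "real N \<le> real a * (real (N div a) + 1)"
        by (metis (no_types) less_imp_le of_nat_1 of_nat_add of_nat_le_iff of_nat_mult)
      then show ?thesis using a by (simp add: field_simps)
    qed
    ultimately have "\<bar>real (N div a) - real N / real a\<bar> \<le> 1" by linarith
    then show "\<bar>\<chi> a * (real (N div a) - real N / real a)\<bar> \<le> 1"
      unfolding abs_mult using \<chi>[of a] by (intro mult_le_one) auto
  qed
  finally show ?thesis by simp
qed

lemma sum_over_tail:
  fixes \<chi> :: "nat \<Rightarrow> real"
  assumes "\<And>n. \<bar>\<Sum>a=1..n. \<chi> a\<bar> \<le> m" "Q \<le> N"
  shows "\<bar>(\<Sum>a=1..N. \<chi> a / real a) - (\<Sum>a=1..Q. \<chi> a / real a)\<bar> \<le> 2 * m / (real Q + 1)"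
proof -
  have "\<bar>\<Sum>a=Suc Q..N. \<chi> a * (1 / real a)\<bar> \<le> 2 * m * (1 / real (Suc Q))"
    by (rule abel_bounded) (use assms in \<open>auto simp: field_simps\<close>)
  moreover have "(\<Sum>a=1..N. \<chi> a / real a) = (\<Sum>a=1..Q. \<chi> a / real a) + (\<Sum>a=Suc Q..N. \<chi> a / real a)"
    by (rule sum_tail_split[OF assms(2)])
  ultimately show ?thesis by (simp add: add.commute)
qed

text \<open>The cut sqrt (m N) balances the hyperbola method for a character with partial sums
  bounded by m: the rounding error Q and the tail m N / (Q + 1) are both at most sqrt (m N).\<close>

lemma floor_sqrt_mult:
  fixes m N :: nat
  assumes "1 \<le> m" "m \<le> N"
  defines "Q \<equiv> nat \<lfloor>sqrt (real m * real N)\<rfloor>"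
  shows "1 \<le> Q" "Q \<le> N" "real Q \<le> sqrt (real m * real N)" "sqrt (real m * real N) \<le> real Q + 1"
    "real N / (real Q + 1) * real m \<le> sqrt (real m * real N)"
proof -
  let ?s = "sqrt (real m * real N)"
  have s1: "?s \<ge> 1"
  proof (rule real_le_rsqrt)
    have "1 * 1 \<le> real m * real N" using assms by (intro mult_mono) auto
    then show "1\<^sup>2 \<le> real m * real N" by simp
  qed
  have sN: "?s \<le> real N"
  proof (rule real_le_lsqrt)
    have "real m * real N \<le> real N * real N" using assms by (intro mult_right_mono) auto
    then show "real m * real N \<le> (real N)\<^sup>2" by (simp add: power2_eq_square)
  qed simp
  have Q: "real Q = of_int \<lfloor>?s\<rfloor>" unfolding Q_def using s1 by simp
  show b: "real Q \<le> ?s" "?s \<le> real Q + 1" unfolding Q by linarith+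
  have "\<lfloor>?s\<rfloor> \<ge> 1" using s1 by simp
  then show "1 \<le> Q" unfolding Q_def by linarith
  show "Q \<le> N" using b(1) sN by linarith
  have "real N * real m = ?s * ?s" by simp
  also have "\<dots> \<le> ?s * (real Q + 1)" using b(2) s1 by (intro mult_left_mono) auto
  finally show "real N / (real Q + 1) * real m \<le> ?s" by (simp add: field_simps)
qed

text \<open>5 = 1 + 2 + 2: rounding, the range beyond the cut, and extending the sum of \<chi>(a) /
  a from Q to X.\<close>

lemma divisor_sum_asymptotic:
  assumes \<chi>: "\<And>n. \<bar>\<chi> n\<bar> \<le> 1" and S: "\<And>n. \<bar>\<Sum>a=1..n. \<chi> a\<bar> \<le> real m"
    and m: "1 \<le> m" "m \<le> N" "N \<le> X"
  shows "\<bar>(\<Sum>n=1..N. divisor_sum \<chi> n) - real N * (\<Sum>a=1..X. \<chi> a / real a)\<bar> \<le> 5 * sqrt (real m * real N)"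
proof -
  define Q where "Q = nat \<lfloor>sqrt (real m * real N)\<rfloor>"
  note q = floor_sqrt_mult[OF m(1,2), folded Q_def]
  let ?T = "\<Sum>b=1..N div (Q + 1). (\<Sum>a=1..N div b. \<chi> a) - (\<Sum>a=1..Q. \<chi> a)"
  let ?D = "\<lambda>Q. \<Sum>a=1..Q. \<chi> a / real a"
  have 1: "\<bar>(\<Sum>n=1..N. divisor_sum \<chi> n) - real N * ?D Q - ?T\<bar> \<le> real Q"
    by (rule divisor_sum_hyperbola_core[OF \<chi> q(1,2)])
  have "\<bar>?T\<bar> \<le> (\<Sum>b=1..N div (Q + 1). 2 * real m)"
  proof (rule order.trans[OF sum_abs], rule sum_mono)
    fix b
    show "\<bar>(\<Sum>a=1..N div b. \<chi> a) - (\<Sum>a=1..Q. \<chi> a)\<bar> \<le> 2 * real m"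
      using S[of "N div b"] S[of Q] by linarith
  qed
  also have "\<dots> = real (N div (Q + 1)) * (2 * real m)" by simp
  also have "\<dots> \<le> real N / (real Q + 1) * (2 * real m)"
    using of_nat_div_le_of_nat[of N "Q + 1", where 'a = real] by (intro mult_right_mono) (auto simp: add.commute)
  also have "\<dots> = 2 * (real N / (real Q + 1) * real m)" by simp
  also have "\<dots> \<le> 2 * sqrt (real m * real N)" using q(5) by linarith
  finally have 2: "\<bar>?T\<bar> \<le> 2 * sqrt (real m * real N)" .
  have "\<bar>?D X - ?D Q\<bar> \<le> 2 * real m / (real Q + 1)"
    by (rule sum_over_tail[OF S]) (use q m in linarith)
  then have "real N * \<bar>?D X - ?D Q\<bar> \<le> real N * (2 * real m / (real Q + 1))" by (intro mult_left_mono) auto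
  also have "\<dots> = 2 * (real N / (real Q + 1) * real m)" by simp
  also have "\<dots> \<le> 2 * sqrt (real m * real N)" using q(5) by linarith
  finally have "\<bar>real N * (?D X - ?D Q)\<bar> \<le> 2 * sqrt (real m * real N)" by (simp add: abs_mult)
  then have 3: "\<bar>real N * ?D X - real N * ?D Q\<bar> \<le> 2 * sqrt (real m * real N)"
    by (simp only: right_diff_distrib)
  show ?thesis using 1 2 3 q(3) by linarith
qed

text \<open>Complete multiplicativity distributes \<open>\<chi>2 n\<close> over n = d (n div d),
  which turns the twist into a convolution of two characters.\<close>

lemma twisted_divisor_sum:
  assumes "cmult_fun \<chi>2" "n > 0"
  shows "dconv (\<lambda>d. \<chi>1 d * \<chi>2 d) \<chi>2 n = \<chi>2 n * divisor_sum \<chi>1 n"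
  unfolding dconv_def divisor_sum_def sum_distrib_left
proof (intro sum.cong refl)
  fix d assume "d \<in> {d. d dvd n}"
  then have "\<chi>2 n = \<chi>2 d * \<chi>2 (n div d)" using cmult_funD(2)[OF assms(1), of d "n div d"] by simp
  then show "\<chi>1 d * \<chi>2 d * \<chi>2 (n div d) = \<chi>2 n * (\<chi>1 d * 1)" by simp
qed

lemma twisted_divisor_sum_bound:
  assumes \<chi>2: "cmult_fun \<chi>2" and \<chi>12: "\<And>n. \<bar>\<chi>1 n * \<chi>2 n\<bar> \<le> 1"
    and S2: "\<And>n. \<bar>\<Sum>a=1..n. \<chi>2 a\<bar> \<le> real m2"
    and S12: "\<And>n. \<bar>\<Sum>a=1..n. \<chi>1 a * \<chi>2 a\<bar> \<le> real m1 * real m2"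
    and m: "1 \<le> m1" "m1 \<le> N"
  shows "\<bar>\<Sum>n=1..N. \<chi>2 n * divisor_sum \<chi>1 n\<bar> \<le> 3 * real m2 * sqrt (real m1 * real N)"
proof -
  define A where "A = nat \<lfloor>sqrt (real m1 * real N)\<rfloor>"
  note q = floor_sqrt_mult[OF m, folded A_def]
  have "(\<Sum>n=1..N. \<chi>2 n * divisor_sum \<chi>1 n) = (\<Sum>n=1..N. dconv (\<lambda>d. \<chi>1 d * \<chi>2 d) \<chi>2 n)"
    by (intro sum.cong refl) (simp add: twisted_divisor_sum[OF \<chi>2])
  also have "\<dots> = (\<Sum>a=1..A. \<chi>1 a * \<chi>2 a * (\<Sum>b=1..N div a. \<chi>2 b))
      + (\<Sum>b=1..N div (A + 1). \<chi>2 b * ((\<Sum>a=1..N div b. \<chi>1 a * \<chi>2 a) - (\<Sum>a=1..A. \<chi>1 a * \<chi>2 a)))"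
    by (rule dirichlet_hyperbola[OF q(2)])
  also have "\<bar>\<dots>\<bar> \<le> (\<Sum>a=1..A. real m2) + (\<Sum>b=1..N div (A + 1). 2 * (real m1 * real m2))"
  proof (rule order.trans[OF abs_triangle_ineq], rule add_mono; rule order.trans[OF sum_abs], rule sum_mono)
    fix a
    show "\<bar>\<chi>1 a * \<chi>2 a * (\<Sum>b=1..N div a. \<chi>2 b)\<bar> \<le> real m2"
      using mult_mono[OF \<chi>12[of a] S2[of "N div a"]] by (simp add: abs_mult)
  next
    fix b
    have "\<bar>(\<Sum>a=1..N div b. \<chi>1 a * \<chi>2 a) - (\<Sum>a=1..A. \<chi>1 a * \<chi>2 a)\<bar> \<le> 2 * (real m1 * real m2)"
      using S12[of "N div b"] S12[of A] by linarith
    from mult_mono[OF cmult_funD(4)[OF \<chi>2, of b] this]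
    show "\<bar>\<chi>2 b * ((\<Sum>a=1..N div b. \<chi>1 a * \<chi>2 a) - (\<Sum>a=1..A. \<chi>1 a * \<chi>2 a))\<bar> \<le> 2 * (real m1 * real m2)"
      by (simp add: abs_mult)
  qed
  also have "\<dots> = real A * real m2 + real (N div (A + 1)) * real m1 * (2 * real m2)" by simp
  also have "\<dots> \<le> sqrt (real m1 * real N) * real m2 + sqrt (real m1 * real N) * (2 * real m2)"
  proof (intro add_mono mult_right_mono q(3))
    have "real (N div (A + 1)) * real m1 \<le> real N / (real A + 1) * real m1"
      using of_nat_div_le_of_nat[of N "A + 1", where 'a = real] by (intro mult_right_mono) (auto simp: add.commute)
    then show "real (N div (A + 1)) * real m1 \<le> sqrt (real m1 * real N)" using q(5) by linarith
  qed auto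
  finally show ?thesis by (simp add: algebra_simps)
qed

text \<open>The cut at A separates two sources of smallness. For a \<le> A the inner sum of
  \<chi>2(b) / b is close to its value up to U, a truncation of L(1, \<chi>2); for a > A the
  cancellation in \<chi>1 \<chi>2 leaves a tail of size m1 m2 / A.\<close>

lemma twisted_divisor_sum_over_bound:
  assumes \<chi>2: "cmult_fun \<chi>2" and \<chi>12: "\<And>n. \<bar>\<chi>1 n * \<chi>2 n\<bar> \<le> 1"
    and S2: "\<And>n. \<bar>\<Sum>a=1..n. \<chi>2 a\<bar> \<le> real m2"
    and S12: "\<And>n. \<bar>\<Sum>a=1..n. \<chi>1 a * \<chi>2 a\<bar> \<le> real m1 * real m2"
    and A: "1 \<le> A" "A \<le> U"
  shows "\<bar>\<Sum>n=1..U. \<chi>2 n * divisor_sum \<chi>1 n / real n\<bar>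
    \<le> (1 + ln (real A)) * (\<bar>\<Sum>b=1..U. \<chi>2 b / real b\<bar> + 2 * real m2 * real A / real U)
      + (1 + ln (real U)) * (2 * (real m1 * real m2) / real A)"
proof -
  let ?g = "\<lambda>a. \<chi>1 a * \<chi>2 a / real a" and ?h = "\<lambda>b. \<chi>2 b / real b"
  let ?D = "\<lambda>n. \<Sum>b=1..n. ?h b"
  let ?T1 = "\<Sum>a=1..A. ?g a * ?D (U div a)"
    and ?T2 = "\<Sum>b=1..U div (A + 1). ?h b * ((\<Sum>a=1..U div b. ?g a) - (\<Sum>a=1..A. ?g a))"
  have Upos: "real U > 0" using A by simp
  have "(\<Sum>n=1..U. \<chi>2 n * divisor_sum \<chi>1 n / real n) = (\<Sum>n=1..U. dconv ?g ?h n)"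
  proof (intro sum.cong refl)
    fix n assume n: "n \<in> {1..U}"
    have "\<chi>2 n * divisor_sum \<chi>1 n / real n = (\<Sum>d | d dvd n. \<chi>1 d * \<chi>2 d * \<chi>2 (n div d) / real n)"
      using n by (simp add: twisted_divisor_sum[OF \<chi>2, symmetric] dconv_def sum_divide_distrib)
    also have "\<dots> = dconv ?g ?h n"
      unfolding dconv_def
    proof (intro sum.cong refl)
      fix d assume "d \<in> {d. d dvd n}"
      then have "real n = real d * real (n div d)" by (metis dvd_mult_div_cancel mem_Collect_eq of_nat_mult)
      then show "\<chi>1 d * \<chi>2 d * \<chi>2 (n div d) / real n = \<chi>1 d * \<chi>2 d / real d * (\<chi>2 (n div d) / real (n div d))"
        by simp
    qed
    finally show "\<chi>2 n * divisor_sum \<chi>1 n / real n = dconv ?g ?h n" .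
  qed
  also have "\<dots> = ?T1 + ?T2" by (rule dirichlet_hyperbola[OF A(2)])
  finally have eq: "(\<Sum>n=1..U. \<chi>2 n * divisor_sum \<chi>1 n / real n) = ?T1 + ?T2" .
  have "\<bar>?T1 + ?T2\<bar> \<le> (\<Sum>a=1..A. 1 / real a * (\<bar>?D U\<bar> + 2 * real m2 * real A / real U))
      + (\<Sum>b=1..U div (A + 1). 1 / real b * (2 * (real m1 * real m2) / real A))"
  proof (rule order.trans[OF abs_triangle_ineq], rule add_mono; rule order.trans[OF sum_abs], rule sum_mono)
    fix a assume a: "a \<in> {1..A}"
    have "\<bar>?D U - ?D (U div a)\<bar> \<le> 2 * real m2 / (real (U div a) + 1)"
      by (rule sum_over_tail[OF S2]) (simp add: div_le_dividend)
    also have "\<dots> \<le> 2 * real m2 * real A / real U"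
    proof -
      have "U < a * (U div a + 1)" using dividend_less_times_div[of a U] a by simp
      also have "\<dots> \<le> A * (U div a + 1)" using a by (intro mult_right_mono) auto
      finally have "real U \<le> real A * (real (U div a) + 1)"
        by (metis (no_types) less_imp_le of_nat_1 of_nat_add of_nat_le_iff of_nat_mult)
      then have "2 * real m2 * real U \<le> 2 * real m2 * (real A * (real (U div a) + 1))" by (intro mult_left_mono) auto
      then show ?thesis using Upos by (simp add: field_simps)
    qed
    finally have "\<bar>?D (U div a)\<bar> \<le> \<bar>?D U\<bar> + 2 * real m2 * real A / real U" by linarith
    moreover have "\<bar>?g a\<bar> \<le> 1 / real a" using \<chi>12[of a] a by (simp add: divide_right_mono)
    ultimately show "\<bar>?g a * ?D (U div a)\<bar> \<le> 1 / real a * (\<bar>?D U\<bar> + 2 * real m2 * real A / real U)"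
      unfolding abs_mult[of "?g a"] by (intro mult_mono) auto
  next
    fix b assume b: "b \<in> {1..U div (A + 1)}"
    have "A \<le> U div b"
    proof -
      have "(A + 1) * b \<le> U" using b by (simp add: less_eq_div_iff_mult_less_eq mult.commute)
      then have "A + 1 \<le> U div b" using b by (simp add: less_eq_div_iff_mult_less_eq)
      then show ?thesis by simp
    qed
    from sum_over_tail[OF S12 this] have "\<bar>(\<Sum>a=1..U div b. ?g a) - (\<Sum>a=1..A. ?g a)\<bar> \<le> 2 * (real m1 * real m2) / (real A + 1)" .
    also have "\<dots> \<le> 2 * (real m1 * real m2) / real A" using A by (intro divide_left_mono) auto
    finally have "\<bar>(\<Sum>a=1..U div b. ?g a) - (\<Sum>a=1..A. ?g a)\<bar> \<le> 2 * (real m1 * real m2) / real A" .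
    moreover have "\<bar>?h b\<bar> \<le> 1 / real b" using cmult_funD(4)[OF \<chi>2, of b] by (simp add: divide_right_mono)
    ultimately show "\<bar>?h b * ((\<Sum>a=1..U div b. ?g a) - (\<Sum>a=1..A. ?g a))\<bar> \<le> 1 / real b * (2 * (real m1 * real m2) / real A)"
      unfolding abs_mult[of "?h b"] by (intro mult_mono) auto
  qed
  also have "\<dots> = (\<Sum>a=1..A. 1 / real a) * (\<bar>?D U\<bar> + 2 * real m2 * real A / real U)
      + (\<Sum>b=1..U div (A + 1). 1 / real b) * (2 * (real m1 * real m2) / real A)"
    by (rule arg_cong2[where f = "(+)"]; rule sum_distrib_right[symmetric])
  also have "\<dots> \<le> (1 + ln (real A)) * (\<bar>?D U\<bar> + 2 * real m2 * real A / real U)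
      + (1 + ln (real U)) * (2 * (real m1 * real m2) / real A)"
  proof (intro add_mono mult_right_mono)
    show "(\<Sum>a=1..A. 1 / real a) \<le> 1 + ln (real A)" by (rule sum_inverse_le_ln[OF A(1)])
    have "(\<Sum>b=1..U div (A + 1). 1 / real b) \<le> (\<Sum>b=1..U. 1 / real b)"
      by (rule sum_mono2) (auto intro: order.trans[OF _ div_le_dividend])
    also have "\<dots> \<le> 1 + ln (real U)" using A by (intro sum_inverse_le_ln) auto
    finally show "(\<Sum>b=1..U div (A + 1). 1 / real b) \<le> 1 + ln (real U)" .
  qed auto
  finally show ?thesis unfolding eq .
qed

text \<open>These are the coefficients of 1 / ((1 - x)^2 (1 + x)) and of 1 / (1 - x^2)^2. They are
  proved together because the recurrence for the second involves the first.\<close>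

lemma alternating_convolution:
  "(\<Sum>i\<le>k. (real i + 1) * (-1) ^ (k - i)) = real (k div 2) + 1"
  "(\<Sum>i\<le>k. (real i + 1) * (real (k - i) + 1) * (-1) ^ (k - i)) = (if even k then real (k div 2) + 1 else 0)"
proof (induction k)
  case (Suc k)
  have U: "(\<Sum>i\<le>Suc k. (real i + 1) * (-1) ^ (Suc k - i)) = real k + 2 - (\<Sum>i\<le>k. (real i + 1) * (-1) ^ (k - i))"
    by (simp add: Suc_diff_le sum_negf)
  show 1: "(\<Sum>i\<le>Suc k. (real i + 1) * (-1) ^ (Suc k - i)) = real (Suc k div 2) + 1"
    unfolding U Suc.IH(1) by (cases "even k") (auto elim!: evenE oddE)
  have "(\<Sum>i\<le>k. (real i + 1) * (real (Suc k - i) + 1) * (-1) ^ (Suc k - i))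
      = (\<Sum>i\<le>k. - ((real i + 1) * (real (k - i) + 1) * (-1) ^ (k - i)) - (real i + 1) * (-1) ^ (k - i))"
    by (intro sum.cong refl) (auto simp: Suc_diff_le algebra_simps)
  also have "\<dots> = - (\<Sum>i\<le>k. (real i + 1) * (real (k - i) + 1) * (-1) ^ (k - i)) - (\<Sum>i\<le>k. (real i + 1) * (-1) ^ (k - i))"
    by (simp add: sum_subtractf sum_negf)
  finally have "(\<Sum>i\<le>Suc k. (real i + 1) * (real (Suc k - i) + 1) * (-1) ^ (Suc k - i))
      = real k + 2 - (if even k then real (k div 2) + 1 else 0) - (real (k div 2) + 1)"
    unfolding Suc.IH by simp
  then show "(\<Sum>i\<le>Suc k. (real i + 1) * (real (Suc k - i) + 1) * (-1) ^ (Suc k - i)) = (if even (Suc k) then real (Suc k div 2) + 1 else 0)"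
    by (cases "even k") (auto elim!: evenE oddE)
qed simp_all

lemma mult_fun_divisor_sum:
  assumes "cmult_fun \<chi>"
  shows "mult_fun (divisor_sum \<chi>)"
  unfolding mult_fun_def
proof (intro conjI allI impI)
  fix a b :: nat assume c: "coprime a b"
  show "divisor_sum \<chi> (a * b) = divisor_sum \<chi> a * divisor_sum \<chi> b"
  proof (cases "a = 0 \<or> b = 0")
    case True
    then have "a = 0 \<and> b = 1 \<or> a = 1 \<and> b = 0" using c by auto
    then show ?thesis using divisor_sum_mult(1)[OF assms] by auto
  next
    case False
    then show ?thesis using divisor_sum_mult(2)[OF assms] c by auto
  qed
qed (rule divisor_sum_mult(1)[OF assms])

lemma four_fold_convolution_nonneg:
  assumes \<chi>1: "cmult_fun \<chi>1" and \<chi>2: "cmult_fun \<chi>2"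
  shows "dconv (\<lambda>n. \<chi>2 n * divisor_sum \<chi>1 n) (divisor_sum \<chi>1) 1 = 1"
    "n > 0 \<Longrightarrow> dconv (\<lambda>n. \<chi>2 n * divisor_sum \<chi>1 n) (divisor_sum \<chi>1) n \<ge> 0"
proof -
  let ?r = "divisor_sum \<chi>1" and ?h = "\<lambda>n. \<chi>2 n * divisor_sum \<chi>1 n"
  have r: "mult_fun ?r" by (rule mult_fun_divisor_sum[OF \<chi>1])
  then have h: "mult_fun ?h" using cmult_funD(1,2)[OF \<chi>2] by (simp add: mult_fun_def)
  note M = mult_fun_dconv[OF h r]
  show "dconv ?h ?r 1 = 1" by (rule M(1))
  have pp: "dconv ?h ?r (p ^ k) \<ge> 0" if p: "prime p" for p k
  proof -
    note R = divisor_sum_mult(3)[OF \<chi>1 p]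
    have R0: "?r (p ^ i) \<ge> 0" for i unfolding R by simp
    have eq: "dconv ?h ?r (p ^ k) = (\<Sum>i\<le>k. \<chi>2 p ^ i * ?r (p ^ i) * ?r (p ^ (k - i)))"
      unfolding dconv_prime_power[OF p] by (simp add: cmult_funD(5)[OF \<chi>2])
    \<comment> \<open>With \<chi>2(p) = -1 signs alternate. If \<chi>1(p) = 1 the local factor is 1
      / (1 - x^2)^2; if it is 0 the factor is 1 / (1 - x^2); if it is -1 the divisor sum vanishes at
      odd exponents, so no negative term occurs.\<close>
    consider "\<chi>2 p \<in> {0, 1}" | "\<chi>2 p = -1" "\<chi>1 p = 1" | "\<chi>2 p = -1" "\<chi>1 p = 0" | "\<chi>2 p = -1" "\<chi>1 p = -1"
      using cmult_funD(3)[OF \<chi>1, of p] cmult_funD(3)[OF \<chi>2, of p] by auto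
    then show ?thesis
    proof cases
      case 1
      then show ?thesis unfolding eq using R0 by (intro sum_nonneg mult_nonneg_nonneg) auto
    next
      case 2
      have "dconv ?h ?r (p ^ k) = (\<Sum>i\<le>k. (real (k - i) + 1) * (real i + 1) * (-1) ^ (k - i))"
      proof -
        have "dconv ?h ?r (p ^ k) = (\<Sum>i\<le>k. (real i + 1) * (real (k - i) + 1) * (-1) ^ i)"
          unfolding eq R using 2 by (simp add: mult_ac)
        also have "\<dots> = (\<Sum>i\<le>k. (real (k - i) + 1) * (real i + 1) * (-1) ^ (k - i))"
          by (rule sum.reindex_bij_witness[of _ "\<lambda>i. k - i" "\<lambda>i. k - i"]) auto
        finally show ?thesis .
      qed
      also have "\<dots> = (if even k then real (k div 2) + 1 else 0)"
        using alternating_convolution(2)[of k] by (simp add: mult_ac)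
      finally show ?thesis by simp
    next
      case 3
      then show ?thesis unfolding eq R using sum_alternating[of k] by simp
    next
      case 4
      then show ?thesis unfolding eq R by (intro sum_nonneg) auto
    qed
  qed
  show "dconv ?h ?r n \<ge> 0" if "n > 0"
    using that
  proof (induction n rule: prime_power_induct)
    case one
    then show ?case using M(1) by simp
  next
    case (mult p k u)
    have "dconv ?h ?r (p ^ k * u) = dconv ?h ?r (p ^ k) * dconv ?h ?r u"
      using mult prime_gt_0_nat[of p] by (intro M(2)) auto
    then show ?case using pp[OF mult(1)] mult.IH by simp
  qed
qed

lemma sum_inverse_sqrt_le: "(\<Sum>b=1..K. 1 / sqrt (real b)) \<le> 2 * sqrt (real K)"
proof (induction K)
  case (Suc K)
  let ?x = "sqrt (real (Suc K))" and ?y = "sqrt (real K)"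
  have "?x > 0" "?y \<le> ?x" by simp_all
  have "1 = (?x - ?y) * (?x + ?y)" by (simp add: algebra_simps)
  also have "\<dots> \<le> (?x - ?y) * (2 * ?x)" using \<open>?y \<le> ?x\<close> by (intro mult_left_mono) auto
  finally have "1 / ?x \<le> 2 * (?x - ?y)" using \<open>?x > 0\<close> by (simp add: field_simps)
  then show ?case using Suc by simp
qed simp

lemma div_sqrt:
  fixes x y z :: real
  assumes "y > 0"
  shows "x / y * (z * sqrt y) = z * x / sqrt y"
proof -
  obtain s where s: "y = s * s" "s > 0" using assms by (metis real_sqrt_gt_0_iff real_sqrt_mult_self abs_of_pos)
  then show ?thesis by (simp add: real_sqrt_mult)
qed

text \<open>The term with \<open>G'\<close> allows for arguments beyond the range of the Burgess
  bound. In 3 G N / sqrt Q two parts come from summing 1 / sqrt b and one from the repeated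
  subtraction of the sum up to Q.\<close>

lemma divisor_sum_hyperbola_estimate:
  assumes \<chi>: "\<And>n. \<bar>\<chi> n\<bar> \<le> 1"
    and S: "\<And>n. n \<le> N \<Longrightarrow> \<bar>\<Sum>a=1..n. \<chi> a\<bar> \<le> G * sqrt (real n) + G' * real n"
    and SQ: "\<bar>\<Sum>a=1..Q. \<chi> a\<bar> \<le> G * sqrt (real Q)"
    and Q: "1 \<le> Q" "Q \<le> N" and G: "G \<ge> 0" "G' \<ge> 0"
  shows "\<bar>(\<Sum>n=1..N. divisor_sum \<chi> n) - real N * (\<Sum>a=1..Q. \<chi> a / real a)\<bar>
    \<le> real Q + 3 * G * real N / sqrt (real Q) + G' * real N * (1 + ln (real N))"
proof -
  define K where "K = N div (Q + 1)"
  let ?S = "\<lambda>n. \<Sum>a=1..n. \<chi> a"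
  have KN: "real K \<le> real N / real Q"
  proof -
    have "real K \<le> real N / real (Q + 1)" unfolding K_def by (rule of_nat_div_le_of_nat)
    also have "\<dots> \<le> real N / real Q" using Q by (intro divide_left_mono) auto
    finally show ?thesis .
  qed
  have 1: "\<bar>(\<Sum>n=1..N. divisor_sum \<chi> n) - real N * (\<Sum>a=1..Q. \<chi> a / real a)
      - (\<Sum>b=1..K. ?S (N div b) - ?S Q)\<bar> \<le> real Q"
    unfolding K_def by (rule divisor_sum_hyperbola_core[OF \<chi> Q])
  have 2: "\<bar>\<Sum>b=1..K. ?S (N div b) - ?S Q\<bar> \<le> 3 * G * real N / sqrt (real Q) + G' * real N * (1 + ln (real N))"
  proof (cases "K = 0")
    case True
    then show ?thesis using G Q by simp
  next
    case False
    have "\<bar>\<Sum>b=1..K. ?S (N div b) - ?S Q\<bar> \<le> (\<Sum>b=1..K. G * sqrt (real N) * (1 / sqrt (real b)) + G' * real N * (1 / real b) + G * sqrt (real Q))"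
    proof (rule order.trans[OF sum_abs], rule sum_mono)
      fix b assume b: "b \<in> {1..K}"
      have le: "real (N div b) \<le> real N / real b" by (rule of_nat_div_le_of_nat)
      have "\<bar>?S (N div b)\<bar> \<le> G * sqrt (real (N div b)) + G' * real (N div b)"
        by (rule S) (simp add: div_le_dividend)
      also have "\<dots> \<le> G * sqrt (real N / real b) + G' * (real N / real b)"
        using G le by (intro add_mono mult_left_mono) auto
      finally show "\<bar>?S (N div b) - ?S Q\<bar> \<le> G * sqrt (real N) * (1 / sqrt (real b)) + G' * real N * (1 / real b) + G * sqrt (real Q)"
        using SQ by (simp add: real_sqrt_divide)
    qed
    also have "\<dots> = G * sqrt (real N) * (\<Sum>b=1..K. 1 / sqrt (real b)) + G' * real N * (\<Sum>b=1..K. 1 / real b) + real K * (G * sqrt (real Q))"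
      by (simp add: sum.distrib sum_distrib_left)
    also have "\<dots> \<le> G * sqrt (real N) * (2 * sqrt (real N / real Q)) + G' * real N * (1 + ln (real N)) + real N / real Q * (G * sqrt (real Q))"
    proof (intro add_mono mult_left_mono mult_right_mono KN)
      show "(\<Sum>b=1..K. 1 / sqrt (real b)) \<le> 2 * sqrt (real N / real Q)"
        using sum_inverse_sqrt_le[of K] KN by (smt (verit) real_sqrt_le_iff)
      have "K \<le> N" by (simp add: K_def div_le_dividend)
      then have "ln (real K) \<le> ln (real N)" using False by (intro ln_mono) auto
      then show "(\<Sum>b=1..K. 1 / real b) \<le> 1 + ln (real N)"
        using sum_inverse_le_ln[of K] False by simp
    qed (use G in auto)
    also have "\<dots> = 3 * G * real N / sqrt (real Q) + G' * real N * (1 + ln (real N))"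
    proof -
      have "sqrt (real N) * sqrt (real N) = real N" by simp
      then have "G * sqrt (real N) * (2 * sqrt (real N / real Q)) = 2 * G * real N / sqrt (real Q)"
        by (simp add: real_sqrt_divide)
      moreover have "real N / real Q * (G * sqrt (real Q)) = G * real N / sqrt (real Q)"
        using div_sqrt[of "real Q" N G] Q by simp
      ultimately show ?thesis by (simp add: field_simps)
    qed
    finally show ?thesis .
  qed
  show ?thesis using 1 2 by linarith
qed

text \<open>A long interval is cut into blocks of length \<open>N1\<close>, each contributing G sqrt
  N1, and a shorter remainder.\<close>

lemma interval_sum_chop:
  fixes f :: "int \<Rightarrow> real"
  assumes b: "\<And>M N. N \<le> N1 \<Longrightarrow> \<bar>\<Sum>n\<in>{M<..M + int N}. f n\<bar> \<le> G * sqrt (real N)" and N1: "N1 > 0" and G: "G \<ge> 0"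
  shows "\<bar>\<Sum>n\<in>{M<..M + int N}. f n\<bar> \<le> G * sqrt (real N) + G / sqrt (real N1) * real N"
proof -
  have "\<bar>\<Sum>n\<in>{M<..M + int (k * N1 + l)}. f n\<bar> \<le> real k * (G * sqrt (real N1)) + G * sqrt (real l)" if "l \<le> N1" for k l M
  proof (induction k arbitrary: M)
    case 0
    show ?case using b[OF that, of M] by simp
  next
    case (Suc k)
    have "Suc k * N1 + l = N1 + (k * N1 + l)" by simp
    then show ?case
      using interval_sum_split[of f M N1 "k * N1 + l"] Suc.IH[of "M + int N1"] b[of N1 M]
      by (simp add: algebra_simps)
  qed
  from this[of "N mod N1" M "N div N1"] N1
  have "\<bar>\<Sum>n\<in>{M<..M + int N}. f n\<bar> \<le> real (N div N1) * (G * sqrt (real N1)) + G * sqrt (real (N mod N1))"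
    by (simp del: of_nat_add of_nat_mult)
  also have "\<dots> \<le> real N / real N1 * (G * sqrt (real N1)) + G * sqrt (real N)"
    using G by (intro add_mono mult_right_mono mult_left_mono of_nat_div_le_of_nat) auto
  also have "real N / real N1 * (G * sqrt (real N1)) = G / sqrt (real N1) * real N"
    using div_sqrt[of "real N1" N G] N1 by simp
  finally show ?thesis by simp
qed

lemma sum_int_interval:
  fixes f :: "int \<Rightarrow> real"
  shows "(\<Sum>a=1..n. f (int a)) = (\<Sum>k\<in>{0<..0 + int n}. f k)"
  by (rule sum.reindex_bij_witness[of _ nat int]) auto

text \<open>The partial sum \<open>D\<close> of \<chi>(a) / a up to Q governs the divisor sum at
  every length. At Y the divisor sum is at most 3 sqrt Y, which forces D to be small; at N \<ge> Y
  the same D then gives a small main term.\<close>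

lemma divisor_sum_small:
  fixes f :: "int \<Rightarrow> real" and t L :: real
  assumes f: "real_char m f"
    and burgess: "\<And>M N. real N \<le> sqrt (real m) \<Longrightarrow> \<bar>\<Sum>n\<in>{M<..M + int N}. f n\<bar> \<le> L * t ^ 45 / 10 * sqrt (real N)"
    and t: "t ^ 3 \<ge> 100" "t > 4" "sqrt (real m) = t ^ 120" "L = ln (real m)" "L > 366" "L \<le> 797 / 1000 * t ^ 4"
    and Y: "Y = nat \<lfloor>4 * t ^ 120 / L\<rfloor>"
    and RY: "(\<Sum>n=1..Y. divisor_sum (\<lambda>n. f (int n)) n) \<le> 3 * sqrt (real Y)"
    and N: "Y \<le> N" "N \<le> m\<^sup>2"
  shows "(\<Sum>n=1..N. divisor_sum (\<lambda>n. f (int n)) n) \<le> 6 / 5 / t ^ 6 * real N"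
proof -
  define \<chi> where "\<chi> n = f (int n)" for n :: nat
  define G where "G = L * t ^ 45 / 10"
  \<comment> \<open>The cut makes the two errors at length Y comparable: Q itself, and 3 G Y / sqrt
    Q, which is about 6 / 5 t^165 / t^55 since the logarithms in G and Y cancel.\<close>
  define Q where "Q = nat \<lfloor>t ^ 110\<rfloor>"
  define D where "D = (\<Sum>a=1..Q. \<chi> a / real a)"
  let ?R = "\<lambda>N. \<Sum>n=1..N. divisor_sum \<chi> n"
  have \<chi>f: "\<chi> = (\<lambda>n. f (int n))" by (simp add: \<chi>_def fun_eq_iff)
  have \<chi>: "\<bar>\<chi> n\<bar> \<le> 1" for n using real_charD(7)[OF f] by (simp add: \<chi>_def)
  have t1: "t ^ j \<ge> 1" for j using t(2) by simp
  have G: "G > 0" using t by (simp add: G_def)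
  have tk: "t ^ (i + j) = t ^ i * t ^ j" for i j by (rule power_add)
  have big: "t ^ 30 \<ge> 10 ^ 20" using power_mono[OF t(1), of 10] by (simp flip: power_mult)
  have mono: "t ^ i \<le> t ^ j" if "i \<le> j" for i j using t(2) that by (intro power_increasing) auto
  have Q: "real Q \<le> t ^ 110" "real Q > t ^ 110 - 1"
  proof -
    have "real Q = of_int \<lfloor>t ^ 110\<rfloor>" unfolding Q_def using t1[of 110] by simp
    then show "real Q \<le> t ^ 110" "real Q > t ^ 110 - 1" by linarith+
  qed
  have "real Q \<ge> (999 / 1000 * t ^ 55)\<^sup>2"
  proof -
    have "(999 / 1000 * t ^ 55)\<^sup>2 = 998001 / 1000000 * t ^ 110" by (simp add: power_mult_distrib power_divide flip: power_mult)
    moreover have "t ^ 110 \<ge> 10 ^ 20" using big mono[of 30 110] by linarith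
    ultimately show ?thesis using Q(2) by simp
  qed
  then have sQ: "sqrt (real Q) \<ge> 999 / 1000 * t ^ 55" by (rule real_le_rsqrt)
  have y: "4 * t ^ 120 / L \<ge> 5 * t ^ 116"
  proof -
    have "5 * t ^ 116 * L \<le> 5 * t ^ 116 * (797 / 1000 * t ^ 4)" using t t1[of 116] by (intro mult_left_mono) auto
    also have "\<dots> \<le> 4 * t ^ 120" using tk[of 116 4] t1[of 120] by simp
    finally show ?thesis using t(5) by (simp add: field_simps)
  qed
  have Yr: "real Y \<le> 4 * t ^ 120 / L" "real Y > 4 * t ^ 120 / L - 1"
  proof -
    have "4 * t ^ 120 / L \<ge> 0" using t1[of 120] t by simp
    then have "real Y = of_int \<lfloor>4 * t ^ 120 / L\<rfloor>" unfolding Y by simp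
    then show "real Y \<le> 4 * t ^ 120 / L" "real Y > 4 * t ^ 120 / L - 1" by linarith+
  qed
  have Y999: "real Y \<ge> 3996 / 1000 * t ^ 120 / L"
  proof -
    have "t ^ 116 \<ge> 10 ^ 20" using big mono[of 30 116] by linarith
    then have "4 * t ^ 120 / L \<ge> 1000" using y by simp
    moreover have "3996 / 1000 * t ^ 120 / L = 999 / 1000 * (4 * t ^ 120 / L)" by simp
    ultimately show ?thesis using Yr(2) by linarith
  qed
  have Yt: "real Y \<ge> t ^ 116"
  proof -
    have "t ^ 116 \<ge> 1" by (rule t1)
    then show ?thesis using y Yr(2) by linarith
  qed
  then have Ypos: "real Y > 0" using t1[of 116] by linarith
  have Ym: "real Y \<le> sqrt (real m)"
  proof -
    have "4 * t ^ 120 / L \<le> t ^ 120" using t t1[of 120] by (simp add: field_simps)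
    then show ?thesis using Yr(1) t(3) by linarith
  qed
  have QY: "Q \<le> Y"
  proof -
    have "real Q \<le> real Y" using Q(1) Yt mono[of 110 116] by linarith
    then show ?thesis by simp
  qed
  have "real Q > 0" using Q(2) t1[of 110] by linarith
  then have Q1: "1 \<le> Q" by simp
  have S: "\<bar>\<Sum>a=1..n. \<chi> a\<bar> \<le> G * sqrt (real n)" if "real n \<le> sqrt (real m)" for n
    unfolding \<chi>_def sum_int_interval G_def using burgess[OF that, of 0] by simp
  define N1 where "N1 = nat \<lfloor>t ^ 120\<rfloor>"
  have N1: "real N1 \<le> t ^ 120" "real N1 > t ^ 120 - 1"
  proof -
    have "real N1 = of_int \<lfloor>t ^ 120\<rfloor>" unfolding N1_def using t1[of 120] by simp
    then show "real N1 \<le> t ^ 120" "real N1 > t ^ 120 - 1" by linarith+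
  qed
  have "real N1 \<ge> (t ^ 60 / 3)\<^sup>2"
  proof -
    have "(t ^ 60 / 3)\<^sup>2 = t ^ 120 / 9" by (simp add: power_divide flip: power_mult)
    moreover have "t ^ 120 \<ge> 10 ^ 20" using big mono[of 30 120] by linarith
    ultimately show ?thesis using N1(2) by simp
  qed
  then have sN1: "sqrt (real N1) \<ge> t ^ 60 / 3" by (rule real_le_rsqrt)
  have N1pos: "N1 > 0" using N1(2) mono[of 0 120] big mono[of 30 120] by (intro gr0I) simp
  define G' where "G' = 3 * G / t ^ 60"
  have G': "G' \<ge> 0" using G t(2) by (simp add: G'_def)
  have S': "\<bar>\<Sum>a=1..n. \<chi> a\<bar> \<le> G * sqrt (real n) + G' * real n" for n
  proof -
    have "\<bar>\<Sum>a=1..n. \<chi> a\<bar> \<le> G * sqrt (real n) + G / sqrt (real N1) * real n"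
      unfolding \<chi>_def sum_int_interval
    proof (rule interval_sum_chop)
      fix M N assume "N \<le> N1"
      then have "real N \<le> sqrt (real m)" using N1(1) t(3) by simp
      then show "\<bar>\<Sum>n\<in>{M<..M + int N}. f n\<bar> \<le> G * sqrt (real N)"
        using burgess by (simp add: G_def)
    qed (use N1pos G in auto)
    also have "G / sqrt (real N1) * real n \<le> G / (t ^ 60 / 3) * real n"
      using sN1 G t(2) N1pos by (intro mult_right_mono divide_left_mono) auto
    finally show ?thesis by (simp add: G'_def mult.commute)
  qed
  have eY: "\<bar>?R Y - real Y * D\<bar> \<le> real Q + 3 * G * real Y / sqrt (real Q)"
    using divisor_sum_hyperbola_estimate[of \<chi> Y G 0 Q] \<chi> S G Q1 QY Ym unfolding D_def by simp
  have eN: "\<bar>?R N - real N * D\<bar> \<le> real Q + 3 * G * real N / sqrt (real Q) + G' * real N * (1 + ln (real N))"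
    unfolding D_def
    using \<chi> S[of Q] S' G G' Q1 QY N Ym by (intro divisor_sum_hyperbola_estimate) auto
  have sY: "sqrt (real Y) \<ge> t ^ 58"
    using Yt by (intro real_le_rsqrt) (simp flip: power_mult)
  define c where "c = 3 * G / sqrt (real Q)"
  have c: "c \<le> 3004 / 10000 * L / t ^ 10"
  proof -
    have "c \<le> 3 * G / (999 / 1000 * t ^ 55)"
      unfolding c_def using sQ G t(2) \<open>real Q > 0\<close> by (intro divide_left_mono) auto
    also have "\<dots> = 300 / 999 * (L / t ^ 10)"
      using tk[of 45 10] t(2) by (simp add: G_def field_simps)
    also have "\<dots> \<le> 3004 / 10000 * (L / t ^ 10)"
      using t by (intro mult_right_mono) auto
    finally show ?thesis by simp
  qed
  have QYr: "real Q / real Y \<le> 2503 / 10000 * L / t ^ 10"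
  proof -
    have "real Q / real Y \<le> t ^ 110 / (3996 / 1000 * t ^ 120 / L)"
      using Q(1) Y999 Ypos t t1[of 120] by (intro frac_le) auto
    also have "\<dots> = 1000 / 3996 * (L / t ^ 10)" using tk[of 110 10] t(2) by (simp add: field_simps)
    also have "\<dots> \<le> 2503 / 10000 * (L / t ^ 10)" using t by (intro mult_right_mono) auto
    finally show ?thesis by simp
  qed
  have D: "D \<le> 3 / t ^ 58 + real Q / real Y + c"
  proof -
    have "real Y * D \<le> ?R Y + (real Q + 3 * G * real Y / sqrt (real Q))" using eY by linarith
    also have "?R Y \<le> 3 * sqrt (real Y)" using RY by (simp only: \<chi>f)
    also have "3 * sqrt (real Y) + (real Q + 3 * G * real Y / sqrt (real Q)) = real Y * (3 / sqrt (real Y) + real Q / real Y + c)"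
      using Ypos by (simp add: c_def field_simps)
    finally have "D \<le> 3 / sqrt (real Y) + real Q / real Y + c"
      using Ypos by (simp add: mult_le_cancel_left_pos)
    moreover have "3 / sqrt (real Y) \<le> 3 / t ^ 58" using sY Ypos t(2) by (intro divide_left_mono) auto
    ultimately show ?thesis by linarith
  qed
  have Npos: "real N > 0" using Ypos N(1) by simp
  have lnN: "ln (real N) \<le> 2 * L"
  proof -
    have "ln (real N) \<le> ln (real (m\<^sup>2))" using N(2) Npos by (intro ln_mono) auto
    also have "\<dots> = 2 * L" using t(4) real_charD(1)[OF f] by (simp add: ln_realpow)
    finally show ?thesis .
  qed
  have "real Q \<le> real N * (real Q / real Y)"
  proof -
    have "real Q = real Y * (real Q / real Y)" using Ypos by simp
    also have "\<dots> \<le> real N * (real Q / real Y)" using N(1) by (intro mult_right_mono) auto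
    finally show ?thesis .
  qed
  moreover have "G' * real N * (1 + ln (real N)) \<le> real N * (G' * (1 + 2 * L))"
  proof -
    have "G' * real N * (1 + ln (real N)) \<le> G' * real N * (1 + 2 * L)" using lnN G' by (intro mult_left_mono) auto
    then show ?thesis by (simp add: mult_ac)
  qed
  moreover have "real N * D \<le> real N * (3 / t ^ 58 + real Q / real Y + c)" using D Npos by (intro mult_left_mono) auto
  moreover have "3 * G * real N / sqrt (real Q) = real N * c" by (simp add: c_def)
  ultimately have "?R N \<le> real N * (3 / t ^ 58 + real Q / real Y + c) + real N * (real Q / real Y) + real N * c + real N * (G' * (1 + 2 * L))"
    using eN by linarith
  then have "?R N \<le> real N * (3 / t ^ 58 + 2 * (real Q / real Y) + 2 * c + G' * (1 + 2 * L))"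
    by (simp add: algebra_simps)
  also have "\<dots> \<le> real N * (6 / 5 / t ^ 6)"
  proof (intro mult_left_mono)
    \<comment> \<open>The logarithm is traded for t^4 here, which leaves the saving t^-6.\<close>
    have "L / t ^ 10 \<le> (797 / 1000 * t ^ 4) / t ^ 10"
      using t(2,6) by (intro divide_right_mono) auto
    also have "\<dots> = 797 / 1000 / t ^ 6" using t(2) tk[of 4 6] by (simp add: field_simps)
    finally have "L / t ^ 10 \<le> 797 / 1000 / t ^ 6" .
    moreover have "3 / t ^ 58 \<le> 1 / 1000 / t ^ 6"
    proof -
      have "t ^ 30 \<le> t ^ 52" by (rule mono) simp
      moreover have "(3000::real) \<le> 10 ^ 20" by simp
      ultimately have "3000 \<le> t ^ 52" using big by linarith
      then have "3000 * t ^ 6 \<le> t ^ 52 * t ^ 6" using t(2) by (intro mult_right_mono) auto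
      then show ?thesis using tk[of 52 6] t(2) by (simp add: field_simps)
    qed
    moreover have "G' * (1 + 2 * L) \<le> 1 / 10 / t ^ 6"
    proof -
      have "G' * (1 + 2 * L) = 3 / 10 * L * (1 + 2 * L) / t ^ 15"
        using tk[of 45 15] t(2) by (simp add: G'_def G_def field_simps)
      also have "3 / 10 * L * (1 + 2 * L) \<le> 1 / 10 * t ^ 9"
      proof -
        have "3 / 10 * L * (1 + 2 * L) \<le> 3 / 10 * (797 / 1000 * t ^ 4) * (201 / 100 * (797 / 1000 * t ^ 4))"
          using t by (intro mult_mono) auto
        also have "\<dots> = 3 / 10 * 797 / 1000 * 201 / 100 * 797 / 1000 * t ^ 8" using tk[of 4 4] by simp
        also have "\<dots> \<le> 4 / 10 * t ^ 8" using t(2) by (intro mult_right_mono) auto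
        also have "\<dots> \<le> t / 10 * t ^ 8" using t(2) by (intro mult_right_mono) auto
        also have "\<dots> = 1 / 10 * t ^ 9" using tk[of 1 8] by simp
        finally show ?thesis .
      qed
      then have "3 / 10 * L * (1 + 2 * L) / t ^ 15 \<le> (1 / 10 * t ^ 9) / t ^ 15"
        using t(2) by (intro divide_right_mono) auto
      also have "(1 / 10 * t ^ 9) / t ^ 15 = 1 / 10 / t ^ 6" using tk[of 9 6] t(2) by (simp add: field_simps)
      finally show ?thesis .
    qed
    moreover have "real Q / real Y \<le> 2503 / 10000 * (L / t ^ 10)" "c \<le> 3004 / 10000 * (L / t ^ 10)"
      using QYr c by simp_all
    moreover have "1 / t ^ 6 > 0" using t(2) by simp
    moreover have "797 / 1000 / t ^ 6 = 797 / 1000 * (1 / t ^ 6)" "1 / 1000 / t ^ 6 = 1 / 1000 * (1 / t ^ 6)"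
      "1 / 10 / t ^ 6 = 1 / 10 * (1 / t ^ 6)" "6 / 5 / t ^ 6 = 6 / 5 * (1 / t ^ 6)" by simp_all
    ultimately show "3 / t ^ 58 + 2 * (real Q / real Y) + 2 * c + G' * (1 + 2 * L) \<le> 6 / 5 / t ^ 6"
      by linarith
  qed (use Npos in auto)
  finally show ?thesis by (simp add: \<chi>f mult.commute)
qed

lemma exp_le_inverse: "x < 1 \<Longrightarrow> exp x \<le> 1 / (1 - x)" for x :: real
  using exp_ge_add_one_self[of "- x"] by (simp add: exp_minus field_simps)

section \<open>Two sparse divisor sums\<close>

text \<open>Here \<open>1 - \<eta>\<close> plays the role of a Siegel zero: by the intermediate value theorem \<open>\<eta>\<close> is chosen such that
  \<open>P \<eta> X\<close> equals its main term \<open>l / \<eta> * X powr \<eta>\<close>. The summand \<open>6 * sqrt (m / X)\<close> in \<open>l\<close> only ensures \<open>l > 0\<close>.\<close>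

lemma exceptional_exponent:
  fixes \<chi> :: "nat \<Rightarrow> real" and t :: real
  defines "P \<equiv> \<lambda>\<eta> N. \<Sum>n=1..N. divisor_sum \<chi> n * real n powr (\<eta> - 1)"
  assumes \<chi>: "cmult_fun \<chi>" and S: "\<And>n. \<bar>\<Sum>a=1..n. \<chi> a\<bar> \<le> real m"
    and t: "real m = t ^ 240" "t \<ge> 46 / 10" "ln (real m) \<le> 797 / 1000 * t ^ 4"
    and R: "(\<Sum>n=1..m\<^sup>2. divisor_sum \<chi> n) \<le> 6 / 5 / t ^ 6 * (real m)\<^sup>2"
    and p: "(\<Sum>n=1..m\<^sup>2. divisor_sum \<chi> n / real n) \<le> 21 / 10"
    and X: "m\<^sup>2 \<le> X"
  obtains \<eta> l where "0 < \<eta>" "\<eta> \<le> 1815 / 1000 / t ^ 6" "0 < l" "l \<le> 1" "l / \<eta> \<le> 49 / 20"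
    "\<And>Y. m \<le> Y \<Longrightarrow> Y \<le> X \<Longrightarrow> \<bar>P \<eta> Y - l / \<eta> * real Y powr \<eta>\<bar> \<le> 56 * sqrt (real m) * real Y powr (\<eta> - 1 / 2)"
proof -
  define r where "r = divisor_sum \<chi>"
  have t1: "t > 1" using t(2) by simp
  have tpow: "t ^ j \<ge> 1" for j using t1 by simp
  have sm: "sqrt (real m) = t ^ 120"
    unfolding t(1) by (rule real_sqrt_unique) (use t1 in \<open>simp_all flip: power_mult\<close>)
  have m1: "1 \<le> m" using t(1) tpow[of 240] by linarith
  have mm: "m \<le> m\<^sup>2" by (simp add: power2_eq_square)
  have mX: "m \<le> X" using mm X by linarith
  have X1: "1 \<le> X" using m1 mX by linarith
  have r0: "r n \<ge> 0" if "n \<ge> 1" for n using divisor_sum_nonneg[OF \<chi>] that by (simp add: r_def)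
  have r1: "r 1 = 1" using divisor_sum_mult(1)[OF \<chi>] by (simp add: r_def)
  have big: "t ^ 114 \<ge> 10 ^ 10"
  proof -
    have "(10::real) ^ 10 \<le> (46 / 10) ^ 16" by (simp add: power_divide)
    also have "\<dots> \<le> t ^ 16" using t(2) by (intro power_mono) auto
    also have "\<dots> \<le> t ^ 114" using t1 by (intro power_increasing) auto
    finally show ?thesis .
  qed
  have t2: "t\<^sup>2 \<ge> 2116 / 100" using power_mono[OF t(2), of 2] by (simp add: power_divide)
  define D where "D = (\<Sum>a=1..X. \<chi> a / real a)"
  define l where "l = D + 6 * sqrt (real m / real X)"
  let ?R = "\<lambda>n. \<Sum>k=1..n. r k"
  have asym: "\<bar>?R n - real n * D\<bar> \<le> 5 * sqrt (real m * real n)" if "m \<le> n" "n \<le> X" for n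
    unfolding r_def D_def by (rule divisor_sum_asymptotic[OF cmult_funD(4)[OF \<chi>] S m1 that])
  have lpos: "l > 0"
  proof -
    have "real X * sqrt (real m / real X) = sqrt ((real X)\<^sup>2 * (real m / real X))"
      by (simp add: real_sqrt_mult real_sqrt_divide)
    also have "(real X)\<^sup>2 * (real m / real X) = real m * real X"
      using X1 by (simp add: power2_eq_square)
    finally have s: "real X * sqrt (real m / real X) = sqrt (real m * real X)" .
    have "?R X \<ge> 0" using r0 by (intro sum_nonneg) auto
    then have "real X * D \<ge> - 5 * sqrt (real m * real X)" using asym[OF mX] by linarith
    then have "real X * l \<ge> sqrt (real m * real X)" using s by (simp add: l_def distrib_left)
    moreover have "sqrt (real m * real X) > 0" using m1 X1 by simp
    ultimately have "real X * l > 0" by linarith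
    then show ?thesis using X1 by (simp add: zero_less_mult_iff)
  qed
  \<comment> \<open>11 collects 5 from the hyperbola error and 6 from the summand added to
    \<open>D\<close>.\<close>
  have lR: "\<bar>?R n - l * real n\<bar> \<le> 11 * sqrt (real m) * sqrt (real n)" if n: "m \<le> n" "n \<le> X" for n
  proof -
    have "real n = sqrt (real n) * sqrt (real n)" by simp
    also have "\<dots> \<le> sqrt (real n) * sqrt (real X)" using n by (intro mult_left_mono) auto
    finally have "real n / sqrt (real X) \<le> sqrt (real n)" using X1 by (simp add: field_simps)
    then have "sqrt (real m) * (real n / sqrt (real X)) \<le> sqrt (real m) * sqrt (real n)" by (intro mult_left_mono) auto
    then have "real n * sqrt (real m / real X) \<le> sqrt (real m) * sqrt (real n)"
      by (simp add: real_sqrt_divide mult.commute)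
    moreover have "real n * sqrt (real m / real X) \<ge> 0" by simp
    moreover have "l * real n = real n * D + 6 * (real n * sqrt (real m / real X))" by (simp add: l_def algebra_simps)
    moreover have "sqrt (real m * real n) = sqrt (real m) * sqrt (real n)" by (rule real_sqrt_mult)
    ultimately show ?thesis using asym[OF n] by linarith
  qed
  have lt6: "l \<le> 121 / 100 / t ^ 6"
  proof -
    have "l * (real m)\<^sup>2 \<le> ?R (m\<^sup>2) + 11 * sqrt (real m) * real m"
      using lR[OF mm X] by simp
    also have "\<dots> \<le> 6 / 5 / t ^ 6 * (real m)\<^sup>2 + 11 * sqrt (real m) * real m" using R by (simp add: r_def)
    also have "11 * sqrt (real m) * real m = 11 / t ^ 120 * (real m)\<^sup>2"
      unfolding sm unfolding t(1) using t1 by (simp add: field_simps power2_eq_square flip: power_add)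
    finally have "l * (real m)\<^sup>2 \<le> (6 / 5 / t ^ 6 + 11 / t ^ 120) * (real m)\<^sup>2" by (simp add: distrib_right)
    then have "l \<le> 6 / 5 / t ^ 6 + 11 / t ^ 120" using m1 by simp
    also have "11 / t ^ 120 \<le> 1 / 100 / t ^ 6"
    proof -
      have "(1100::real) \<le> 10 ^ 10" by simp
      then have "1100 \<le> t ^ 114" using big by linarith
      then have "1100 * t ^ 6 \<le> t ^ 114 * t ^ 6" using t1 by (intro mult_right_mono) auto
      then show ?thesis using t1 by (simp add: field_simps flip: power_add)
    qed
    finally show ?thesis by simp
  qed
  have t6: "t ^ 6 \<ge> 9000"
  proof -
    have "(9000::real) \<le> (46 / 10) ^ 6" by (simp add: power_divide)
    also have "\<dots> \<le> t ^ 6" using t(2) by (intro power_mono) auto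
    finally show ?thesis .
  qed
  have l1: "l \<le> 1"
  proof -
    have "121 / 100 / t ^ 6 \<le> 121 / 100 / 9000" using t6 by (intro divide_left_mono) auto
    then show ?thesis using lt6 by simp
  qed
  \<comment> \<open>At 3/2 l the main term up to m^2 is below 2/3 * 1.17, whereas the term n = 1
    alone makes \<open>P\<close> at least 1; this gives one sign for the intermediate value theorem.
    Moreover 1815 / 1000 = 3/2 * 121 / 100.\<close>
  define \<eta>0 where "\<eta>0 = 3 / 2 * l"
  have \<eta>0: "\<eta>0 > 0" "\<eta>0 \<le> 1815 / 1000 / t ^ 6"
    using lpos lt6 by (simp_all add: \<eta>0_def)
  have \<eta>0': "\<eta>0 \<le> 1 / 100"
  proof -
    have "1815 / 1000 / t ^ 6 \<le> 1815 / 1000 / 9000" using t6 by (intro divide_left_mono) auto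
    then show ?thesis using \<eta>0(2) by simp
  qed
  define Z where "Z = m\<^sup>2"
  have Z: "m \<le> Z" "Z \<le> X" "real Z = (real m)\<^sup>2" "1 \<le> Z" using mm X m1 by (auto simp: Z_def)
  \<comment> \<open>\<eta> is of order t^-6 and log m at most of order t^4, so \<eta> log (m^2) is
    of order t^-2 and the power stays near 1.\<close>
  have Zpow: "real Z powr \<eta> \<le> 116 / 100" if "0 < \<eta>" "\<eta> \<le> \<eta>0" for \<eta>
  proof -
    have "\<eta> * ln (real Z) = \<eta> * (2 * ln (real m))" using m1 by (simp add: Z(3) ln_realpow)
    also have "\<dots> \<le> (1815 / 1000 / t ^ 6) * (2 * (797 / 1000 * t ^ 4))"
      using that \<eta>0 t m1 by (intro mult_mono) auto
    also have "\<dots> = 2 * (1815 / 1000) * (797 / 1000) / t\<^sup>2"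
      using t1 by (simp add: field_simps flip: power_add)
    also have "\<dots> \<le> 2 * (1815 / 1000) * (797 / 1000) / (2116 / 100)"
      using t2 by (intro divide_left_mono) auto
    also have "\<dots> \<le> 137 / 1000" by simp
    finally have "real Z powr \<eta> \<le> exp (137 / 1000)" using Z(4) by (simp add: powr_def)
    also have "\<dots> \<le> 1 / (1 - 137 / 1000)" by (rule exp_le_inverse) simp
    also have "\<dots> \<le> 116 / 100" by simp
    finally show ?thesis .
  qed
  have inc: "\<bar>P \<eta> X - P \<eta> Y - l * (real X powr \<eta> - real Y powr \<eta>) / \<eta>\<bar> \<le> 56 * sqrt (real m) * real Y powr (\<eta> - 1 / 2)"
    if \<eta>: "0 < \<eta>" "\<eta> \<le> 1 / 100" and Y: "m \<le> Y" "Y \<le> X" for \<eta> Y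
  proof -
    have Y1: "1 \<le> Y" using Y m1 by linarith
    have k0: "11 * sqrt (real m) \<ge> 0" by simp
    have RR: "\<bar>(\<Sum>k=1..n. r k) - l * real n\<bar> \<le> 11 * sqrt (real m) * sqrt (real n)" if "Y \<le> n" "n \<le> X" for n
      by (rule lR) (use that Y in linarith)+
    have "\<bar>P \<eta> X - P \<eta> Y - l * (real X powr \<eta> - real Y powr \<eta>) / \<eta>\<bar>
        \<le> 5 * (11 * sqrt (real m)) * real Y powr (\<eta> - 1 / 2) + l * real Y powr (\<eta> - 1)"
      unfolding P_def r_def[symmetric]
      by (rule weighted_divisor_sum_increment[OF \<eta> Y1 Y(2) k0 less_imp_le[OF lpos] RR])
    also have "l * real Y powr (\<eta> - 1) \<le> sqrt (real m) * real Y powr (\<eta> - 1 / 2)"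
      using l1 lpos m1 Y1 by (intro mult_mono powr_mono) (auto intro: order.trans[of l 1])
    finally show ?thesis by simp
  qed
  have Zerr: "56 * sqrt (real m) * real Z powr (\<eta> - 1 / 2) \<le> 1 / 100" if "0 < \<eta>" "\<eta> \<le> \<eta>0" for \<eta>
  proof -
    have "real Z powr (\<eta> - 1 / 2) = real Z powr \<eta> / real m"
      using m1 by (simp add: powr_diff powr_half_sqrt Z(3))
    also have "\<dots> \<le> (116 / 100) / real m" using Zpow[OF that] by (intro divide_right_mono) auto
    finally have "56 * sqrt (real m) * real Z powr (\<eta> - 1 / 2) \<le> 56 * sqrt (real m) * ((116 / 100) / real m)"
      by (intro mult_left_mono) auto
    also have "\<dots> = 56 * (116 / 100) / t ^ 120"
      unfolding sm unfolding t(1) using t1 by (simp add: field_simps flip: power_add)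
    also have "\<dots> \<le> 56 * (116 / 100) / 10 ^ 10"
    proof (intro divide_left_mono)
      show "10 ^ 10 \<le> t ^ 120" using big power_increasing[of 114 120 t] t1 by linarith
    qed (use t1 in auto)
    also have "\<dots> \<le> 1 / 100" by simp
    finally show ?thesis .
  qed
  define g where "g \<eta> = P \<eta> X - l * real X powr \<eta> / \<eta>" for \<eta>
  have P1: "P \<eta> N \<ge> 1" if "N \<ge> 1" for \<eta> N
  proof -
    have "(\<Sum>n\<in>{1}. r n * real n powr (\<eta> - 1)) \<le> (\<Sum>n=1..N. r n * real n powr (\<eta> - 1))"
      by (rule sum_mono2) (use that r0 in auto)
    then show ?thesis using r1 by (simp add: P_def r_def)
  qed
  have g0: "g \<eta>0 \<ge> 0"
  proof -
    have "l * real Z powr \<eta>0 / \<eta>0 = 2 / 3 * real Z powr \<eta>0" using lpos by (simp add: \<eta>0_def)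
    also have "\<dots> \<le> 2 / 3 * (116 / 100)" using Zpow[OF \<eta>0(1)] by (intro mult_left_mono) auto
    finally have "l * real Z powr \<eta>0 / \<eta>0 \<le> 78 / 100" by simp
    moreover have "l * (real X powr \<eta>0 - real Z powr \<eta>0) / \<eta>0 = l * real X powr \<eta>0 / \<eta>0 - l * real Z powr \<eta>0 / \<eta>0"
      by (simp add: right_diff_distrib diff_divide_distrib)
    moreover have "P \<eta>0 Z \<ge> 1" by (rule P1[OF Z(4)])
    ultimately show ?thesis
      using inc[OF \<eta>0(1) \<eta>0' Z(1,2)] Zerr[OF \<eta>0(1)] unfolding g_def by linarith
  qed
  \<comment> \<open>Here l / \<eta>1 alone exceeds the unweighted sum \<open>?R X\<close>, which
    dominates \<open>P\<close>; this gives the opposite sign.\<close>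
  define \<eta>1 where "\<eta>1 = l / (?R X + 2)"
  have RX: "?R X \<ge> 0" using r0 by (intro sum_nonneg) auto
  have \<eta>1: "\<eta>1 > 0" "\<eta>1 \<le> \<eta>0"
  proof -
    show "\<eta>1 > 0" using lpos RX by (simp add: \<eta>1_def)
    have "\<eta>1 \<le> l / 1" unfolding \<eta>1_def using lpos RX by (intro divide_left_mono) auto
    then show "\<eta>1 \<le> \<eta>0" using lpos by (simp add: \<eta>0_def)
  qed
  have g1: "g \<eta>1 \<le> 0"
  proof -
    have "P \<eta>1 X \<le> ?R X"
      unfolding P_def r_def[symmetric]
    proof (rule sum_mono)
      fix n assume n: "n \<in> {1..X}"
      have "real n powr (\<eta>1 - 1) \<le> real n powr 0" using n \<eta>1 \<eta>0' by (intro powr_mono) auto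
      then have "r n * real n powr (\<eta>1 - 1) \<le> r n * 1" using r0[of n] n by (intro mult_left_mono) auto
      then show "r n * real n powr (\<eta>1 - 1) \<le> r n" by simp
    qed
    moreover have "l * real X powr \<eta>1 / \<eta>1 \<ge> ?R X + 2"
    proof -
      have "real X powr \<eta>1 \<ge> 1" using X1 \<eta>1 by (intro ge_one_powr_ge_zero) auto
      then have "l * 1 / \<eta>1 \<le> l * real X powr \<eta>1 / \<eta>1" using lpos \<eta>1 by (intro divide_right_mono mult_left_mono) auto
      moreover have "l * 1 / \<eta>1 = ?R X + 2" using lpos RX by (simp add: \<eta>1_def)
      ultimately show ?thesis by simp
    qed
    ultimately show ?thesis unfolding g_def by linarith
  qed
  have "continuous_on {\<eta>1..\<eta>0} g"
    unfolding g_def P_def using \<eta>1 X1 by (intro continuous_intros) auto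
  then obtain \<eta> where \<eta>: "\<eta>1 \<le> \<eta>" "\<eta> \<le> \<eta>0" "g \<eta> = 0"
    using IVT'[of g \<eta>1 0 \<eta>0] g0 g1 \<eta>1(2) by blast
  have \<eta>pos: "0 < \<eta>" "\<eta> \<le> 1 / 100" using \<eta> \<eta>1 \<eta>0' by linarith+
  have est: "\<bar>P \<eta> Y - l / \<eta> * real Y powr \<eta>\<bar> \<le> 56 * sqrt (real m) * real Y powr (\<eta> - 1 / 2)" if "m \<le> Y" "Y \<le> X" for Y
  proof -
    have "l * (real X powr \<eta> - real Y powr \<eta>) / \<eta> = l * real X powr \<eta> / \<eta> - l / \<eta> * real Y powr \<eta>"
      by (simp add: right_diff_distrib diff_divide_distrib)
    then show ?thesis using inc[OF \<eta>pos that] \<eta>(3) unfolding g_def by linarith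
  qed
  \<comment> \<open>Evaluated at Z = m^2, where Z^\<eta> is near 1: \<open>P\<close> is at most
    21/10 * 116/100 and the error at most 1/100, in total below 49 / 20.\<close>
  have "l / \<eta> \<le> 49 / 20"
  proof -
    have "l / \<eta> * 1 \<le> l / \<eta> * real Z powr \<eta>"
      using lpos \<eta>pos Z(4) by (intro mult_left_mono ge_one_powr_ge_zero) auto
    also have "\<dots> \<le> P \<eta> Z + 1 / 100" using est[OF Z(1,2)] Zerr[OF \<eta>pos(1) \<eta>(2)] by linarith
    also have "P \<eta> Z \<le> (\<Sum>n=1..Z. r n / real n * real Z powr \<eta>)"
      unfolding P_def r_def[symmetric]
    proof (rule sum_mono)
      fix n assume n: "n \<in> {1..Z}"
      have "real n powr (\<eta> - 1) = real n powr \<eta> / real n" using n by (simp add: powr_diff)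
      also have "\<dots> \<le> real Z powr \<eta> / real n" using n \<eta>pos by (intro divide_right_mono powr_mono2) auto
      finally have "r n * real n powr (\<eta> - 1) \<le> r n * (real Z powr \<eta> / real n)" using r0[of n] n by (intro mult_left_mono) auto
      then show "r n * real n powr (\<eta> - 1) \<le> r n / real n * real Z powr \<eta>" by simp
    qed
    also have "\<dots> = (\<Sum>n=1..Z. r n / real n) * real Z powr \<eta>" by (simp add: sum_distrib_right)
    also have "\<dots> \<le> 21 / 10 * (116 / 100)"
      using p Zpow[OF \<eta>pos(1) \<eta>(2)] by (intro mult_mono) (auto simp: r_def Z_def)
    finally show ?thesis by linarith
  qed
  moreover have "\<eta> \<le> 1815 / 1000 / t ^ 6" using \<eta>(2) \<eta>0(2) by linarith
  ultimately show ?thesis using that[OF \<eta>pos(1) _ lpos l1] est by blast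
qed

lemma powr_div_close:
  fixes X k U V :: nat and \<eta> :: real
  assumes X: "X = U * V" and k: "1 \<le> k" "k \<le> U" and V: "1 \<le> V" and \<eta>: "0 < \<eta>" "\<eta> \<le> 1"
  shows "V \<le> X div k" "\<bar>real (X div k) powr \<eta> - (real X / real k) powr \<eta>\<bar> \<le> \<eta> * real V powr (\<eta> - 1)"
proof -
  define N where "N = X div k"
  have "V = (k * V) div k" using k by simp
  also have "\<dots> \<le> N" unfolding N_def X using k by (intro div_le_mono mult_right_mono) auto
  finally show VN: "V \<le> X div k" by (simp add: N_def)
  have N: "real N \<le> real X / real k" "real X / real k \<le> real N + 1"
  proof -
    show "real N \<le> real X / real k" unfolding N_def by (rule of_nat_div_le_of_nat)
    have "real X < (real N + 1) * real k"
      using dividend_less_div_times[of k X] k by (simp add: N_def distrib_right flip: of_nat_mult of_nat_add)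
    then show "real X / real k \<le> real N + 1" using k by (simp add: field_simps)
  qed
  have N1: "real N > 0" using VN V by (simp add: N_def)
  obtain z where z: "real N < z" "(real N + 1) powr \<eta> - real N powr \<eta> = \<eta> * z powr (\<eta> - 1)"
    using powr_diff_mvt[OF N1] by blast
  have "z powr (\<eta> - 1) \<le> real V powr (\<eta> - 1)"
    using z(1) VN V \<eta> by (intro powr_mono2') (auto simp: N_def)
  then have "(real N + 1) powr \<eta> - real N powr \<eta> \<le> \<eta> * real V powr (\<eta> - 1)"
    unfolding z(2) using \<eta> by (intro mult_left_mono) auto
  moreover have "real N powr \<eta> \<le> (real X / real k) powr \<eta>" using N \<eta> by (intro powr_mono2) auto
  moreover have "(real X / real k) powr \<eta> \<le> (real N + 1) powr \<eta>"
    using N(2) \<eta> by (intro powr_mono2) auto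
  ultimately show "\<bar>real (X div k) powr \<eta> - (real X / real k) powr \<eta>\<bar> \<le> \<eta> * real V powr (\<eta> - 1)"
    unfolding N_def by linarith
qed

text \<open>The convolution of \<open>h\<close> and \<open>r\<close> has the Dirichlet series \<open>\<zeta>(s) L(s, \<chi>\<^sub>1) L(s, \<chi>\<^sub>2) L(s, \<chi>\<^sub>1\<chi>\<^sub>2)\<close>, with nonnegative coefficients; its
  partial sum at \<open>s = 1 - \<eta>\<close> is estimated by the hyperbola method.\<close>

lemma four_fold_weighted_sum:
  fixes \<chi>1 \<chi>2 :: "nat \<Rightarrow> real" and \<eta> l :: real
  defines "r \<equiv> divisor_sum \<chi>1" and "h \<equiv> \<lambda>n. \<chi>2 n * divisor_sum \<chi>1 n"
  defines "P \<equiv> \<lambda>N. \<Sum>n=1..N. r n * real n powr (\<eta> - 1)"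
  assumes \<chi>1: "cmult_fun \<chi>1" and \<chi>2: "cmult_fun \<chi>2"
    and S2: "\<And>n. \<bar>\<Sum>a=1..n. \<chi>2 a\<bar> \<le> real m2"
    and S12: "\<And>n. \<bar>\<Sum>a=1..n. \<chi>1 a * \<chi>2 a\<bar> \<le> real m1 * real m2"
    and m: "1 \<le> m1" "m1 \<le> V" "V \<le> U" "56 * sqrt (real m1) \<le> sqrt (real V)"
    and \<eta>: "0 < \<eta>" "\<eta> \<le> 1 / 100" and l: "0 < l" "l \<le> 1" "l / \<eta> \<le> 49 / 20"
    and P: "\<And>Y. m1 \<le> Y \<Longrightarrow> Y \<le> U * V \<Longrightarrow>
      \<bar>P Y - l / \<eta> * real Y powr \<eta>\<bar> \<le> 56 * sqrt (real m1) * real Y powr (\<eta> - 1 / 2)"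
  shows "1 \<le> l / \<eta> * real (U * V) powr \<eta> * \<bar>\<Sum>k=1..U. h k / real k\<bar>
    + 7 / 2 * real U powr \<eta> * (57 * sqrt (real m1) * real V powr (\<eta> - 1 / 2))
    + 7 / 2 * real V powr \<eta> * (15 * real m2 * sqrt (real m1) * real U powr (\<eta> - 1 / 2))"
proof -
  define X where "X = U * V"
  define c where "c = l / \<eta>"
  define e where "e = 57 * sqrt (real m1) * real V powr (\<eta> - 1 / 2)"
  define G where "G k = h k * real k powr (\<eta> - 1)" for k
  define F where "F j = r j * real j powr (\<eta> - 1)" for j
  have c: "0 < c" "c \<le> 49 / 20" "c * \<eta> = l" using \<eta> l by (simp_all add: c_def)
  have V1: "1 \<le> V" "1 \<le> U" using m by linarith+
  have UX: "U \<le> X" "V \<le> X" using V1 by (simp_all add: X_def)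
  have r0: "r n \<ge> 0" if "n \<ge> 1" for n using divisor_sum_nonneg[OF \<chi>1] that by (simp add: r_def)
  have hr: "\<bar>h n\<bar> \<le> r n" if "n \<ge> 1" for n
    using mult_right_mono[OF cmult_funD(4)[OF \<chi>2, of n] r0[OF that]] r0[OF that]
    by (simp add: h_def r_def abs_mult)
  have F0: "F n \<ge> 0" if "n \<ge> 1" for n using r0[OF that] by (simp add: F_def)
  have PF: "P N = (\<Sum>n=1..N. F n)" for N by (simp add: P_def F_def)
  \<comment> \<open>7 / 2 rounds up 49 / 20 + 1; the error term is absorbed by one more Y^\<eta>,
    which is what the assumption on 56 sqrt m1 is for.\<close>
  have Pup: "P Y \<le> 7 / 2 * real Y powr \<eta>" if Y: "V \<le> Y" "Y \<le> X" for Y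
  proof -
    have Y1: "real Y \<ge> 1" using Y V1 by simp
    have "56 * sqrt (real m1) \<le> sqrt (real Y)" using m(4) Y by (meson of_nat_mono order.trans real_sqrt_le_mono)
    then have "56 * sqrt (real m1) * real Y powr (\<eta> - 1 / 2) \<le> sqrt (real Y) * real Y powr (\<eta> - 1 / 2)"
      by (intro mult_right_mono) auto
    also have "\<dots> = real Y powr \<eta>" using Y1 by (simp add: powr_diff powr_half_sqrt)
    finally have "P Y \<le> c * real Y powr \<eta> + real Y powr \<eta>"
      using P[of Y] Y m by (simp add: c_def X_def)
    moreover have "c * real Y powr \<eta> \<le> 49 / 20 * real Y powr \<eta>" using c by (intro mult_right_mono) auto
    moreover have "real Y powr \<eta> \<ge> 0" by simp
    ultimately show ?thesis by linarith
  qed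
  have Pdiv: "\<bar>P (X div k) - c * (real X / real k) powr \<eta>\<bar> \<le> e" if k: "k \<in> {1..U}" for k
  proof -
    define N where "N = X div k"
    have \<eta>1: "\<eta> \<le> 1" using \<eta> by simp
    have k': "1 \<le> k" "k \<le> U" using k by auto
    note d = powr_div_close[OF X_def k' V1(1) \<eta>(1) \<eta>1, folded N_def]
    have N: "m1 \<le> N" "N \<le> U * V" using d(1) m(2) by (auto simp: N_def X_def)
    have "\<bar>c * real N powr \<eta> - c * (real X / real k) powr \<eta>\<bar> = c * \<bar>real N powr \<eta> - (real X / real k) powr \<eta>\<bar>"
      using c(1) by (simp add: abs_mult flip: right_diff_distrib)
    also have "\<dots> \<le> c * (\<eta> * real V powr (\<eta> - 1))" using d(2) c by (intro mult_left_mono) auto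
    also have "\<dots> = l * real V powr (\<eta> - 1)" using c(3) by (simp flip: mult.assoc)
    also have "\<dots> \<le> sqrt (real m1) * real V powr (\<eta> - 1 / 2)"
    proof (intro mult_mono powr_mono)
      show "l \<le> sqrt (real m1)" using l(2) m(1) by (simp add: order.trans[of l 1])
    qed (use V1 l in auto)
    finally have 1: "\<bar>c * real N powr \<eta> - c * (real X / real k) powr \<eta>\<bar> \<le> sqrt (real m1) * real V powr (\<eta> - 1 / 2)" .
    have "real N powr (\<eta> - 1 / 2) \<le> real V powr (\<eta> - 1 / 2)"
      using d(1) V1 \<eta> by (intro powr_mono2') auto
    then have "56 * sqrt (real m1) * real N powr (\<eta> - 1 / 2) \<le> 56 * sqrt (real m1) * real V powr (\<eta> - 1 / 2)"
      by (intro mult_left_mono) auto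
    then have "\<bar>P N - c * real N powr \<eta>\<bar> \<le> 56 * sqrt (real m1) * real V powr (\<eta> - 1 / 2)"
      using P[OF N] by (simp add: c_def)
    then show ?thesis using 1 unfolding N_def[symmetric] e_def by linarith
  qed
  have dc: "dconv G F n = dconv h r n * real n powr (\<eta> - 1)" if "n \<ge> 1" for n
    unfolding dconv_def sum_distrib_right
  proof (intro sum.cong refl)
    fix d assume d: "d \<in> {d. d dvd n}"
    have "real n = real d * real (n div d)" using d by (metis dvd_mult_div_cancel mem_Collect_eq of_nat_mult)
    then have "real n powr (\<eta> - 1) = real d powr (\<eta> - 1) * real (n div d) powr (\<eta> - 1)"
      by (simp add: powr_mult)
    then show "G d * F (n div d) = h d * r (n div d) * real n powr (\<eta> - 1)"
      by (simp add: G_def F_def)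
  qed
  note ff = four_fold_convolution_nonneg[OF \<chi>1 \<chi>2, folded h_def r_def]
  have "1 = (\<Sum>n\<in>{1}. dconv G F n)" using dc[of 1] ff(1) by simp
  \<comment> \<open>Nonnegativity of the coefficients makes the single term n = 1 a lower bound for
    the whole sum.\<close>
  also have "\<dots> \<le> (\<Sum>n=1..X. dconv G F n)"
    by (rule sum_mono2) (use UX V1 dc ff(2) in auto)
  also have "\<dots> = (\<Sum>k=1..U. G k * (\<Sum>j=1..X div k. F j))
      + (\<Sum>j=1..X div (U + 1). F j * ((\<Sum>k=1..X div j. G k) - (\<Sum>k=1..U. G k)))"
    by (rule dirichlet_hyperbola[OF UX(1)])
  finally have main: "1 \<le> (\<Sum>k=1..U. G k * P (X div k))
      + (\<Sum>j=1..X div (U + 1). F j * ((\<Sum>k=1..X div j. G k) - (\<Sum>k=1..U. G k)))"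
    unfolding PF .
  have T1: "(\<Sum>k=1..U. G k * P (X div k)) \<le> c * real X powr \<eta> * \<bar>\<Sum>k=1..U. h k / real k\<bar> + 7 / 2 * real U powr \<eta> * e"
  proof -
    have "G k * P (X div k) \<le> c * real X powr \<eta> * (h k / real k) + F k * e" if k: "k \<in> {1..U}" for k
    proof -
      have GF: "\<bar>G k\<bar> \<le> F k"
        using hr[of k] k by (auto simp: G_def F_def abs_mult intro!: mult_right_mono)
      \<comment> \<open>The powers of k from the weight and from the main term of P combine to 1 /
        k, so the twisted sum appears at s = 1, where L(1, \<chi>2) controls it, although the
        weights belong to s = 1 - \<eta>.\<close>
      have "G k * (c * (real X / real k) powr \<eta>) = c * real X powr \<eta> * (h k / real k)"
        using k by (simp add: G_def powr_divide powr_diff field_simps)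
      moreover have "G k * (P (X div k) - c * (real X / real k) powr \<eta>) \<le> F k * e"
      proof -
        have "G k * (P (X div k) - c * (real X / real k) powr \<eta>) \<le> \<bar>G k\<bar> * \<bar>P (X div k) - c * (real X / real k) powr \<eta>\<bar>"
          by (metis abs_ge_self abs_mult)
        also have "\<dots> \<le> F k * e" using GF Pdiv[OF k] F0[of k] k by (intro mult_mono) auto
        finally show ?thesis .
      qed
      ultimately show ?thesis by (simp add: right_diff_distrib)
    qed
    then have "(\<Sum>k=1..U. G k * P (X div k)) \<le> (\<Sum>k=1..U. c * real X powr \<eta> * (h k / real k) + F k * e)"
      by (rule sum_mono)
    also have "\<dots> = c * real X powr \<eta> * (\<Sum>k=1..U. h k / real k) + P U * e"
      by (simp add: sum.distrib sum_distrib_left sum_distrib_right PF)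
    also have "\<dots> \<le> c * real X powr \<eta> * \<bar>\<Sum>k=1..U. h k / real k\<bar> + 7 / 2 * real U powr \<eta> * e"
      using c Pup[OF m(3) UX(1)] by (intro add_mono mult_left_mono mult_right_mono) (auto simp: e_def)
    finally show ?thesis .
  qed
  have T2: "(\<Sum>j=1..X div (U + 1). F j * ((\<Sum>k=1..X div j. G k) - (\<Sum>k=1..U. G k)))
      \<le> 7 / 2 * real V powr \<eta> * (15 * real m2 * sqrt (real m1) * real U powr (\<eta> - 1 / 2))"
  proof -
    let ?b = "15 * real m2 * sqrt (real m1) * real U powr (\<eta> - 1 / 2)"
    have "F j * ((\<Sum>k=1..X div j. G k) - (\<Sum>k=1..U. G k)) \<le> F j * ?b" if j: "j \<in> {1..X div (U + 1)}" for j
    proof (rule mult_left_mono)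
      have "j * (U + 1) \<le> X" using j by (simp add: less_eq_div_iff_mult_less_eq)
      then have "U * j \<le> X" by (simp add: algebra_simps)
      then have UN: "U \<le> X div j" using j by (simp add: less_eq_div_iff_mult_less_eq)
      have hb: "\<bar>\<Sum>k=1..n. h k\<bar> \<le> 3 * real m2 * sqrt (real m1) * sqrt (real n)" if "U \<le> n" for n
      proof -
        have "m1 \<le> n" using that m by linarith
        moreover have "\<bar>\<chi>1 n * \<chi>2 n\<bar> \<le> 1" for n
          using mult_mono[OF cmult_funD(4)[OF \<chi>1, of n] cmult_funD(4)[OF \<chi>2, of n]] by (simp add: abs_mult)
        ultimately have "\<bar>\<Sum>n=1..n. \<chi>2 n * divisor_sum \<chi>1 n\<bar> \<le> 3 * real m2 * sqrt (real m1 * real n)"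
          using twisted_divisor_sum_bound[OF \<chi>2 _ S2 S12 m(1)] by blast
        then show ?thesis by (simp add: h_def real_sqrt_mult)
      qed
      have \<eta>0: "0 \<le> \<eta>" using \<eta> by simp
      \<comment> \<open>15 = 5 * 3: partial summation costs 5, and 3 is the constant in the bound
        for the partial sums of \<open>h\<close>.\<close>
      have "\<bar>\<Sum>k=Suc U..X div j. h k * real k powr (\<eta> - 1)\<bar> \<le> 5 * (3 * real m2 * sqrt (real m1)) * real U powr (\<eta> - 1 / 2)"
        by (rule abel_sqrt[OF \<eta>0 \<eta>(2) V1(2) UN _ hb]) auto
      then show "(\<Sum>k=1..X div j. G k) - (\<Sum>k=1..U. G k) \<le> ?b"
        using sum_tail_split[OF UN, of G] by (simp add: G_def)
      show "0 \<le> F j" using F0 j by simp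
    qed
    then have "(\<Sum>j=1..X div (U + 1). F j * ((\<Sum>k=1..X div j. G k) - (\<Sum>k=1..U. G k))) \<le> (\<Sum>j=1..X div (U + 1). F j * ?b)"
      by (rule sum_mono)
    also have "\<dots> = (\<Sum>j=1..X div (U + 1). F j) * ?b" by (rule sum_distrib_right[symmetric])
    also have "\<dots> \<le> P V * ?b"
    proof (rule mult_right_mono)
      have "X div (U + 1) \<le> X div U" using V1 by (intro div_le_mono2) auto
      also have "\<dots> = V" using V1 by (simp add: X_def)
      finally show "(\<Sum>j=1..X div (U + 1). F j) \<le> P V" unfolding PF by (intro sum_mono2) (auto intro: F0)
    qed simp
    also have "\<dots> \<le> 7 / 2 * real V powr \<eta> * ?b" using Pup[OF order.refl UX(2)] by (intro mult_right_mono) auto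
    finally show ?thesis .
  qed
  show ?thesis using main T1 T2 unfolding c_def e_def X_def by linarith
qed

text \<open>All that the comparison of two exceptional moduli uses about each of them: the period
  survives as the bound \<open>S\<close>, the scarcity of primes with value 1 as the small mean
  \<open>R\<close> and the bounded weighted sum \<open>p\<close>.\<close>

locale sparse_divisor_sum =
  fixes \<chi> :: "nat \<Rightarrow> real" and m :: nat and t :: real
  assumes \<chi>: "cmult_fun \<chi>"
    and S: "\<And>n. \<bar>\<Sum>a=1..n. \<chi> a\<bar> \<le> real m"
    and t: "real m = t ^ 240" "t \<ge> 46 / 10" "t ^ 3 \<ge> 100" "ln (real m) \<le> 797 / 1000 * t ^ 4"
    and R: "(\<Sum>n=1..m\<^sup>2. divisor_sum \<chi> n) \<le> 6 / 5 / t ^ 6 * (real m)\<^sup>2"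
    and p: "(\<Sum>n=1..m\<^sup>2. divisor_sum \<chi> n / real n) \<le> 21 / 10"
begin

lemma t_power_ge: "t ^ j \<ge> 1" "t ^ (3 * j) \<ge> 100 ^ j"
  using t(2) power_mono[OF t(3), of j] by (simp_all flip: power_mult)

lemma m_ge_1: "1 \<le> m"
  using t(1) t_power_ge(1)[of 240] by simp

lemma sqrt_m: "sqrt (real m) = t ^ 120"
  unfolding t(1) by (rule real_sqrt_unique) (use t(2) in \<open>simp_all flip: power_mult\<close>)

text \<open>At length m^2 the hyperbola error is relatively of size 5 / t^120, so the truncated L(1,
  \<chi>) nearly equals the mean of the divisor sum, which is bounded above by \<open>R\<close> and
  below by nonnegativity.\<close>

lemma abs_L_partial_sum_le:
  assumes "m\<^sup>2 \<le> X"
  shows "\<bar>\<Sum>a=1..X. \<chi> a / real a\<bar> \<le> 121 / 100 / t ^ 6"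
proof -
  let ?D = "\<Sum>a=1..X. \<chi> a / real a" and ?R = "\<Sum>n=1..m\<^sup>2. divisor_sum \<chi> n"
  have m0: "real m > 0" using m_ge_1 by simp
  have "m \<le> m\<^sup>2" by (simp add: power2_eq_square)
  then have "\<bar>?R - real (m\<^sup>2) * ?D\<bar> \<le> 5 * sqrt (real m * real (m\<^sup>2))"
    by (intro divisor_sum_asymptotic cmult_funD(4)[OF \<chi>] S m_ge_1 assms)
  also have "sqrt (real m * real (m\<^sup>2)) = t ^ 120 * real m" by (simp add: real_sqrt_mult sqrt_m)
  also have "5 * (t ^ 120 * real m) = 5 / t ^ 120 * (real m)\<^sup>2"
    unfolding t(1) using t(2) by (simp add: field_simps flip: power_mult power_add)
  finally have 1: "\<bar>?R - (real m)\<^sup>2 * ?D\<bar> \<le> 5 / t ^ 120 * (real m)\<^sup>2" by simp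
  have "?R \<ge> 0" using divisor_sum_nonneg[OF \<chi>] by (intro sum_nonneg) auto
  then have "(real m)\<^sup>2 * \<bar>?D\<bar> \<le> (6 / 5 / t ^ 6 + 5 / t ^ 120) * (real m)\<^sup>2"
    using 1 R by (simp add: abs_mult distrib_right flip: abs_mult[of "(real m)\<^sup>2", simplified])
  then have "\<bar>?D\<bar> \<le> 6 / 5 / t ^ 6 + 5 / t ^ 120" using m0 by (simp add: mult.commute)
  also have "5 / t ^ 120 \<le> 1 / 100 / t ^ 6"
  proof -
    have "(500::real) \<le> t ^ (3 * 38)" using t_power_ge(2)[of 38] by (rule order.trans[rotated]) simp
    then have "500 * t ^ 6 \<le> t ^ 114 * t ^ 6" using t(2) by (intro mult_right_mono) auto
    then show ?thesis using t(2) by (simp add: field_simps flip: power_add)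
  qed
  finally show ?thesis by simp
qed

end

lemma two_sparse_divisor_sums:
  assumes "sparse_divisor_sum \<chi>1 m1 t1" "sparse_divisor_sum \<chi>2 m2 t2"
    and S12: "\<And>n. \<bar>\<Sum>a=1..n. \<chi>1 a * \<chi>2 a\<bar> \<le> real m1 * real m2" and less: "m1 < m2"
  shows False
proof -
  interpret A: sparse_divisor_sum \<chi>1 m1 t1 by fact
  interpret B: sparse_divisor_sum \<chi>2 m2 t2 by fact
  define t where "t = t2"
  \<comment> \<open>These powers make both hyperbola errors negligible: sqrt m1 / sqrt V is at most
    t^-120 and m2 sqrt m1 / sqrt U at most t^-240.\<close>
  define U V X where "U = m2 ^ 5" and "V = m2\<^sup>2" and "X = m2 ^ 7"
  define L where "L = ln (real m2)"
  note t = B.t[folded t_def]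
  have t0: "t > 0" using t by simp
  have m: "1 \<le> m1" "1 \<le> m2" using A.m_ge_1 less by auto
  have X: "X = U * V" by (simp add: U_def V_def X_def flip: power_add)
  have sm1: "sqrt (real m1) \<le> t ^ 120" using less B.sqrt_m by (simp add: t_def flip: B.sqrt_m)
  have t100: "t ^ (3 * j) \<ge> 100 ^ j" for j using B.t_power_ge(2) by (simp add: t_def)
  have V: "m1 \<le> V" "V \<le> U" "m1\<^sup>2 \<le> U * V"
  proof -
    show "m1 \<le> V" using less m self_le_power[of m2 2] unfolding V_def by linarith
    show "V \<le> U" unfolding U_def V_def using m by (intro power_increasing) auto
    have "m1\<^sup>2 \<le> V" unfolding V_def using less by (intro power_mono) auto
    also have "\<dots> \<le> U * V" using m by (simp add: U_def)
    finally show "m1\<^sup>2 \<le> U * V" .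
  qed
  have reals: "real V = (t ^ 240)\<^sup>2" "real U = (t ^ 600)\<^sup>2" "real m2 = t ^ 240" "real X = t ^ 1680"
    unfolding U_def V_def X_def by (simp_all add: t(1) flip: power_mult)
  have sq: "sqrt (real V) = t ^ 240" "sqrt (real U) = t ^ 600"
    unfolding reals using t0 by (simp_all only: real_sqrt_abs abs_of_pos zero_less_power)
  have V56: "56 * sqrt (real m1) \<le> sqrt (real V)"
  proof -
    have "(56::real) \<le> t ^ (3 * 40)" by (rule order.trans[OF _ t100]) simp
    then have "56 * t ^ 120 \<le> t ^ 120 * t ^ 120" using t0 by (intro mult_right_mono) auto
    then show ?thesis unfolding sq using sm1 by (simp flip: power_add)
  qed
  obtain \<eta> l where \<eta>: "0 < \<eta>" "\<eta> \<le> 1815 / 1000 / t1 ^ 6" and l: "0 < l" "l \<le> 1" "l / \<eta> \<le> 49 / 20"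
    and P: "\<And>Y. m1 \<le> Y \<Longrightarrow> Y \<le> U * V \<Longrightarrow>
      \<bar>(\<Sum>n=1..Y. divisor_sum \<chi>1 n * real n powr (\<eta> - 1)) - l / \<eta> * real Y powr \<eta>\<bar>
        \<le> 56 * sqrt (real m1) * real Y powr (\<eta> - 1 / 2)"
    using exceptional_exponent[OF A.\<chi> A.S A.t(1,2,4) A.R A.p V(3)] by blast
  \<comment> \<open>Only an absolute bound is taken, from t1^6 \<ge> 10^4, since m1 may be far
    smaller than m2.\<close>
  have \<eta>': "\<eta> \<le> 1815 / 10000000"
  proof -
    have "t1 ^ 6 \<ge> 10000" using A.t_power_ge(2)[of 2] by simp
    then have "1815 / 1000 / t1 ^ 6 \<le> 1815 / 1000 / 10000" by (intro divide_left_mono) auto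
    then show ?thesis using \<eta>(2) by simp
  qed
  define H where "H = (\<Sum>k=1..U. \<chi>2 k * divisor_sum \<chi>1 k / real k)"
  have \<eta>100: "\<eta> \<le> 1 / 100" using \<eta>' by simp
  have ff: "1 \<le> l / \<eta> * real (U * V) powr \<eta> * \<bar>H\<bar>
    + 7 / 2 * real U powr \<eta> * (57 * sqrt (real m1) * real V powr (\<eta> - 1 / 2))
    + 7 / 2 * real V powr \<eta> * (15 * real m2 * sqrt (real m1) * real U powr (\<eta> - 1 / 2))"
    unfolding H_def
    by (rule four_fold_weighted_sum[OF A.\<chi> B.\<chi> B.S S12 m(1) V(1,2) V56 \<eta>(1) \<eta>100 l P])
  have Xr: "real U powr \<eta> * real V powr \<eta> = real X powr \<eta>" "real (U * V) powr \<eta> = real X powr \<eta>"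
    using m by (simp_all add: X flip: powr_mult)
  have half: "real V powr (\<eta> - 1 / 2) = real V powr \<eta> / t ^ 240" "real U powr (\<eta> - 1 / 2) = real U powr \<eta> / t ^ 600"
    using sq by (simp_all add: powr_diff powr_half_sqrt)
  have t4: "t ^ 4 \<ge> 447"
    using power_mono[OF t(2), of 4] by (simp add: power_divide)
  have tiny: "b / t ^ (a + 3 * j) \<le> b / 100 ^ j / t ^ a" if "b \<ge> 0" for a j and b :: real
  proof -
    have "b / t ^ (a + 3 * j) = b / t ^ (3 * j) / t ^ a" by (simp add: power_add)
    also have "\<dots> \<le> b / 100 ^ j / t ^ a" using t100[of j] t0 that by (intro divide_right_mono divide_left_mono) auto
    finally show ?thesis .
  qed
  have H: "\<bar>H\<bar> \<le> 3 / t\<^sup>2"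
  proof -
    have L: "L \<le> 797 / 1000 * t ^ 4" "L \<ge> 0" using t(4) m by (simp_all add: L_def)
    \<comment> \<open>Cutting at m2^3 leaves 2 m2 m2^3 / U = 2 / m2 below the cut and 2 m1 m2 / m2^3
      \<le> 2 / m2 above it.\<close>
    have A13: "1 \<le> m2 ^ 3" "m2 ^ 3 \<le> U" unfolding U_def using m by (auto intro: power_increasing)
    have 12: "\<bar>\<chi>1 n * \<chi>2 n\<bar> \<le> 1" for n
      using mult_mono[OF cmult_funD(4)[OF A.\<chi>, of n] cmult_funD(4)[OF B.\<chi>, of n]] by (simp add: abs_mult)
    have VU: "m2\<^sup>2 \<le> U" using V(2) by (simp add: V_def)
    have "\<bar>H\<bar> \<le> (1 + ln (real (m2 ^ 3))) * (\<bar>\<Sum>b=1..U. \<chi>2 b / real b\<bar> + 2 * real m2 * real (m2 ^ 3) / real U)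
      + (1 + ln (real U)) * (2 * (real m1 * real m2) / real (m2 ^ 3))"
      unfolding H_def by (rule twisted_divisor_sum_over_bound[OF B.\<chi> 12 B.S S12 A13])
    also have "ln (real (m2 ^ 3)) = 3 * L" using m by (simp add: L_def ln_realpow)
    also have "ln (real U) = 5 * L" using m by (simp add: L_def U_def ln_realpow)
    also have "2 * real m2 * real (m2 ^ 3) / real U = 2 / t ^ 240"
      using m t(1) t0 by (simp add: U_def field_simps flip: power_Suc power_add)
    finally have "\<bar>H\<bar> \<le> (1 + 3 * L) * (\<bar>\<Sum>b=1..U. \<chi>2 b / real b\<bar> + 2 / t ^ 240)
      + (1 + 5 * L) * (2 * (real m1 * real m2) / real (m2 ^ 3))" .
    also have "\<dots> \<le> (24 / 10 * t ^ 4) * (121 / 100 / t ^ 6 + 2 / t ^ 240) + (4 * t ^ 4) * (2 / t ^ 240)"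
    proof (intro add_mono mult_mono)
      show "1 + 3 * L \<le> 24 / 10 * t ^ 4" "1 + 5 * L \<le> 4 * t ^ 4" using L t4 by linarith+
      show "\<bar>\<Sum>b=1..U. \<chi>2 b / real b\<bar> \<le> 121 / 100 / t ^ 6" using B.abs_L_partial_sum_le[OF VU] by (simp add: t_def)
      have "2 * (real m1 * real m2) / real (m2 ^ 3) \<le> 2 * (real m2 * real m2) / real (m2 ^ 3)"
        using less by (intro divide_right_mono mult_left_mono mult_right_mono) auto
      also have "\<dots> = 2 / t ^ 240" using m t(1) t0 by (simp add: power3_eq_cube field_simps)
      finally show "2 * (real m1 * real m2) / real (m2 ^ 3) \<le> 2 / t ^ 240" .
    qed (use L t0 in auto)
    also have "\<dots> = 2904 / 1000 / t\<^sup>2 + 128 / 10 / t ^ (2 + 3 * 78)"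
      using t0 by (simp add: field_simps flip: power_add)
    also have "\<dots> \<le> 2904 / 1000 / t\<^sup>2 + 128 / 10 / 100 ^ 78 / t\<^sup>2" by (intro add_left_mono tiny) simp
    also have "\<dots> = (2904 / 1000 + 128 / 10 / 100 ^ 78) / t\<^sup>2" by (rule add_divide_distrib[symmetric])
    also have "\<dots> \<le> 3 / t\<^sup>2" by (intro divide_right_mono) simp_all
    finally show ?thesis .
  qed
  \<comment> \<open>X is t^1680, and 1680 * 1815 / 10^7 is below 1 / 2.\<close>
  have Xt: "real X powr \<eta> \<le> sqrt t"
  proof -
    have "real X powr \<eta> = t powr (1680 * \<eta>)"
      unfolding reals powr_realpow[OF t0, symmetric, of 1680] by (simp only: powr_powr of_nat_numeral)
    also have "\<dots> \<le> t powr (1 / 2)" using \<eta>' t(2) by (intro powr_mono) auto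
    finally show ?thesis using t0 by (simp add: powr_half_sqrt)
  qed
  have e1: "7 / 2 * real U powr \<eta> * (57 * sqrt (real m1) * real V powr (\<eta> - 1 / 2)) \<le> sqrt t * (200 / t ^ 120)"
  proof -
    have "7 / 2 * real U powr \<eta> * (57 * sqrt (real m1) * real V powr (\<eta> - 1 / 2)) = real X powr \<eta> * (399 / 2 * sqrt (real m1) / t ^ 240)"
      unfolding half Xr(1)[symmetric] by simp
    also have "\<dots> \<le> sqrt t * (200 * t ^ 120 / t ^ 240)"
      using Xt sm1 t0 by (intro mult_mono divide_right_mono) auto
    also have "200 * t ^ 120 / t ^ 240 = 200 / t ^ 120" using t0 by (simp add: field_simps flip: power_add)
    finally show ?thesis .
  qed
  have e2: "7 / 2 * real V powr \<eta> * (15 * real m2 * sqrt (real m1) * real U powr (\<eta> - 1 / 2)) \<le> sqrt t * (53 / t ^ 240)"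
  proof -
    have "7 / 2 * real V powr \<eta> * (15 * real m2 * sqrt (real m1) * real U powr (\<eta> - 1 / 2)) = real X powr \<eta> * (105 / 2 * (real m2 * sqrt (real m1)) / t ^ 600)"
      unfolding half Xr(1)[symmetric] by simp
    also have "\<dots> \<le> sqrt t * (53 * (t ^ 240 * t ^ 120) / t ^ 600)"
      using Xt sm1 t0 reals(3) by (intro mult_mono divide_right_mono) auto
    also have "53 * (t ^ 240 * t ^ 120) / t ^ 600 = 53 / t ^ 240" using t0 by (simp add: field_simps flip: power_add)
    finally show ?thesis .
  qed
  have "l / \<eta> * real (U * V) powr \<eta> * \<bar>H\<bar> \<le> 49 / 20 * sqrt t * (3 / t\<^sup>2)"
    using l \<eta> Xt H Xr(2) t0 by (intro mult_mono) auto
  then have "1 \<le> sqrt t * (147 / 20 / t\<^sup>2 + 200 / t ^ 120 + 53 / t ^ 240)"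
    using ff e1 e2 by (simp add: distrib_left)
  also have "\<dots> \<le> sqrt t * (8 / t\<^sup>2)"
  proof (rule mult_left_mono)
    have a: "200 / t ^ 120 \<le> 1 / 100 / t\<^sup>2"
    proof -
      have "200 / t ^ 120 = 200 / t ^ (2 + 1 + 3 * 39)" by simp
      also have "\<dots> \<le> 200 / 100 ^ 39 / t ^ (2 + 1)" by (rule tiny) simp
      also have "\<dots> \<le> 200 / 100 ^ 39 / t ^ 2" using t(2) by (intro divide_left_mono power_increasing) auto
      also have "\<dots> \<le> 1 / 100 / t\<^sup>2" by (intro divide_right_mono) simp_all
      finally show ?thesis .
    qed
    have "53 / t ^ 240 \<le> 200 / t ^ 120" using t(2) by (intro frac_le power_increasing) auto
    moreover have "147 / 20 / t\<^sup>2 + 1 / 100 / t\<^sup>2 + 1 / 100 / t\<^sup>2 \<le> 8 / t\<^sup>2" using t0 by (simp add: field_simps)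
    ultimately show "147 / 20 / t\<^sup>2 + 200 / t ^ 120 + 53 / t ^ 240 \<le> 8 / t\<^sup>2" using a by linarith
  qed (use t0 in auto)
  finally have "t\<^sup>2 \<le> 8 * sqrt t" using t0 by (simp add: field_simps)
  then have "(t\<^sup>2)\<^sup>2 \<le> (8 * sqrt t)\<^sup>2" by (intro power_mono) auto
  then have "t * t ^ 3 \<le> t * 64" using t0 by (simp add: power_mult_distrib flip: power_mult power_Suc)
  then show False using t(3) t0 by simp
qed

section \<open>Exceptional moduli\<close>

lemma real_char_mult:
  assumes f: "real_char m f" and g: "real_char n g"
  shows "real_char (m * n) (\<lambda>a. f a * g a)"
  unfolding real_char_def
proof (intro conjI allI)
  note F = real_charD[OF f] and G = real_charD[OF g]
  show "m * n > 0" using F(1) G(1) by simp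
  fix a b :: int
  have "[a + int (m * n) = a] (mod int m)" "[a + int (m * n) = a] (mod int n)"
    by (simp_all add: cong_iff_dvd_diff)
  then show "f (a + int (m * n)) * g (a + int (m * n)) = f a * g a" using F(5) G(5) by metis
  show "f (a * b) * g (a * b) = f a * g a * (f b * g b)" by (simp add: F(2) G(2))
  show "f a * g a = 0 \<longleftrightarrow> \<not> coprime a (int (m * n))" using F(3)[of a] G(3)[of a] by auto
  show "f a * g a \<in> {-1, 0, 1}" using F(4)[of a] G(4)[of a] by auto
qed

text \<open>Multiplication by \<open>c\<close> permutes the residues and changes the sign of every
  value, so the sum over a period equals its own negative.\<close>

lemma real_char_period_sum:
  assumes f: "real_char k f" and c: "f c = -1"
  shows "(\<Sum>a<k. f (int (n + a))) = 0"
proof -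
  note F = real_charD[OF f]
  let ?I = "{0..<int k}" and ?g = "\<lambda>x. (c * x) mod int k"
  have cop: "coprime c (int k)" using F(3)[of c] c by auto
  have k: "int k > 0" using F(1) by simp
  have inj: "inj_on ?g ?I"
  proof (rule inj_onI)
    fix x y assume xy: "x \<in> ?I" "y \<in> ?I" "?g x = ?g y"
    have "[c * x = c * y] (mod int k)" using xy(3) by (simp add: cong_def)
    then have "[x = y] (mod int k)" using cop by (simp add: cong_mult_lcancel)
    then show "x = y" using xy(1,2) by (intro cong_less_imp_eq_int[of x "int k" y]) auto
  qed
  have "?g ` ?I = ?I" by (rule endo_inj_surj[OF _ _ inj]) (use k in auto)
  then have "(\<Sum>x\<in>?I. f x) = (\<Sum>x\<in>?g ` ?I. f x)" by simp
  also have "\<dots> = (\<Sum>x\<in>?I. f (?g x))" by (rule sum.reindex_cong[OF inj]) auto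
  also have "\<dots> = (\<Sum>x\<in>?I. - f x)"
  proof (rule sum.cong)
    fix x
    have "f (?g x) = f (c * x)" by (rule F(5)) (simp add: cong_def)
    then show "f (?g x) = - f x" by (simp add: F(2) c)
  qed simp
  finally have "(\<Sum>x\<in>?I. f x) = 0" by (simp add: sum_negf)
  moreover have "(\<Sum>x\<in>?I. f x) = (\<Sum>a<k. f (int a))"
    by (rule sum.reindex_cong[of int]) (auto simp: image_int_atLeastLessThan[of 0 k, simplified] atLeast0LessThan[symmetric])
  ultimately have z: "(\<Sum>a<k. f (int a)) = 0" by simp
  show ?thesis
  proof (induction n)
    case (Suc n)
    have "f (int (n + k)) = f (int n)" by (rule F(5)) (simp add: cong_iff_dvd_diff)
    moreover have "(\<Sum>a<Suc k. f (int (n + a))) = f (int n) + (\<Sum>a<k. f (int (Suc n + a)))"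
      unfolding sum.lessThan_Suc_shift by simp
    ultimately show ?case using Suc by simp
  qed (use z in simp)
qed

text \<open>Full periods cancel and the remainder is shorter than \<open>k\<close>. This trivial
  bound is enough because it is applied at lengths that are large powers of the moduli.\<close>

lemma real_char_partial_sum:
  assumes f: "real_char k f" and c: "f c = -1"
  shows "\<bar>\<Sum>a=1..n. f (int a)\<bar> \<le> real k"
proof (induction n rule: less_induct)
  case (less n)
  note F = real_charD[OF f]
  show ?case
  proof (cases "n < k")
    case True
    have "\<bar>\<Sum>a=1..n. f (int a)\<bar> \<le> (\<Sum>a=1..n. 1)" by (rule order.trans[OF sum_abs sum_mono]) (rule F(7))
    then show ?thesis using True by simp
  next
    case False
    define j where "j = n - k"
    have n: "n = j + k" using False by (simp add: j_def)
    have "(\<Sum>a=1..n. f (int a)) = (\<Sum>a=1..j. f (int a)) + (\<Sum>a=Suc j..n. f (int a))"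
      by (rule sum_tail_split) (simp add: n)
    also have "(\<Sum>a=Suc j..n. f (int a)) = (\<Sum>a<k. f (int (Suc j + a)))"
      by (rule sum.reindex_bij_witness[of _ "\<lambda>a. Suc j + a" "\<lambda>a. a - Suc j"]) (auto simp: n)
    also have "\<dots> = 0" by (rule real_char_period_sum[OF assms])
    finally show ?thesis using less[of j] F(1) n by simp
  qed
qed

lemma coarse_prime_divisors:
  assumes "coarse m"
  shows "finite {p. prime p \<and> p dvd m}" "card {p. prime p \<and> p dvd m} \<le> 2" "\<Prod>{p. prime p \<and> p dvd m} = m"
    "prime q \<Longrightarrow> q dvd m \<Longrightarrow> \<exists>d. m = q * d \<and> coprime q d" "{p. prime p \<and> p dvd m} \<noteq> {}"
proof -
  let ?E = "{p. prime p \<and> p dvd m}"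
  have "finite ?E \<and> card ?E \<le> 2 \<and> \<Prod>?E = m \<and> ?E \<noteq> {} \<and>
      (\<forall>q. prime q \<and> q dvd m \<longrightarrow> (\<exists>d. m = q * d \<and> coprime q d))"
  proof (cases "prime m")
    case True
    then have "?E = {m}" by (auto simp: primes_dvd_imp_eq)
    then show ?thesis using True by (auto intro!: exI[of _ 1] dest: primes_dvd_imp_eq)
  next
    case False
    then obtain p q where pq: "prime p" "prime q" "p \<noteq> q" "m = p * q" using assms by (auto simp: coarse_def)
    then have E: "?E = {p, q}" by (auto simp: prime_dvd_mult_iff primes_dvd_imp_eq)
    have "coprime p q" "coprime q p" using pq by (simp_all add: primes_coprime)
    then have "\<exists>d. m = x * d \<and> coprime x d" if "x = p \<or> x = q" for x
      using that pq(4) by (metis mult.commute)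
    then have "\<forall>x. prime x \<and> x dvd m \<longrightarrow> (\<exists>d. m = x * d \<and> coprime x d)" using E by blast
    then show ?thesis unfolding E using pq by simp
  qed
  then show "finite ?E" "card ?E \<le> 2" "\<Prod>?E = m" "?E \<noteq> {}"
    "prime q \<Longrightarrow> q dvd m \<Longrightarrow> \<exists>d. m = q * d \<and> coprime q d" by blast+
qed

lemma coarse_prime_divisor_gt:
  assumes m: "coarse m" "m > 10 ^ 160" and q: "prime q" "q dvd m"
  shows "real q > real m powr (3 / 8)"
  using m
proof (cases rule: coarse_cases)
  case prime
  then have "q = m" using q by (simp add: primes_dvd_imp_eq)
  have "real m powr (3 / 8) < real m powr 1" using coarse_ln_gt(2)[OF m(2)] by (intro powr_less_mono) auto
  then show ?thesis using coarse_ln_gt(2)[OF m(2)] by (simp add: \<open>q = m\<close>)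
next
  case (semiprime p r)
  then have "q = p \<or> q = r" using q by (auto simp: prime_dvd_mult_iff primes_dvd_imp_eq)
  then show ?thesis using coarse_factor_gt(1)[OF m(2)] semiprime by metis
qed

text \<open>An argument that is 1 modulo n and modulo \<open>d\<close> is invisible to
  \<open>f\<close>, while its residue modulo the prime \<open>q\<close>, which does not divide n,
  can still be chosen to give the value -1 of the other character.\<close>

lemma exists_product_minus_one:
  assumes f: "real_char n f" and \<chi>: "primitive_character m \<chi>" "real_character \<chi>"
    and q: "prime q" "\<not> q dvd n" "m = q * d" "coprime q d"
  shows "\<exists>c. f c * Re (\<chi> c) = -1"
proof -
  have c: "dirichlet_character m \<chi>" using \<chi> by (simp add: primitive_character_def)
  note F = real_charD[OF f] and G = real_charD[OF real_char_Re(1)[OF c \<chi>(2)]]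
  obtain c where c: "[c = 1] (mod int d)" "Re (\<chi> c) = -1"
    using primitive_exists_minus_one[OF \<chi> q(3,4,1)] by blast
  have "coprime q (n * d)" using q by (simp add: prime_imp_coprime)
  then have "coprime (int q) (int n * int d)" by (metis coprime_int_iff of_nat_mult)
  then obtain x where x: "[x = c] (mod int q)" "[x = 1] (mod int n * int d)" using binary_chinese_remainder_int by blast
  have "[x = 1] (mod int n)" "[x = 1] (mod int d)"
    using x(2) cong_modulus_mult[of x 1 "int n" "int d"] cong_modulus_mult[of x 1 "int d" "int n"]
    by (simp_all add: mult.commute)
  then have "f x = 1" "[x = c] (mod int d)" using F(5,6) c(1) by (metis, metis cong_sym cong_trans)
  moreover have "[x = c] (mod int q * int d)"
    using x(1) calculation(2) q(4) by (intro coprime_cong_mult) auto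
  ultimately have "f x * Re (\<chi> x) = -1" using G(5)[of x c] c(2) by (simp add: q(3))
  then show ?thesis by blast
qed

text \<open>A coarse number is the product of its distinct prime divisors, so different coarse
  moduli have different prime sets and some prime divides exactly one of them.\<close>

lemma coarse_product_minus_one:
  assumes m: "coarse m" "coarse n" "m \<noteq> n"
    and \<chi>: "primitive_character m \<chi>" "real_character \<chi>" and \<psi>: "primitive_character n \<psi>" "real_character \<psi>"
  shows "\<exists>c. Re (\<chi> c) * Re (\<psi> c) = -1"
proof -
  have c: "dirichlet_character m \<chi>" "dirichlet_character n \<psi>" using \<chi> \<psi> by (simp_all add: primitive_character_def)
  note R = real_char_Re(1)[OF c(1) \<chi>(2)] real_char_Re(1)[OF c(2) \<psi>(2)]
  have "{p. prime p \<and> p dvd m} \<noteq> {p. prime p \<and> p dvd n}"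
    using coarse_prime_divisors(3)[OF m(1)] coarse_prime_divisors(3)[OF m(2)] m(3) by metis
  then consider q where "prime q" "q dvd m" "\<not> q dvd n" | q where "prime q" "q dvd n" "\<not> q dvd m" by blast
  then show ?thesis
  proof cases
    case 1
    then obtain d where "m = q * d" "coprime q d" using coarse_prime_divisors(4)[OF m(1)] by blast
    then show ?thesis using exists_product_minus_one[OF R(2) \<chi> 1(1,3)] by (metis mult.commute)
  next
    case 2
    then obtain d where "n = q * d" "coprime q d" using coarse_prime_divisors(4)[OF m(2)] by blast
    then show ?thesis using exists_product_minus_one[OF R(1) \<psi> 2(1,3)] by blast
  qed
qed

text \<open>The logarithm is bounded by its tangent at 464, which is 10^(8/3) rounded down and thus
  nearly the smallest value of t^4. With 60 ln 464 \<le> 160 ln 10 < 369.6 the tangent lies below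
  0.797 t^4 from t^4 = 464 on.\<close>

lemma coarse_parameter:
  fixes m :: nat
  assumes m: "m > 10 ^ 160"
  defines "t \<equiv> real m powr (1 / 240)"
  shows "t ^ k = real m powr (real k / 240)" "real m = t ^ 240" "sqrt (real m) = t ^ 120"
    "real m powr (3 / 16) = t ^ 45" "real m powr (3 / 8) = t ^ 90"
    "t ^ 3 \<ge> 100" "t \<ge> 46 / 10" "ln (real m) \<le> 797 / 1000 * t ^ 4"
proof -
  have m0: "real m > 0" using coarse_ln_gt(2)[OF m] by (rule le_less_trans[rotated]) simp
  have t0: "t > 0" using m0 by (simp add: t_def)
  show tk: "t ^ k = real m powr (real k / 240)" for k
    using powr_realpow[OF t0, of k] by (simp add: t_def powr_powr)
  show m240: "real m = t ^ 240" using m0 by (simp add: tk)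
  show "sqrt (real m) = t ^ 120" using m0 by (simp add: tk powr_half_sqrt)
  show "real m powr (3 / 16) = t ^ 45" "real m powr (3 / 8) = t ^ 90" by (simp_all add: tk)
  have "(100::real) = 10 powr (160 * (3 / 240))" by simp
  also have "\<dots> \<le> real m powr (real 3 / 240)" using powr_ge_10_powr[OF coarse_ln_gt(2)[OF m], of "3 / 240"] by simp
  finally show t3: "t ^ 3 \<ge> 100" unfolding tk .
  show "t \<ge> 46 / 10"
  proof (rule ccontr)
    assume "\<not> ?thesis"
    then have "t ^ 3 \<le> (46 / 10) ^ 3" using t0 by (intro power_mono) auto
    then show False using t3 by (simp add: power_divide)
  qed
  have u: "t ^ 4 \<ge> 464"
  proof (rule ccontr)
    assume "\<not> ?thesis"
    then have "(t ^ 4) ^ 3 \<le> 464 ^ 3" using t0 by (intro power_mono) auto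
    moreover have "(t ^ 4) ^ 3 \<ge> 100 ^ 4" using power_mono[OF t3, of 4] by (simp flip: power_mult)
    ultimately show False by simp
  qed
  have l464: "3 * ln (464::real) \<le> 8 * ln 10"
  proof -
    have "3 * ln (464::real) = ln (464 ^ 3)" by (subst ln_realpow) auto
    also have "\<dots> \<le> ln (10 ^ 8)" by (subst ln_le_cancel_iff) auto
    also have "\<dots> = 8 * ln (10::real)" by (subst ln_realpow) auto
    finally show ?thesis .
  qed
  have "ln (real m) = 60 * ln (t ^ 4)" unfolding m240 using t0 by (simp add: ln_realpow)
  moreover have "ln (t ^ 4) = ln 464 + ln (t ^ 4 / 464)" using t0 by (simp add: ln_div)
  moreover have "ln (t ^ 4 / 464) \<le> t ^ 4 / 464 - 1" using t0 by (intro ln_le_minus_one) simp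
  ultimately show "ln (real m) \<le> 797 / 1000 * t ^ 4" using l464 ln_10_bounds(2) u by linarith
qed

text \<open>Beyond Y partial summation turns the density \<rho> of \<open>r\<close> into \<rho>
  times a harmonic sum.\<close>

lemma sum_over_le_of_linear:
  fixes r :: "nat \<Rightarrow> real"
  assumes YN: "Y \<le> N" and r: "\<And>n. r n \<ge> 0" and \<rho>: "\<rho> \<ge> 0"
    and R: "\<And>n. Y \<le> n \<Longrightarrow> n \<le> N \<Longrightarrow> (\<Sum>k=1..n. r k) \<le> \<rho> * real n"
  shows "(\<Sum>n=1..N. r n / real n) \<le> (\<Sum>n=1..Y. r n / real n) + \<rho> * (2 + ln (real (Suc N)))"
proof -
  let ?R = "\<lambda>n. \<Sum>k=1..n. r k"
  have R0: "?R n \<ge> 0" for n by (rule sum_nonneg) (rule r)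
  have "(\<Sum>n=Suc Y..N. r n * (1 / real n)) = ?R N * (1 / real (Suc N)) - ?R Y * (1 / real (Suc Y))
      + (\<Sum>n=Suc Y..N. ?R n * (1 / real n - 1 / real (Suc n)))"
    by (rule abel_summation[OF YN])
  moreover have "?R N * (1 / real (Suc N)) \<le> \<rho>"
  proof -
    have "?R N * (1 / real (Suc N)) \<le> \<rho> * real N * (1 / real (Suc N))" using R[OF YN] by (intro mult_right_mono) auto
    also have "\<dots> \<le> \<rho>" using \<rho> by (simp add: divide_le_eq mult_left_mono)
    finally show ?thesis .
  qed
  moreover have "?R Y * (1 / real (Suc Y)) \<ge> 0" using R0 by simp
  moreover have "(\<Sum>n=Suc Y..N. ?R n * (1 / real n - 1 / real (Suc n))) \<le> \<rho> * (1 + ln (real (Suc N)))"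
  proof -
    have "(\<Sum>n=Suc Y..N. ?R n * (1 / real n - 1 / real (Suc n))) \<le> (\<Sum>n=Suc Y..N. \<rho> * (1 / real (Suc n)))"
    proof (rule sum_mono)
      fix n assume n: "n \<in> {Suc Y..N}"
      have "1 / real n - 1 / real (Suc n) = 1 / (real n * real (Suc n))" using n by (simp add: field_simps)
      then have "?R n * (1 / real n - 1 / real (Suc n)) \<le> \<rho> * real n * (1 / (real n * real (Suc n)))"
        using R[of n] n \<rho> by (intro mult_mono) (auto intro: R0)
      also have "\<dots> = \<rho> * (1 / real (Suc n))" using n by simp
      finally show "?R n * (1 / real n - 1 / real (Suc n)) \<le> \<rho> * (1 / real (Suc n))" .
    qed
    also have "\<dots> = \<rho> * (\<Sum>n=Suc Y..N. 1 / real (Suc n))" by (simp only: sum_distrib_left)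
    also have "(\<Sum>n=Suc Y..N. 1 / real (Suc n)) = (\<Sum>n=Suc (Suc Y)..Suc N. 1 / real n)"
      by (simp only: sum.shift_bounds_cl_Suc_ivl)
    also have "\<dots> \<le> (\<Sum>n=1..Suc N. 1 / real n)" by (rule sum_mono2) auto
    also have "\<dots> \<le> 1 + ln (real (Suc N))" by (rule sum_inverse_le_ln) simp
    finally show ?thesis using \<rho> by (simp add: mult_left_mono)
  qed
  moreover have "(\<Sum>n=1..N. r n / real n) = (\<Sum>n=1..Y. r n / real n) + (\<Sum>n=Suc Y..N. r n / real n)"
    by (rule sum_tail_split[OF YN])
  ultimately show ?thesis by (simp add: distrib_left)
qed

lemma exceptional_modulus_sparse:
  assumes m: "coarse m" "m > 10 ^ 160" and \<chi>: "primitive_character m \<chi>" "real_character \<chi>"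
    and no: "\<And>p::nat. prime p \<Longrightarrow> real p \<le> 4 * real m powr (1 / 2) / ln (real m) \<Longrightarrow> \<chi> (int p) \<noteq> 1"
  shows "sparse_divisor_sum (\<lambda>n. Re (\<chi> (int n))) m (real m powr (1 / 240))"
proof -
  define t where "t = real m powr (1 / 240)"
  define L where "L = ln (real m)"
  define f where "f a = Re (\<chi> a)" for a
  define r where "r = divisor_sum (\<lambda>n. f (int n))"
  define Y where "Y = nat \<lfloor>4 * t ^ 120 / L\<rfloor>"
  let ?E = "{p. prime p \<and> p dvd m}"
  note T = coarse_parameter[OF m(2), folded t_def]
  note E = coarse_prime_divisors[OF m(1)]
  have L366: "L > 366" using coarse_ln_gt[OF m(2)] by (simp add: L_def)
  have L797: "L \<le> 797 / 1000 * t ^ 4" using T(8) by (simp add: L_def)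
  have dc: "dirichlet_character m \<chi>" using \<chi> by (simp add: primitive_character_def)
  have rc: "real_char m f" using real_char_Re(1)[OF dc \<chi>(2)] by (simp add: f_def[abs_def])
  have cm: "cmult_fun (\<lambda>n. f (int n))" by (rule cmult_fun_real_char[OF rc])
  have cop: "coprime (int a) (int m)" if a: "1 \<le> a" "real a \<le> real m powr (3 / 8)" for a
  proof (rule ccontr)
    assume "\<not> ?thesis"
    then have "gcd a m \<noteq> 1" by (metis coprime_iff_gcd_eq_1 coprime_int_iff)
    then obtain q where q: "prime q" "q dvd gcd a m" using prime_factor_nat by blast
    then have "real q > real m powr (3 / 8)" using coarse_prime_divisor_gt[OF m q(1)] by simp
    moreover have "q \<le> a" using q a(1) by (auto intro: dvd_imp_le)
    ultimately show False using a(2) by linarith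
  qed
  have quartic: "\<bar>\<Sum>x\<in>{0..<int m}. f (\<Prod>j<4. x + \<beta> j)\<bar> \<le> 100 * sqrt (real m)"
    if "\<And>j. j < 4 \<Longrightarrow> \<beta> j \<in> {1..B}" "real_of_int B \<le> real m powr (3 / 8)" "odd (card {j. j < 4 \<and> \<beta> j = c})"
    for \<beta> :: "nat \<Rightarrow> int" and B c
    unfolding f_def by (rule quartic_sum_coarse[OF m \<chi> that])
  have burgess: "\<bar>\<Sum>n\<in>{M<..M + int N}. f n\<bar> \<le> L * t ^ 45 / 10 * sqrt (real N)" if "real N \<le> sqrt (real m)" for M N
    unfolding L_def T(4)[symmetric]
    by (rule burgess_bound[OF rc coarse_ln_gt(2)[OF m(2)] coarse_ln_gt(1)[OF m(2)]]) (fact cop quartic that)+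
  have Yle: "real Y \<le> 4 * t ^ 120 / L"
    unfolding Y_def using L366 T(7) by (intro of_nat_floor) (simp add: zero_le_divide_iff)
  have "4 * t ^ 120 / L \<le> 4 * t ^ 120 / 4" using L366 T(7) by (intro divide_left_mono) auto
  then have Y120: "real Y \<le> t ^ 120" using Yle by simp
  have t4: "t > 4" using T(7) by simp
  \<comment> \<open>Every prime factor of m exceeds m^(3/8) = t^90, and Y \<le> t^120 is below its
    square t^180.\<close>
  interpret exc: exceptional "\<lambda>n. f (int n)" Y "t ^ 90" ?E
  proof
    show "f (int p) \<noteq> 1" if "prime p" "p \<le> Y" for p
    proof -
      have "real p \<le> 4 * real m powr (1 / 2) / ln (real m)"
        using that(2) Yle by (simp add: powr_half_sqrt T(3) L_def)
      then have "\<chi> (int p) \<noteq> 1" using no that(1) by blast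
      then show ?thesis using real_char_Re(2)[OF dc \<chi>(2), of "int p"] by (auto simp: f_def)
    qed
    show "p \<in> ?E" if "prime p" "f (int p) = 0" for p
    proof -
      have "\<not> coprime p m" using real_charD(3)[OF rc, of "int p"] that(2) by simp
      then show ?thesis using that(1) prime_imp_coprime by blast
    qed
    show "t ^ 90 \<le> real p" if "p \<in> ?E" for p using coarse_prime_divisor_gt[OF m, of p] that by (simp add: T(5))
    show "t ^ 90 > 1" using t4 by simp
    have "t ^ 120 < t ^ 180" using t4 by (intro power_strict_increasing) auto
    then show "real Y < (t ^ 90)\<^sup>2" using Y120 by (simp flip: power_mult)
  qed (use E(1,2) cm in auto)
  have R: "(\<Sum>n=1..N. r n) \<le> 6 / 5 / t ^ 6 * real N" if N: "Y \<le> N" "N \<le> m\<^sup>2" for N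
    unfolding r_def
    by (rule divisor_sum_small[OF rc _ T(6) t4 T(3) L_def L366 L797 Y_def exc.sum_divisor_sum_le[OF order.refl] N]) (fact burgess)
  have Ym: "Y \<le> m\<^sup>2"
  proof -
    have "real Y \<le> t ^ 480" using Y120 power_increasing[of 120 480 t] t4 by linarith
    also have "t ^ 480 = (real m)\<^sup>2" unfolding T(2) by (simp flip: power_mult)
    finally show ?thesis by (metis of_nat_le_iff of_nat_power)
  qed
  have r0: "n > 0 \<Longrightarrow> r n \<ge> 0" for n using divisor_sum_nonneg[OF cm] by (simp add: r_def)
  have p: "(\<Sum>n=1..m\<^sup>2. r n / real n) \<le> 21 / 10"
  proof -
    \<comment> \<open>The bound below asks for nonnegativity at every index, whereas
      \<open>r0\<close> covers only positive ones; the value at 0 enters no sum.\<close>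
    define w where "w n = (if n = 0 then 0 else r n)" for n
    have w: "(\<Sum>k=1..n. w k) = (\<Sum>k=1..n. r k)" "(\<Sum>k=1..n. w k / real k) = (\<Sum>k=1..n. r k / real k)" for n
      by (auto intro!: sum.cong simp: w_def)
    have "(\<Sum>n=1..m\<^sup>2. w n / real n) \<le> (\<Sum>n=1..Y. w n / real n) + 6 / 5 / t ^ 6 * (2 + ln (real (Suc (m\<^sup>2))))"
    proof (rule sum_over_le_of_linear[OF Ym])
      show "(\<Sum>k=1..n. w k) \<le> 6 / 5 / t ^ 6 * real n" if "Y \<le> n" "n \<le> m\<^sup>2" for n
        unfolding w by (rule R[OF that])
    qed (use t4 r0 in \<open>auto simp: w_def\<close>)
    also have "(\<Sum>n=1..Y. w n / real n) \<le> 2 + 4 / t ^ 90"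
      unfolding w r_def by (rule exc.sum_divisor_sum_over_le) simp
    also have "6 / 5 / t ^ 6 * (2 + ln (real (Suc (m\<^sup>2)))) \<le> 6 / 5 / t ^ 6 * (1607 / 1000 * t ^ 4)"
    proof (rule mult_left_mono)
      have m1: "m > 1" using m(2) by (rule order.strict_trans[rotated]) simp
      have "real (Suc (m\<^sup>2)) \<le> 2 * (real m)\<^sup>2" using m1 by (simp add: of_nat_le_iff[of 1 "m\<^sup>2", simplified] flip: of_nat_power)
      then have "ln (real (Suc (m\<^sup>2))) \<le> ln (2 * (real m)\<^sup>2)" using m1 by (subst ln_le_cancel_iff) (auto intro: add_pos_nonneg)
      also have "\<dots> = ln 2 + 2 * L" using m1 by (simp add: ln_mult ln_realpow L_def)
      also have "ln (2::real) \<le> 1" using ln_le_minus_one[of "2::real"] by simp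
      finally have "2 + ln (real (Suc (m\<^sup>2))) \<le> 3 + 2 * L" by simp
      moreover have "t ^ 4 \<ge> 447" using power_mono[OF T(7), of 4] by (simp add: power_divide)
      ultimately show "2 + ln (real (Suc (m\<^sup>2))) \<le> 1607 / 1000 * t ^ 4" using T(8) unfolding L_def by linarith
    qed (use t4 in auto)
    also have "6 / 5 / t ^ 6 * (1607 / 1000 * t ^ 4) = 19284 / 10000 / t\<^sup>2"
      using t4 by (simp add: field_simps flip: power_add)
    also have "\<dots> \<le> 19284 / 10000 / 21"
    proof (rule divide_left_mono)
      show "21 \<le> t\<^sup>2" using power_mono[OF T(7), of 2] by (simp add: power_divide)
    qed (use t4 in auto)
    also have "4 / t ^ 90 \<le> 4 / 1000"
    proof (rule divide_left_mono)
      have "(1000::real) \<le> 100 ^ 30" by simp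
      also have "\<dots> \<le> (t ^ 3) ^ 30" using T(6) by (rule power_mono) simp
      finally show "1000 \<le> t ^ 90" by (simp flip: power_mult)
    qed (use t4 in auto)
    finally show ?thesis unfolding w by simp
  qed
  obtain q where q: "prime q" "q dvd m" using E(5) by auto
  then obtain d where d: "m = q * d" "coprime q d" using E(4) by blast
  obtain c where c: "f c = -1"
    using primitive_exists_minus_one[OF \<chi> d q(1)] by (auto simp: f_def)
  show ?thesis
    unfolding f_def[symmetric] t_def[symmetric]
  proof
    show "\<bar>\<Sum>a=1..n. f (int a)\<bar> \<le> real m" for n by (rule real_char_partial_sum[OF rc c])
    show "(\<Sum>n=1..m\<^sup>2. divisor_sum (\<lambda>n. f (int n)) n) \<le> 6 / 5 / t ^ 6 * (real m)\<^sup>2"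
      using R[OF Ym order.refl] by (simp add: r_def)
    show "(\<Sum>n=1..m\<^sup>2. divisor_sum (\<lambda>n. f (int n)) n / real n) \<le> 21 / 10" using p by (simp add: r_def)
  qed (fact T cm)+
qed

theorem theorem10p2:
  shows "\<exists>\<^sub>\<le>\<^sub>1 m::nat. coarse m \<and> m > 10 ^ 160 \<and>
           \<not> (\<forall>\<chi>. primitive_character m \<chi> \<and> real_character \<chi> \<longrightarrow>
                (\<exists>p::nat. prime p \<and> real p \<le> 4 * real m powr (1 / 2) / ln (real m) \<and> \<chi> (int p) = 1))"
proof -
  let ?exc = "\<lambda>m \<chi>. coarse m \<and> m > 10 ^ 160 \<and> primitive_character m \<chi> \<and> real_character \<chi> \<and>
    \<not> (\<exists>p::nat. prime p \<and> real p \<le> 4 * real m powr (1 / 2) / ln (real m) \<and> \<chi> (int p) = 1)"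
  \<comment> \<open>The two moduli have different roles, the smaller one providing \<eta> and the
    larger one the saving, so they are ordered before being compared.\<close>
  have contradiction: False if e: "?exc m \<chi>" "?exc n \<psi>" and less: "m < n" for m n \<chi> \<psi>
  proof -
    have sparse: "sparse_divisor_sum (\<lambda>k. Re (\<chi> (int k))) m (real m powr (1 / 240))"
      "sparse_divisor_sum (\<lambda>k. Re (\<psi> (int k))) n (real n powr (1 / 240))"
      using e by (blast intro: exceptional_modulus_sparse)+
    have "m \<noteq> n" using less by simp
    then obtain c where c: "Re (\<chi> c) * Re (\<psi> c) = -1"
      using coarse_product_minus_one[of m n \<chi> \<psi>] e by blast
    have rc: "real_char (m * n) (\<lambda>a. Re (\<chi> a) * Re (\<psi> a))"
      using e by (intro real_char_mult real_char_Re(1)) (auto simp: primitive_character_def)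
    have "\<bar>\<Sum>a=1..k. Re (\<chi> (int a)) * Re (\<psi> (int a))\<bar> \<le> real m * real n" for k
      using real_char_partial_sum[OF rc c, of k] by simp
    from two_sparse_divisor_sums[OF sparse this less] show False .
  qed
  show ?thesis
    unfolding Uniq_def
  proof (intro allI impI)
    fix m n :: nat
    assume "coarse m \<and> m > 10 ^ 160 \<and> \<not> (\<forall>\<chi>. primitive_character m \<chi> \<and> real_character \<chi> \<longrightarrow>
        (\<exists>p::nat. prime p \<and> real p \<le> 4 * real m powr (1 / 2) / ln (real m) \<and> \<chi> (int p) = 1))"
      and "coarse n \<and> n > 10 ^ 160 \<and> \<not> (\<forall>\<chi>. primitive_character n \<chi> \<and> real_character \<chi> \<longrightarrow>
        (\<exists>p::nat. prime p \<and> real p \<le> 4 * real n powr (1 / 2) / ln (real n) \<and> \<chi> (int p) = 1))"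
    then obtain \<chi> \<psi> where e: "?exc m \<chi>" "?exc n \<psi>" by blast
    have "\<not> m < n" using contradiction[OF e] by blast
    moreover have "\<not> n < m" using contradiction[OF e(2,1)] by blast
    ultimately show "m = n" by linarith
  qed
qed

end
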